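(* Let $V\subseteq Y\subseteq X\subseteq H\subseteq X'\subseteq Y'\subseteq V'$ be a chain of spaces with continuous imbeddings, where $V,H$ are Hilbert spaces ($V$ dense in $H$, $H$ identified with its dual) and $X,Y$ are Banach spaces. Let $0<\alpha<\beta$ be real numbers, and assume that there exists $C_5>0$ such that $$\|u\|_X^{\alpha+2}\le C_5\left(\|u\|_H^2+\|u\|_Y^{\beta+2}\right)\qquad\forall u\in V.$$ Let $F:V\to\mathbb{R}$ and $g:(0,+\infty)\times V\to V'$ be functions such that: (i) $F$ is of class $C^1$, with gradient $\nabla F\in C^0(V,V')$; (ii) for every $T>0$ and every $v\in L^\infty((0,T),V)$ the function $t\mapsto g(t,v(t))$ belongs to $L^1((0,T),V')$; (iii) there exists $\delta_1>0$ such that $F(u)\ge \delta_1\|u\|_Y^{\beta+2}$ for all $u\in V$; (iv) there exists $\delta_2>0$ such that $\langle\nabla F(u),u\rangle_{V',V}\ge\delta_2F(u)$ for all $u\in V$; (v) there exists $\delta_4>0$ such that $F(u)\ge\delta_4\|u\|_H^2$ for all $u\in V$; (vi) there exists $\delta_3>0$ such that $\langle g(t,v),v\rangle_{V',V}\ge\delta_3\|v\|_X^{\alpha+2}$ for every $v\in V$ and almost every $t>0$; (vii) $g(t,v)\in X'$ for every $(t,v)\in(0,+\infty)\times V$, and there exists $D_4>0$ such that $\|g(t,v)\|_{X'}\le D_4\|v\|_X^{\alpha+1}$ for every $v\in V$ and almost every $t>0$. Then there exists a real number $D$, depending only on $\alpha$, $\beta$, the imbeddings in the chain of spaces, and the constants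 $\delta_1,\delta_2,\delta_3,\delta_4,D_4,C_5$ (in particular independent of $u$), such that every strong solution $u$ on $(0,+\infty)$ of $$u''(t)+\nabla F(u(t))+g(t,u'(t))=0$$ satisfies $$\|u'(t)\|_H^2+F(u(t))\le D\,t^{-2/\alpha}\qquad\forall t\ge 1.$$
   Context: In the chain $V\subseteq Y\subseteq X\subseteq H\subseteq X'\subseteq Y'\subseteq V'$, primes denote dual spaces; $V\subseteq H\subseteq V'$ is the usual Hilbert triple obtained by identifying $H$ with $H'$, all inclusions are continuous imbeddings, and the duality pairings are compatible (for $w\in X'$ and $u\in V$, $\langle w,u\rangle_{V',V}=\langle w,u\rangle_{X',X}$). For $0<T<+\infty$, a strong solution on $(0,T)$ of $u''(t)+\nabla F(u(t))+g(t,u'(t))=0$ is a function $u\in W^{1,\infty}((0,T),V)\cap W^{2,1}((0,T),V')$ for which the equation holds as an equality in $L^1((0,T),V')$. A strong solution on $(0,+\infty)$ is a function whose restriction to $(0,T)$ is a strong solution on $(0,T)$ for every $T>0$. Every strong solution belongs to $C^0([0,T],V)\cap C^1([0,T],H)$ for every $T>0$, so the values $u(t)\in V$ and $u'(t)\in H$ are well defined. *)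

theory Defs
  imports "HOL-Analysis.Analysis"
begin

section \<open>Bochner spaces\<close>

text \<open>
  The library's \<^const>\<open>has_bochner_integral\<close> is restricted to second countable
  codomains. Neither the Hilbert space $V$ nor its dual is assumed separable, so the textbook
  definition is given here for arbitrary normed spaces, on top of the library's simple functions.
\<close>

definition strongly_measurable :: "'a measure \<Rightarrow> ('a \<Rightarrow> 'b::topological_space) \<Rightarrow> bool" where
  "strongly_measurable M f \<longleftrightarrow>
    (\<exists>s. (\<forall>i. simple_function M (s i)) \<and> (AE x in M. (\<lambda>i. s i x) \<longlonglongrightarrow> f x))"

definition has_Bochner_integral ::
  "'a measure \<Rightarrow> ('a \<Rightarrow> 'b::real_normed_vector) \<Rightarrow> 'b \<Rightarrow> bool" where
  "has_Bochner_integral M f I \<longleftrightarrow>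
    strongly_measurable M f \<and>
    (\<exists>s. (\<forall>i. Bochner_Integration.simple_bochner_integrable M (s i)) \<and>
         (\<lambda>i. \<integral>\<^sup>+x. norm (f x - s i x) \<partial>M) \<longlonglongrightarrow> 0 \<and>
         (\<lambda>i. Bochner_Integration.simple_bochner_integral M (s i)) \<longlonglongrightarrow> I)"

definition Bochner_integral :: "'a measure \<Rightarrow> ('a \<Rightarrow> 'b::real_normed_vector) \<Rightarrow> 'b" where
  "Bochner_integral M f = (THE I. has_Bochner_integral M f I)"

text \<open>Below, functions on the interval $(0,T)$ are functions on the real line whose values
  outside the interval are irrelevant.\<close>

definition L_1 :: "real \<Rightarrow> (real \<Rightarrow> 'b::banach) \<Rightarrow> bool" where
  "L_1 T f \<longleftrightarrow> (\<exists>I. has_Bochner_integral (lebesgue_on {0<..<T}) f I)"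

definition L_infinity :: "real \<Rightarrow> (real \<Rightarrow> 'b::banach) \<Rightarrow> bool" where
  "L_infinity T f \<longleftrightarrow> strongly_measurable (lebesgue_on {0<..<T}) f \<and>
    (\<exists>C. AE t in lebesgue_on {0<..<T}. norm (f t) \<le> C)"

section \<open>Vector-valued Sobolev spaces\<close>

definition test_function :: "real \<Rightarrow> (real \<Rightarrow> real) \<Rightarrow> bool" where
  "test_function T \<phi> \<longleftrightarrow>
    (\<forall>n t. (deriv ^^ n) \<phi> field_differentiable at t) \<and>
    (\<exists>K. compact K \<and> K \<subseteq> {0<..<T} \<and> (\<forall>t. t \<notin> K \<longrightarrow> \<phi> t = 0))"

definition weak_derivative ::
  "real \<Rightarrow> (real \<Rightarrow> 'b::banach) \<Rightarrow> (real \<Rightarrow> 'b) \<Rightarrow> bool" where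
  "weak_derivative T f f' \<longleftrightarrow>
    (\<forall>\<phi>. test_function T \<phi> \<longrightarrow>
      Bochner_integral (lebesgue_on {0<..<T}) (\<lambda>t. deriv \<phi> t *\<^sub>R f t) =
      - Bochner_integral (lebesgue_on {0<..<T}) (\<lambda>t. \<phi> t *\<^sub>R f' t))"

text \<open>Membership in $W^{1,\infty}$ and $W^{2,1}$, with the weak derivatives as arguments.\<close>

definition W_1_infinity :: "real \<Rightarrow> (real \<Rightarrow> 'b::banach) \<Rightarrow> (real \<Rightarrow> 'b) \<Rightarrow> bool" where
  "W_1_infinity T f f' \<longleftrightarrow> L_infinity T f \<and> L_infinity T f' \<and> weak_derivative T f f'"

definition W_2_1 ::
  "real \<Rightarrow> (real \<Rightarrow> 'b::banach) \<Rightarrow> (real \<Rightarrow> 'b) \<Rightarrow> (real \<Rightarrow> 'b) \<Rightarrow> bool" where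
  "W_2_1 T f f' f'' \<longleftrightarrow> L_1 T f \<and> L_1 T f' \<and> L_1 T f'' \<and>
    weak_derivative T f f' \<and> weak_derivative T f' f''"

section \<open>The chain of spaces\<close>

text \<open>
  The four spaces are types; the inclusions $V \subseteq Y \subseteq X \subseteq H$ are bounded
  linear maps \<open>jVY\<close>, \<open>jYX\<close>, \<open>jXH\<close>. An inclusion
  $A \subseteq B$ induces $B' \to A'$ by restriction, and $H$ is identified with $H'$ through the
  Riesz map \<^const>\<open>blinfun_inner_right\<close>.
\<close>

definition dual_map :: "('a::real_normed_vector \<Rightarrow>\<^sub>L 'b::real_normed_vector) \<Rightarrow>
    ('b \<Rightarrow>\<^sub>L real) \<Rightarrow> ('a \<Rightarrow>\<^sub>L real)" where
  "dual_map j w = w o\<^sub>L j"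

definition pivot_map :: "('a::real_normed_vector \<Rightarrow>\<^sub>L 'h::real_inner) \<Rightarrow> 'h \<Rightarrow> ('a \<Rightarrow>\<^sub>L real)" where
  "pivot_map j h = dual_map j (blinfun_inner_right h)"

definition embedding_chain ::
  "('v::{real_inner,banach} \<Rightarrow>\<^sub>L 'y::banach) \<Rightarrow> ('y \<Rightarrow>\<^sub>L 'x::banach) \<Rightarrow>
   ('x \<Rightarrow>\<^sub>L 'h::{real_inner,banach}) \<Rightarrow> bool" where
  "embedding_chain jVY jYX jXH \<longleftrightarrow>
    inj (blinfun_apply jVY) \<and> inj (blinfun_apply jYX) \<and> inj (blinfun_apply jXH) \<and>
    inj (pivot_map jXH) \<and> inj (dual_map jYX) \<and> inj (dual_map jVY) \<and>
    closure (range (blinfun_apply (jXH o\<^sub>L jYX o\<^sub>L jVY))) = UNIV"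

text \<open>
  For an inclusion \<open>j\<close> of $A$ into $B$ with injective \<^term>\<open>dual_map j\<close>: the
  functionals on $A$ that belong to $B'$, and the norm in $B'$ of such a functional.
\<close>

definition dual_space :: "('a::real_normed_vector \<Rightarrow>\<^sub>L 'b::real_normed_vector) \<Rightarrow>
    ('a \<Rightarrow>\<^sub>L real) set" where
  "dual_space j = range (dual_map j)"

definition dual_norm :: "('a::real_normed_vector \<Rightarrow>\<^sub>L 'b::real_normed_vector) \<Rightarrow>
    ('a \<Rightarrow>\<^sub>L real) \<Rightarrow> real" where
  "dual_norm j w = norm (inv (dual_map j) w)"

section \<open>Strong solutions\<close>

text \<open>
  \<open>jVH\<close> is the inclusion of $V$ in $H$ and \<open>G\<close> is the gradient of $F$.
  An element of $W^{1,\infty}((0,T),V)$ is identified with its continuous representative, so that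
  \<open>u t\<close> is meaningful for every \<open>t\<close>.
\<close>

definition strong_solution_on ::
  "('v::{real_inner,banach} \<Rightarrow>\<^sub>L 'h::{real_inner,banach}) \<Rightarrow> ('v \<Rightarrow> ('v \<Rightarrow>\<^sub>L real)) \<Rightarrow>
   (real \<Rightarrow> 'v \<Rightarrow> ('v \<Rightarrow>\<^sub>L real)) \<Rightarrow> real \<Rightarrow> (real \<Rightarrow> 'v) \<Rightarrow> bool" where
  "strong_solution_on jVH G g T u \<longleftrightarrow>
    continuous_on {0<..<T} u \<and>
    (\<exists>u' u''. W_1_infinity T u u' \<and>
      W_2_1 T (\<lambda>t. pivot_map jVH (jVH (u t))) (\<lambda>t. pivot_map jVH (jVH (u' t))) u'' \<and>
      (AE t in lebesgue_on {0<..<T}. u'' t + G (u t) + g t (u' t) = 0))"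

definition global_strong_solution ::
  "('v::{real_inner,banach} \<Rightarrow>\<^sub>L 'h::{real_inner,banach}) \<Rightarrow> ('v \<Rightarrow> ('v \<Rightarrow>\<^sub>L real)) \<Rightarrow>
   (real \<Rightarrow> 'v \<Rightarrow> ('v \<Rightarrow>\<^sub>L real)) \<Rightarrow> (real \<Rightarrow> 'v) \<Rightarrow> bool" where
  "global_strong_solution jVH G g u \<longleftrightarrow> (\<forall>T>0. strong_solution_on jVH G g T u)"

text \<open>
  A strong solution is continuously differentiable as a function into $H$; its velocity is the
  classical derivative there.
\<close>

definition velocity :: "('v::{real_inner,banach} \<Rightarrow>\<^sub>L 'h::{real_inner,banach}) \<Rightarrow>
    (real \<Rightarrow> 'v) \<Rightarrow> real \<Rightarrow> 'h" where
  "velocity jVH u t = vector_derivative (\<lambda>s. jVH (u s)) (at t)"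

end

theory Submission
  imports Defs
begin

text \<open>
  With $E = \frac12 \|u'\|_H^2 + F(u)$ and a constant $\varepsilon$, the functional
  $E + \varepsilon \langle u', u\rangle_H$ decreases at rate at least
  $\frac12\varepsilon\delta_2\lambda$ as long as $\lambda \le E \le 2\lambda$, provided that
  $\varepsilon$ is a small multiple of $\min(\lambda^{\alpha/2}, \lambda^\gamma)$; the exponent
  $\gamma > 0$ exists because $\alpha < \beta$. Hence $E$ halves within a time of order
  $\lambda^{-\alpha/2} + \lambda^{-\gamma}$, and summing these times over all levels above $E(t)$
  bounds $t$ by a multiple of $E(t)^{-\alpha/2} + E(t)^{-\gamma}$, whatever the initial energy.

  To differentiate the energy, only $|\,\|u'(t)\|_H^2 - \|u'(s)\|_H^2| = |\langle u'(t) - u'(s), u'(t) + u'(s)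
  \rangle_{V',V}|$ is needed: it makes the energy absolutely continuous, and at almost every time it
  gives the derivative along some sequence from the right, which is enough for monotonicity.
\<close>

section \<open>Bochner integrals over non-separable spaces\<close>

text \<open>The power \<open>\<lambda> powr (\<alpha> / 2)\<close> has its source in the kinetic
  term: the damping controls only the power \<alpha> + 2 of the X-norm of u', so a quadratic term in
  u' is absorbed up to an error of size \<lambda> once \<epsilon> is a small multiple of that power.
  The pairing of g(t,u') with u must not spoil this. It leaves \<epsilon> to the power \<alpha> + 2
  times the same power of the X-norm of u, to be compared with \<epsilon> \<lambda>. For \<lambda>
  \<le> 1 the interpolation hypothesis bounds that power of the X-norm linearly in \<lambda>; for
  larger \<lambda> the imbedding of Y in X bounds it by \<lambda> to the power (\<alpha> + 2) /
  (\<beta> + 2) < 1, and this gap leaves room for \<gamma>. Freezing \<epsilon> on each dyadic level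
  avoids differentiating a power of the energy.

  The regularity obstacle is that u' is merely bounded and measurable into V, and u'' merely
  integrable into V'. Pointwise statements are therefore made at Lebesgue points, and weak
  derivatives are turned into increments by applying real functionals.\<close>

lemma borel_measurable_lebesgue_on_AE_limit:
  fixes h :: "'a::euclidean_space \<Rightarrow> real"
  assumes S: "S \<in> sets lebesgue"
    and hi: "\<And>i. hi i \<in> borel_measurable (lebesgue_on S)"
    and lim: "AE x in lebesgue_on S. (\<lambda>i. hi i x) \<longlonglongrightarrow> h x"
  shows "h \<in> borel_measurable (lebesgue_on S)"
proof -
  let ?H = "\<lambda>i x. if x \<in> S then hi i x else 0"
  have [measurable]: "?H i \<in> borel_measurable lebesgue" for i
    using hi S borel_measurable_if_lebesgue_on borel_measurable_if by blast
  have "AE x in lebesgue. x \<in> S \<longrightarrow> (\<lambda>i. hi i x) \<longlonglongrightarrow> h x"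
    using lim S by (subst (asm) AE_restrict_space_iff) auto
  \<comment> \<open>\<open>lim\<close> is total, so the limit function is measurable whatever its
    values where the sequence diverges; completeness of \<open>lebesgue\<close> absorbs the null
    set.\<close>
  then have "AE x in lebesgue. lim (\<lambda>i. ?H i x) = (if x \<in> S then h x else 0)"
    by eventually_elim (auto intro: limI)
  moreover have "(\<lambda>x. lim (\<lambda>i. ?H i x)) \<in> borel_measurable lebesgue"
    by measurable
  ultimately have "(\<lambda>x. if x \<in> S then h x else 0) \<in> borel_measurable lebesgue"
    by (rule borel_measurable_AE[rotated])
  then show ?thesis
    using S borel_measurable_if_D by blast
qed

text \<open>Only simple approximants of \<open>f\<close> are at hand. The distance to a simple
  function is an almost everywhere limit of real simple functions, hence measurable, and the L1
  estimates below rest on this scalar measurability. Taking \<open>s\<close> zero gives the norm of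
  \<open>f\<close>.\<close>

lemma strongly_measurable_borel_norm:
  fixes f :: "'a::euclidean_space \<Rightarrow> 'b::real_normed_vector"
  assumes S: "S \<in> sets lebesgue" and f: "strongly_measurable (lebesgue_on S) f"
    and s: "simple_function (lebesgue_on S) s"
  shows "(\<lambda>x. norm (f x - s x)) \<in> borel_measurable (lebesgue_on S)"
proof -
  obtain r where r: "\<And>i. simple_function (lebesgue_on S) (r i)"
      "AE x in lebesgue_on S. (\<lambda>i. r i x) \<longlonglongrightarrow> f x"
    using f unfolding strongly_measurable_def by blast
  show ?thesis
  proof (rule borel_measurable_lebesgue_on_AE_limit[OF S])
    show "(\<lambda>x. norm (r i x - s x)) \<in> borel_measurable (lebesgue_on S)" for i
      by (intro borel_measurable_simple_function simple_function_compose2[OF r(1) s])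
    show "AE x in lebesgue_on S. (\<lambda>i. norm (r i x - s x)) \<longlonglongrightarrow> norm (f x - s x)"
      using r(2) by eventually_elim (intro tendsto_intros)
  qed
qed

lemma strongly_measurable_scaleR:
  fixes f :: "'a \<Rightarrow> 'b::real_normed_vector" and \<phi> :: "'a \<Rightarrow> real"
  assumes f: "strongly_measurable M f" and \<phi>: "\<phi> \<in> borel_measurable M"
  shows "strongly_measurable M (\<lambda>x. \<phi> x *\<^sub>R f x)"
proof -
  obtain r where r: "\<And>i. simple_function M (r i)" "AE x in M. (\<lambda>i. r i x) \<longlonglongrightarrow> f x"
    using f unfolding strongly_measurable_def by blast
  obtain q where q: "\<And>i::nat. simple_function M (q i)" "\<And>x. x \<in> space M \<Longrightarrow> (\<lambda>i. q i x) \<longlonglongrightarrow> \<phi> x"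
    using borel_measurable_implies_sequence_metric[OF \<phi>, of 0] by blast
  show ?thesis
    unfolding strongly_measurable_def
  proof (intro exI[where x="\<lambda>i x. q i x *\<^sub>R r i x"] conjI allI)
    show "simple_function M (\<lambda>x. q i x *\<^sub>R r i x)" for i
      by (rule simple_function_compose2[OF q(1) r(1)])
    show "AE x in M. (\<lambda>i. q i x *\<^sub>R r i x) \<longlonglongrightarrow> \<phi> x *\<^sub>R f x"
      using r(2) AE_space by eventually_elim (intro tendsto_intros q)
  qed
qed

text \<open>\<open>f\<close> is the intermediate point of a triangle inequality. Applied to one
  approximating sequence this gives the Cauchy property of the integrals, applied to two sequences
  it gives uniqueness of the limit.\<close>

lemma simple_bochner_integral_dist_le:
  fixes s t :: "'a \<Rightarrow> 'b::real_normed_vector"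
  assumes s: "Bochner_Integration.simple_bochner_integrable M s"
    and t: "Bochner_Integration.simple_bochner_integrable M t"
    and fs: "(\<lambda>x. norm (f x - s x)) \<in> borel_measurable M"
    and ft: "(\<lambda>x. norm (f x - t x)) \<in> borel_measurable M"
  shows "ennreal (norm (Bochner_Integration.simple_bochner_integral M s
            - Bochner_Integration.simple_bochner_integral M t))
         \<le> (\<integral>\<^sup>+x. norm (f x - s x) \<partial>M) + (\<integral>\<^sup>+x. norm (f x - t x) \<partial>M)"
proof -
  have "ennreal (norm (Bochner_Integration.simple_bochner_integral M s
           - Bochner_Integration.simple_bochner_integral M t))
        = norm (Bochner_Integration.simple_bochner_integral M (\<lambda>x. s x - t x))"
    using s t by (subst simple_bochner_integral_diff) auto
  also have "\<dots> \<le> Bochner_Integration.simple_bochner_integral M (\<lambda>x. norm (s x - t x))"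
    using simple_bochner_integrable_compose2[of "(-)" M s t] s t
    by (auto intro!: simple_bochner_integral_norm_bound)
  also have "\<dots> = (\<integral>\<^sup>+x. norm (s x - t x) \<partial>M)"
    using simple_bochner_integrable_compose2[of "\<lambda>x y. norm (x - y)" M s t] s t
    by (auto intro!: simple_bochner_integral_eq_nn_integral)
  also have "\<dots> \<le> (\<integral>\<^sup>+x. ennreal (norm (f x - s x)) + ennreal (norm (f x - t x)) \<partial>M)"
  proof (intro nn_integral_mono)
    fix x
    have "norm (s x - t x) \<le> norm (f x - s x) + norm (f x - t x)"
      by (metis dual_order.refl norm_diff_triangle_le norm_minus_commute)
    then show "ennreal (norm (s x - t x)) \<le> ennreal (norm (f x - s x)) + ennreal (norm (f x - t x))"
      by (metis ennreal_leI ennreal_plus norm_ge_zero)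
  qed
  also have "\<dots> = (\<integral>\<^sup>+x. norm (f x - s x) \<partial>M) + (\<integral>\<^sup>+x. norm (f x - t x) \<partial>M)"
    using fs ft by (intro nn_integral_add) auto
  finally show ?thesis .
qed

text \<open>Approximants converging almost everywhere need not be dominated. Setting them to zero
  where they exceed twice the norm of \<open>f\<close> makes dominated convergence applicable, so
  they converge in L1 and their integrals form a Cauchy sequence.\<close>

lemma has_Bochner_integral_exists:
  fixes f :: "'a::euclidean_space \<Rightarrow> 'b::banach"
  assumes S: "S \<in> sets lebesgue" and f: "strongly_measurable (lebesgue_on S) f"
    and fin: "(\<integral>\<^sup>+x. norm (f x) \<partial>lebesgue_on S) < \<infinity>"
  shows "\<exists>I. has_Bochner_integral (lebesgue_on S) f I"
proof -
  let ?M = "lebesgue_on S"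
  obtain r where r: "\<And>i. simple_function ?M (r i)" "AE x in ?M. (\<lambda>i. r i x) \<longlonglongrightarrow> f x"
    using f unfolding strongly_measurable_def by blast
  have nf [measurable]: "(\<lambda>x. norm (f x)) \<in> borel_measurable ?M"
    using strongly_measurable_borel_norm[OF S f simple_function_const, of 0] by simp
  have nr [measurable]: "(\<lambda>x. norm (r i x)) \<in> borel_measurable ?M" for i
    by (intro borel_measurable_simple_function simple_function_compose1[OF r(1)])
  \<comment> \<open>Where \<open>f x \<noteq> 0\<close> the factor 2 lets the approximants
    eventually pass the test; where \<open>f x = 0\<close> the test forces the value 0, which is the
    limit.\<close>
  define A where "A i = {x \<in> space ?M. norm (r i x) \<le> 2 * norm (f x)}" for i
  have A: "A i \<in> sets ?M" for i
    unfolding A_def by measurable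
  define s where "s i x = (if x \<in> A i then r i x else 0)" for i x
  have s: "simple_function ?M (s i)" for i
    unfolding s_def using A r(1)
    by (intro simple_function_If_set) (auto simp: sets.Int_space_eq2)
  have s_le: "norm (s i x) \<le> 2 * norm (f x)" if "x \<in> space ?M" for i x
    by (auto simp: s_def A_def)
  have s_lim: "AE x in ?M. (\<lambda>i. s i x) \<longlonglongrightarrow> f x"
    using r(2) AE_space
  proof eventually_elim
    case (elim x)
    show ?case
    proof (cases "f x = 0")
      case True
      then have "s i x = 0" for i
        by (auto simp: s_def A_def)
      then show ?thesis using True by simp
    next
      case False
      have "eventually (\<lambda>i. norm (r i x) < 2 * norm (f x)) sequentially"
        using tendsto_norm[OF elim(1)] False by (intro order_tendstoD) auto
      then have "eventually (\<lambda>i. r i x = s i x) sequentially"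
        by eventually_elim (use elim(2) in \<open>auto simp: s_def A_def\<close>)
      then show ?thesis
        using elim(1) by (rule Lim_transform_eventually[rotated])
    qed
  qed
  have fs [measurable]: "(\<lambda>x. norm (f x - s i x)) \<in> borel_measurable ?M" for i
    by (rule strongly_measurable_borel_norm[OF S f s])
  have sbi: "Bochner_Integration.simple_bochner_integrable ?M (s i)" for i
  proof (rule simple_bochner_integrableI_bounded[OF s])
    have "(\<integral>\<^sup>+x. norm (s i x) \<partial>?M) \<le> (\<integral>\<^sup>+x. 2 * ennreal (norm (f x)) \<partial>?M)"
      using s_le by (intro nn_integral_mono) (metis ennreal_leI ennreal_mult' ennreal_numeral norm_ge_zero zero_le_numeral)
    also have "\<dots> = 2 * (\<integral>\<^sup>+x. norm (f x) \<partial>?M)"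
      by (intro nn_integral_cmult) auto
    also have "\<dots> < \<infinity>"
      using fin by (simp add: ennreal_mult_less_top)
    finally show "(\<integral>\<^sup>+x. norm (s i x) \<partial>?M) < \<infinity>" .
  qed
  have lim0: "(\<lambda>i. \<integral>\<^sup>+x. norm (f x - s i x) \<partial>?M) \<longlonglongrightarrow> 0"
  proof -
    have "(\<lambda>i. \<integral>\<^sup>+x. norm (f x - s i x) \<partial>?M) \<longlonglongrightarrow> (\<integral>\<^sup>+x. 0 \<partial>?M)"
    proof (rule nn_integral_dominated_convergence[where w="\<lambda>x. 3 * ennreal (norm (f x))"])
      show "AE x in ?M. ennreal (norm (f x - s i x)) \<le> 3 * ennreal (norm (f x))" for i
      proof (rule AE_I2)
        fix x assume "x \<in> space ?M"
        then have "norm (f x - s i x) \<le> 3 * norm (f x)"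
          using s_le[of x i] norm_triangle_ineq4[of "f x" "s i x"] by linarith
        then show "ennreal (norm (f x - s i x)) \<le> 3 * ennreal (norm (f x))"
          by (metis ennreal_leI ennreal_mult' ennreal_numeral norm_ge_zero zero_le_numeral)
      qed
      have "(\<integral>\<^sup>+x. 3 * ennreal (norm (f x)) \<partial>?M) = 3 * (\<integral>\<^sup>+x. norm (f x) \<partial>?M)"
        by (intro nn_integral_cmult) auto
      then show "(\<integral>\<^sup>+x. 3 * ennreal (norm (f x)) \<partial>?M) < \<infinity>"
        using fin by (simp add: ennreal_mult_less_top)
      show "AE x in ?M. (\<lambda>i. ennreal (norm (f x - s i x))) \<longlonglongrightarrow> 0"
        using s_lim
      proof eventually_elim
        case (elim x)
        have "(\<lambda>i. norm (f x - s i x)) \<longlonglongrightarrow> norm (f x - f x)"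
          by (intro tendsto_intros elim)
        then show ?case
          using tendsto_ennrealI by fastforce
      qed
    qed auto
    then show ?thesis by simp
  qed
  have "Cauchy (\<lambda>i. Bochner_Integration.simple_bochner_integral ?M (s i))"
  proof (rule CauchyI)
    fix e :: real assume "0 < e"
    then have "eventually (\<lambda>i. (\<integral>\<^sup>+x. norm (f x - s i x) \<partial>?M) < ennreal (e/2)) sequentially"
      by (intro order_tendstoD(2)[OF lim0]) auto
    then obtain N where N: "\<And>i. i \<ge> N \<Longrightarrow> (\<integral>\<^sup>+x. norm (f x - s i x) \<partial>?M) < ennreal (e/2)"
      unfolding eventually_sequentially by blast
    have "norm (Bochner_Integration.simple_bochner_integral ?M (s m)
              - Bochner_Integration.simple_bochner_integral ?M (s n)) < e" if "m \<ge> N" "n \<ge> N" for m n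
    proof -
      have "ennreal (norm (Bochner_Integration.simple_bochner_integral ?M (s m)
              - Bochner_Integration.simple_bochner_integral ?M (s n)))
           \<le> (\<integral>\<^sup>+x. norm (f x - s m x) \<partial>?M) + (\<integral>\<^sup>+x. norm (f x - s n x) \<partial>?M)"
        by (rule simple_bochner_integral_dist_le[OF sbi sbi fs fs])
      also have "\<dots> < ennreal (e/2) + ennreal (e/2)"
        using N that by (intro add_strict_mono) auto
      also have "\<dots> = ennreal e"
        using \<open>0 < e\<close> by (simp flip: ennreal_plus)
      finally show ?thesis
        by (simp add: ennreal_less_iff)
    qed
    then show "\<exists>N. \<forall>m\<ge>N. \<forall>n\<ge>N. norm (Bochner_Integration.simple_bochner_integral ?M (s m)
              - Bochner_Integration.simple_bochner_integral ?M (s n)) < e"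
      by blast
  qed
  then obtain I where "(\<lambda>i. Bochner_Integration.simple_bochner_integral ?M (s i)) \<longlonglongrightarrow> I"
    using Cauchy_convergent_iff convergent_def by blast
  then show ?thesis
    unfolding has_Bochner_integral_def using f sbi lim0 by blast
qed

text \<open>Composing the approximants with \<xi> lands in the reals, where
  \<open>has_bochner_integral\<close> applies. Later computations with vector-valued integrals are
  scalar ones obtained in this way.\<close>

lemma has_Bochner_integral_bounded_linear:
  fixes f :: "'a::euclidean_space \<Rightarrow> 'b::real_normed_vector" and \<xi> :: "'b \<Rightarrow> real"
  assumes S: "S \<in> sets lebesgue" and f: "has_Bochner_integral (lebesgue_on S) f I"
    and \<xi>: "bounded_linear \<xi>"
  shows "has_bochner_integral (lebesgue_on S) (\<lambda>x. \<xi> (f x)) (\<xi> I)"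
proof -
  let ?M = "lebesgue_on S"
  interpret \<xi>: bounded_linear \<xi> by fact
  obtain s where sm: "strongly_measurable ?M f"
    and s: "\<And>i::nat. Bochner_Integration.simple_bochner_integrable ?M (s i)"
    and lim0: "(\<lambda>i. \<integral>\<^sup>+x. norm (f x - s i x) \<partial>?M) \<longlonglongrightarrow> 0"
    and lim: "(\<lambda>i. Bochner_Integration.simple_bochner_integral ?M (s i)) \<longlonglongrightarrow> I"
    using f unfolding has_Bochner_integral_def by blast
  obtain r where r: "\<And>i::nat. simple_function ?M (r i)" "AE x in ?M. (\<lambda>i. r i x) \<longlonglongrightarrow> f x"
    using sm unfolding strongly_measurable_def by blast
  obtain B where B: "0 < B" "\<And>x. norm (\<xi> x) \<le> norm x * B"
    using \<xi>.pos_bounded by blast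
  have sf: "simple_function ?M (s i)" for i
    using s[of i] by (auto elim: simple_bochner_integrable.cases)
  have \<xi>s: "Bochner_Integration.simple_bochner_integrable ?M (\<lambda>x. \<xi> (s i x))" for i
    using simple_bochner_integrable_compose2[of "\<lambda>x y. \<xi> x", OF _ s s] by (simp add: \<xi>.zero)
  show ?thesis
  proof (rule has_bochner_integral.intros[where s="\<lambda>i x. \<xi> (s i x)"])
    show "(\<lambda>x. \<xi> (f x)) \<in> borel_measurable ?M"
    proof (rule borel_measurable_lebesgue_on_AE_limit[OF S])
      show "(\<lambda>x. \<xi> (r i x)) \<in> borel_measurable ?M" for i
        by (intro borel_measurable_simple_function simple_function_compose1[OF r(1)])
      show "AE x in ?M. (\<lambda>i. \<xi> (r i x)) \<longlonglongrightarrow> \<xi> (f x)"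
        using r(2) by eventually_elim (intro \<xi>.tendsto)
    qed
    show "Bochner_Integration.simple_bochner_integrable ?M (\<lambda>x. \<xi> (s i x))" for i
      by (rule \<xi>s)
    have "(\<lambda>i. ennreal B * (\<integral>\<^sup>+x. norm (f x - s i x) \<partial>?M)) \<longlonglongrightarrow> ennreal B * 0"
      by (intro ennreal_tendsto_cmult lim0) auto
    then have *: "(\<lambda>i. ennreal B * (\<integral>\<^sup>+x. norm (f x - s i x) \<partial>?M)) \<longlonglongrightarrow> 0"
      by simp
    show "(\<lambda>i. \<integral>\<^sup>+x. norm (\<xi> (f x) - \<xi> (s i x)) \<partial>?M) \<longlonglongrightarrow> 0"
    proof (rule tendsto_sandwich[OF _ _ tendsto_const *])
      show "eventually (\<lambda>i. (\<integral>\<^sup>+x. norm (\<xi> (f x) - \<xi> (s i x)) \<partial>?M)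
              \<le> ennreal B * (\<integral>\<^sup>+x. norm (f x - s i x) \<partial>?M)) sequentially"
      proof (rule always_eventually, rule allI)
        fix i
        have "(\<integral>\<^sup>+x. norm (\<xi> (f x) - \<xi> (s i x)) \<partial>?M) \<le> (\<integral>\<^sup>+x. ennreal B * norm (f x - s i x) \<partial>?M)"
          using B by (intro nn_integral_mono)
            (simp add: ennreal_leI mult.commute flip: ennreal_mult \<xi>.diff del: real_norm_def)
        also have "\<dots> = ennreal B * (\<integral>\<^sup>+x. norm (f x - s i x) \<partial>?M)"
          using strongly_measurable_borel_norm[OF S sm sf] by (intro nn_integral_cmult) auto
        finally show "(\<integral>\<^sup>+x. norm (\<xi> (f x) - \<xi> (s i x)) \<partial>?M)
              \<le> ennreal B * (\<integral>\<^sup>+x. norm (f x - s i x) \<partial>?M)" .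
      qed
    qed auto
    show "(\<lambda>i. Bochner_Integration.simple_bochner_integral ?M (\<lambda>x. \<xi> (s i x))) \<longlonglongrightarrow> \<xi> I"
      using \<xi>.tendsto[OF lim] simple_bochner_integral_linear[OF \<xi>.linear_axioms s] by simp
  qed
qed

text \<open>One approximant at L1 distance below 1 suffices: its norm plus the norm of the
  difference dominates the norm of \<open>f\<close>.\<close>

lemma has_Bochner_integral_norm_integrable:
  fixes f :: "'a::euclidean_space \<Rightarrow> 'b::real_normed_vector"
  assumes S: "S \<in> sets lebesgue" and f: "has_Bochner_integral (lebesgue_on S) f I"
  shows "integrable (lebesgue_on S) (\<lambda>x. norm (f x))"
proof -
  let ?M = "lebesgue_on S"
  obtain s where sm: "strongly_measurable ?M f"
    and s: "\<And>i::nat. Bochner_Integration.simple_bochner_integrable ?M (s i)"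
    and lim0: "(\<lambda>i. \<integral>\<^sup>+x. norm (f x - s i x) \<partial>?M) \<longlonglongrightarrow> 0"
    using f unfolding has_Bochner_integral_def by blast
  have sf: "simple_function ?M (s i)" for i
    using s[of i] by (auto elim: simple_bochner_integrable.cases)
  have fs: "(\<lambda>x. norm (f x - s i x)) \<in> borel_measurable ?M" for i
    by (rule strongly_measurable_borel_norm[OF S sm sf])
  have "eventually (\<lambda>i. (\<integral>\<^sup>+x. norm (f x - s i x) \<partial>?M) < 1) sequentially"
    by (intro order_tendstoD(2)[OF lim0]) auto
  then obtain i where i: "(\<integral>\<^sup>+x. norm (f x - s i x) \<partial>?M) < 1"
    unfolding eventually_sequentially by blast
  have "Bochner_Integration.simple_bochner_integrable ?M (\<lambda>x. norm (s i x))"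
    using simple_bochner_integrable_compose2[of "\<lambda>x y. norm x", OF _ s s] by simp
  then have "integrable ?M (\<lambda>x. norm (s i x))"
    using has_bochner_integral_simple_bochner_integrable integrable.simps by blast
  moreover have "integrable ?M (\<lambda>x. norm (f x - s i x))"
    using fs i by (intro integrableI_bounded) (auto simp: top.not_eq_extremum order_less_trans[OF _ ennreal_one_less_top])
  ultimately have "integrable ?M (\<lambda>x. norm (f x - s i x) + norm (s i x))"
    by simp
  moreover have "(\<lambda>x. norm (f x)) \<in> borel_measurable ?M"
    using strongly_measurable_borel_norm[OF S sm simple_function_const, of 0] by simp
  ultimately show ?thesis
    by (rule Bochner_Integration.integrable_bound)
       (auto intro!: AE_I2 simp: norm_triangle_sub[of "f _" "s i _"] add.commute)
qed

lemma Bochner_integral_bounded_linear: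
  fixes f :: "'a::euclidean_space \<Rightarrow> 'b::banach" and \<xi> :: "'b \<Rightarrow> real"
  assumes S: "S \<in> sets lebesgue" and f: "strongly_measurable (lebesgue_on S) f"
    and fin: "integrable (lebesgue_on S) (\<lambda>x. norm (f x))"
    and \<xi>: "bounded_linear \<xi>"
  shows "integrable (lebesgue_on S) (\<lambda>x. \<xi> (f x))"
    and "\<xi> (Bochner_integral (lebesgue_on S) f) = integral\<^sup>L (lebesgue_on S) (\<lambda>x. \<xi> (f x))"
proof -
  let ?M = "lebesgue_on S"
  have "(\<integral>\<^sup>+x. norm (f x) \<partial>?M) < \<infinity>"
    using fin by (simp add: integrable_iff_bounded)
  then obtain I where I: "has_Bochner_integral ?M f I"
    using has_Bochner_integral_exists[OF S f] by blast
  \<comment> \<open>Uniqueness of the value is what makes the definite description in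
    \<open>Bochner_integral\<close> denote \<open>I\<close>.\<close>
  have "J = I" if J: "has_Bochner_integral ?M f J" for J
  proof -
    obtain s where s: "\<And>i::nat. Bochner_Integration.simple_bochner_integrable ?M (s i)"
      and s0: "(\<lambda>i. \<integral>\<^sup>+x. norm (f x - s i x) \<partial>?M) \<longlonglongrightarrow> 0"
      and sI: "(\<lambda>i. Bochner_Integration.simple_bochner_integral ?M (s i)) \<longlonglongrightarrow> I"
      using I unfolding has_Bochner_integral_def by blast
    obtain t where t: "\<And>i::nat. Bochner_Integration.simple_bochner_integrable ?M (t i)"
      and t0: "(\<lambda>i. \<integral>\<^sup>+x. norm (f x - t i x) \<partial>?M) \<longlonglongrightarrow> 0"
      and tJ: "(\<lambda>i. Bochner_Integration.simple_bochner_integral ?M (t i)) \<longlonglongrightarrow> J"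
      using J unfolding has_Bochner_integral_def by blast
    have m: "(\<lambda>x. norm (f x - s i x)) \<in> borel_measurable ?M" "(\<lambda>x. norm (f x - t i x)) \<in> borel_measurable ?M" for i
      using s[of i] t[of i] by (auto intro!: strongly_measurable_borel_norm[OF S f] elim: simple_bochner_integrable.cases)
    have "(\<lambda>i. (\<integral>\<^sup>+x. norm (f x - t i x) \<partial>?M) + (\<integral>\<^sup>+x. norm (f x - s i x) \<partial>?M)) \<longlonglongrightarrow> 0 + 0"
      by (intro tendsto_add s0 t0)
    then have 0: "(\<lambda>i. (\<integral>\<^sup>+x. norm (f x - t i x) \<partial>?M) + (\<integral>\<^sup>+x. norm (f x - s i x) \<partial>?M)) \<longlonglongrightarrow> 0"
      by simp
    have "(\<lambda>i. ennreal (norm (Bochner_Integration.simple_bochner_integral ?M (t i)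
            - Bochner_Integration.simple_bochner_integral ?M (s i)))) \<longlonglongrightarrow> 0"
      by (rule tendsto_sandwich[OF _ _ tendsto_const 0])
         (auto intro!: always_eventually simple_bochner_integral_dist_le s t m)
    moreover have "(\<lambda>i. ennreal (norm (Bochner_Integration.simple_bochner_integral ?M (t i)
            - Bochner_Integration.simple_bochner_integral ?M (s i)))) \<longlonglongrightarrow> ennreal (norm (J - I))"
      by (intro tendsto_ennrealI tendsto_intros sI tJ)
    ultimately have "ennreal (norm (J - I)) = 0"
      by (rule LIMSEQ_unique[rotated])
    then show ?thesis by (simp add: ennreal_eq_0_iff)
  qed
  then have "Bochner_integral ?M f = I"
    unfolding Bochner_integral_def using I by blast
  then have *: "has_bochner_integral ?M (\<lambda>x. \<xi> (f x)) (\<xi> (Bochner_integral ?M f))"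
    using has_Bochner_integral_bounded_linear[OF S I \<xi>] by simp
  then show "integrable ?M (\<lambda>x. \<xi> (f x))"
    and "\<xi> (Bochner_integral ?M f) = integral\<^sup>L ?M (\<lambda>x. \<xi> (f x))"
    by (auto simp: has_bochner_integral_iff)
qed

section \<open>Smooth test functions\<close>

text \<open>The first conjunct of \<open>test_function\<close>, isolated so that closure properties
  can be stated without the support condition.\<close>

definition smooth :: "(real \<Rightarrow> real) \<Rightarrow> bool" where
  "smooth f \<longleftrightarrow> (\<forall>n t. (deriv ^^ n) f field_differentiable at t)"

text \<open>A class in which every member has its derivative again in the class contains all
  iterated derivatives. Naming such a class replaces the computation of n-th derivatives.\<close>

lemma smooth_coinduct:
  assumes "\<And>f. f \<in> S \<Longrightarrow> \<exists>g\<in>S. \<forall>t. (f has_real_derivative g t) (at t)" and "f \<in> S"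
  shows "smooth f"
proof -
  have "(deriv ^^ n) f \<in> S" for n
  proof (induction n)
    case 0
    then show ?case using assms(2) by simp
  next
    case (Suc n)
    then obtain g where g: "g \<in> S" "\<And>t. ((deriv ^^ n) f has_real_derivative g t) (at t)"
      using assms(1) by blast
    have "deriv ((deriv ^^ n) f) = g"
      using DERIV_imp_deriv[OF g(2)] by (intro ext)
    then show ?case using g by simp
  qed
  then show ?thesis
    unfolding smooth_def field_differentiable_def using assms(1) by blast
qed

lemma smooth_DERIV: "smooth f \<Longrightarrow> (f has_real_derivative deriv f t) (at t)"
  using field_differentiable_derivI[of f t] unfolding smooth_def by (metis funpow_0)

lemma smooth_deriv: "smooth f \<Longrightarrow> smooth (deriv f)"
  unfolding smooth_def by (metis comp_apply funpow_Suc_right)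

lemma smooth_continuous: "smooth f \<Longrightarrow> continuous_on S f"
  using smooth_DERIV DERIV_isCont continuous_at_imp_continuous_on by blast

lemma smooth_antiderivative:
  assumes f: "\<And>t. (f has_real_derivative f' t) (at t)" and f': "smooth f'"
  shows "smooth f"
proof (rule smooth_coinduct[of "insert f (Collect smooth)"])
  fix g assume "g \<in> insert f (Collect smooth)"
  then show "\<exists>h\<in>insert f (Collect smooth). \<forall>t. (g has_real_derivative h t) (at t)"
    using f f' smooth_DERIV smooth_deriv by blast
qed simp

lemma smooth_diff:
  assumes "smooth f" "smooth g"
  shows "smooth (\<lambda>t. f t - g t)"
proof (rule smooth_coinduct[of "{\<lambda>t. f t - g t | f g. smooth f \<and> smooth g}"])
  fix h assume "h \<in> {\<lambda>t. f t - g t | f g. smooth f \<and> smooth g}"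
  then obtain f g where fg: "smooth f" "smooth g" "h = (\<lambda>t. f t - g t)"
    by blast
  have "\<forall>t. (h has_real_derivative deriv f t - deriv g t) (at t)"
    using fg by (auto intro!: DERIV_diff smooth_DERIV)
  moreover have "(\<lambda>t. deriv f t - deriv g t) \<in> {\<lambda>t. f t - g t | f g. smooth f \<and> smooth g}"
    using fg smooth_deriv by blast
  ultimately show "\<exists>g\<in>{\<lambda>t. f t - g t | f g. smooth f \<and> smooth g}. \<forall>t. (h has_real_derivative g t) (at t)"
    by (intro bexI)
qed (use assms in blast)

lemma smooth_affine:
  assumes "smooth f"
  shows "smooth (\<lambda>t. c * f (m * t + b))"
proof (rule smooth_coinduct[of "{\<lambda>t. c * f (m * t + b) | c f. smooth f}"])
  fix h assume "h \<in> {\<lambda>t. c * f (m * t + b) | c f. smooth f}"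
  then obtain c f where f: "smooth f" "h = (\<lambda>t. c * f (m * t + b))"
    by blast
  have "\<forall>t. (h has_real_derivative (c * m) * deriv f (m * t + b)) (at t)"
    unfolding f(2)
    by (intro allI) (rule derivative_eq_intros DERIV_chain2[OF smooth_DERIV[OF f(1)]] refl | simp)+
  moreover have "(\<lambda>t. (c * m) * deriv f (m * t + b)) \<in> {\<lambda>t. c * f (m * t + b) | c f. smooth f}"
    using f smooth_deriv by blast
  ultimately show "\<exists>g\<in>{\<lambda>t. c * f (m * t + b) | c f. smooth f}. \<forall>t. (h has_real_derivative g t) (at t)"
    by (intro bexI)
qed (use assms in blast)

text \<open>This class of functions is closed under differentiation, which makes its members smooth.\<close>

definition bump :: "real poly \<Rightarrow> nat \<Rightarrow> real \<Rightarrow> real" where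
  "bump p k x = (if 0 < x \<and> x < 1
     then poly p x / (x * (1 - x)) ^ k * exp (- 1 / (x * (1 - x))) else 0)"

text \<open>From \<open>(1 + y / n) ^ n \<le> exp y\<close> at \<open>y = 1 / q\<close>, with
  \<open>q = x * (1 - x)\<close>, follows \<open>exp (- 1 / q) \<le> (n * q) ^ n\<close>. The choice
  \<open>n = k + 2\<close> cancels the pole and leaves the square of \<open>q\<close>, from which
  the derivative at the endpoints is read off.\<close>

lemma bump_quadratic_bound:
  obtains C where "C \<ge> 0" "\<And>x. \<bar>bump p k x\<bar> \<le> C * (x * (1 - x))\<^sup>2"
proof -
  have "bounded (poly p ` {0..1})"
    by (intro compact_imp_bounded compact_continuous_image continuous_intros compact_Icc)
  then obtain B where B: "\<And>x. x \<in> {0..1} \<Longrightarrow> \<bar>poly p x\<bar> \<le> B"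
    unfolding bounded_iff by (metis imageI real_norm_def)
  define n where "n = k + 2"
  have "\<bar>bump p k x\<bar> \<le> (B * real n ^ n) * (x * (1 - x))\<^sup>2" for x
  proof (cases "0 < x \<and> x < 1")
    case True
    define q where "q = x * (1 - x)"
    have q: "q > 0" using True by (simp add: q_def)
    have "(1 / q / n) ^ n \<le> (1 + 1 / q / n) ^ n"
      using q by (intro power_mono) auto
    also have "\<dots> \<le> exp (1 / q)"
    proof (rule exp_ge_one_plus_x_over_n_power_n)
      have "- real n \<le> 0" "0 \<le> 1 / q" using q by auto
      then show "- real n \<le> 1 / q" by linarith
    qed (simp add: n_def)
    finally have "(1 / q / n) ^ n * (n * q) ^ n \<le> exp (1 / q) * (n * q) ^ n"
      using q by (intro mult_right_mono) auto
    moreover have "(1 / q / n) ^ n * (n * q) ^ n = 1"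
      using q unfolding power_mult_distrib[symmetric] by (simp add: n_def)
    ultimately have *: "exp (- 1 / q) \<le> (n * q) ^ n"
      by (simp add: exp_minus field_simps)
    have "\<bar>bump p k x\<bar> = \<bar>poly p x\<bar> / q ^ k * exp (- 1 / q)"
      using True q by (simp add: bump_def abs_mult q_def)
    also have "\<dots> \<le> B / q ^ k * (n * q) ^ n"
      using q B[of x] True * by (intro mult_mono divide_right_mono) auto
    also have "\<dots> = B * real n ^ n * q\<^sup>2"
    proof -
      have "q ^ n = q ^ k * q\<^sup>2" by (simp add: n_def power_add power2_eq_square)
      then show ?thesis using q by (simp add: power_mult_distrib)
    qed
    finally show ?thesis by (simp add: q_def)
  next
    case False
    moreover have "B \<ge> 0" using B[of 0] by force
    ultimately show ?thesis unfolding bump_def if_not_P[OF False] by simp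
  qed
  moreover have "B \<ge> 0" using B[of 0] by force
  ultimately show thesis by (intro that[of "B * real n ^ n"]) auto
qed

lemma DERIV_zero_if_quadratic:
  fixes f :: "real \<Rightarrow> real"
  assumes "\<And>y. \<bar>f y\<bar> \<le> C * (y - x)\<^sup>2"
  shows "(f has_real_derivative 0) (at x)"
  unfolding has_field_derivative_iff
proof (rule Lim_null_comparison)
  have 0: "f x = 0" using assms[of x] by simp
  show "eventually (\<lambda>y. norm ((f y - f x) / (y - x)) \<le> C * \<bar>y - x\<bar>) (at x)"
    unfolding eventually_at_filter
  proof (intro always_eventually allI impI)
    fix y assume "y \<noteq> x"
    then show "norm ((f y - f x) / (y - x)) \<le> C * \<bar>y - x\<bar>"
      using assms[of y] 0 by (simp add: abs_divide divide_le_eq power2_eq_square mult.assoc)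
  qed
  show "((\<lambda>y. C * \<bar>y - x\<bar>) \<longlongrightarrow> 0) (at x)"
    by (rule tendsto_eq_intros refl | simp)+
qed

lemma DERIV_quotient_exp:
  fixes P Q :: "real \<Rightarrow> real"
  assumes [derivative_intros]: "(P has_real_derivative P') (at x)" "(Q has_real_derivative Q') (at x)"
    and Q: "Q x \<noteq> 0"
  shows "((\<lambda>x. P x / Q x ^ k * exp (- 1 / Q x)) has_real_derivative
    (P' * (Q x)\<^sup>2 - real k * (P x * Q' * Q x) + P x * Q') / Q x ^ (k + 2) * exp (- 1 / Q x)) (at x)"
\<comment> \<open>The exponent \<open>k - 1\<close> in the power rule is a truncated difference, so
  \<open>k = 0\<close> is treated apart.\<close>
proof (cases k)
  case 0
  show ?thesis unfolding 0
    by (rule derivative_eq_intros refl | use Q in \<open>simp add: field_simps power2_eq_square\<close>)+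
next
  case (Suc n)
  show ?thesis unfolding Suc
    by (rule derivative_eq_intros refl | use Q in \<open>simp add: field_simps power2_eq_square\<close>)+
qed

text \<open>On (0,1) the quotient rule stays within the class and raises \<open>k\<close> by 2. At
  all other points the derivative is 0 by the quadratic bound.\<close>

lemma bump_DERIV:
  "\<exists>p' k'. \<forall>x. (bump p k has_real_derivative bump p' k' x) (at x)"
proof -
  define q :: "real poly" where "q = [:0, 1, -1:]"
  have q: "poly q x = x * (1 - x)" for x by (simp add: q_def algebra_simps)
  let ?p' = "pderiv p * q\<^sup>2 - smult (real k) (p * pderiv q * q) + p * pderiv q"
  have "(bump p k has_real_derivative bump ?p' (k + 2) x) (at x)" for x
  proof (cases "0 < x \<and> x < 1")
    case True
    let ?f = "\<lambda>x. poly p x / poly q x ^ k * exp (- 1 / poly q x)"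
    have q0: "poly q x \<noteq> 0" using True by (simp add: q)
    have "(?f has_real_derivative (poly (pderiv p) x * (poly q x)\<^sup>2
        - real k * (poly p x * poly (pderiv q) x * poly q x) + poly p x * poly (pderiv q) x)
          / poly q x ^ (k + 2) * exp (- 1 / poly q x)) (at x)"
      by (rule DERIV_quotient_exp[OF poly_DERIV poly_DERIV q0])
    then have *: "(?f has_real_derivative bump ?p' (k + 2) x) (at x)"
      using True unfolding bump_def q[symmetric]
      by (simp)
    show ?thesis
      by (rule has_field_derivative_transform_within_open[OF *, of "{0<..<1}"])
         (use True in \<open>auto simp: bump_def q\<close>)
  next
    case False
    obtain C where C: "C \<ge> 0" "\<And>x. \<bar>bump p k x\<bar> \<le> C * (x * (1 - x))\<^sup>2"
      using bump_quadratic_bound by blast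
    have "\<bar>bump p k y\<bar> \<le> C * (y - x)\<^sup>2" for y
    proof (cases "0 < y \<and> y < 1")
      case True
      have "x \<le> 0 \<or> 1 \<le> x"
        using False by auto
      \<comment> \<open>For \<open>x\<close> outside (0,1) one of the two bounds, \<open>y\<close>
        or \<open>1 - y\<close>, is the distance from \<open>y\<close> to an endpoint between
        \<open>x\<close> and \<open>y\<close>.\<close>
      have "y * (1 - y) \<le> y" "y * (1 - y) \<le> 1 - y"
        using True mult_left_le_one_le[of "1 - y" y] mult_left_le[of "1 - y" y] by auto
      then have "y * (1 - y) \<le> \<bar>y - x\<bar>"
        using \<open>x \<le> 0 \<or> 1 \<le> x\<close> abs_ge_self[of "y - x"] abs_ge_minus_self[of "y - x"] by linarith
      then have "(y * (1 - y))\<^sup>2 \<le> (y - x)\<^sup>2"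
        using True by (intro abs_le_square_iff[THEN iffD1]) (simp add: abs_mult)
      then show ?thesis
        using C(2)[of y] C(1) mult_left_mono by (meson order_trans)
    qed (use C in \<open>auto simp: bump_def\<close>)
    then have "(bump p k has_real_derivative 0) (at x)"
      by (rule DERIV_zero_if_quadratic)
    then show ?thesis
      unfolding bump_def[of _ _ x] if_not_P[OF False] .
  qed
  then show ?thesis by blast
qed

lemma smooth_bump: "smooth (bump p k)"
proof (rule smooth_coinduct[of "{bump p k | p k. True}"])
  fix f assume "f \<in> {bump p k | p k. True}"
  then obtain p k where "f = bump p k" by blast
  then show "\<exists>g\<in>{bump p k | p k. True}. \<forall>t. (f has_real_derivative g t) (at t)"
    using bump_DERIV[of p k] by blast
qed blast

lemma mollifier_exists:
  obtains \<eta> \<Theta> :: "real \<Rightarrow> real" and C where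
    "smooth \<eta>" "\<And>t. 0 \<le> \<eta> t" "\<And>t. \<eta> t \<le> C" "\<And>t. t \<notin> {0<..<1} \<Longrightarrow> \<eta> t = 0"
    "\<And>t. (\<Theta> has_real_derivative \<eta> t) (at t)" "\<And>t. t \<le> 0 \<Longrightarrow> \<Theta> t = 0" "\<And>t. t \<ge> 1 \<Longrightarrow> \<Theta> t = 1"
proof -
  define b where "b = bump 1 0"
  have b: "smooth b" "\<And>t. 0 \<le> b t" "\<And>t. b t \<le> 1" "\<And>t. t \<notin> {0<..<1} \<Longrightarrow> b t = 0"
    unfolding b_def by (auto simp: smooth_bump) (auto simp: bump_def)
  define I where "I = integral {0..1} b"
  have cont: "continuous_on S b" for S by (rule smooth_continuous[OF b(1)])
  have "I \<noteq> 0"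
  proof
    assume "I = 0"
    then have "b (1/2) = 0"
      using integral_eq_0_iff[OF cont, of 0 1] b unfolding I_def by force
    then show False by (simp add: b_def bump_def)
  qed
  moreover have "I \<ge> 0"
    unfolding I_def using b by (intro integral_nonneg integrable_continuous_real cont) auto
  ultimately have I: "I > 0" by simp
  \<comment> \<open>Starting at -1 makes every \<open>t \<ge> 0\<close> an interior point of
    \<open>{-1..t+1}\<close>, so the derivative of the integral is two-sided.\<close>
  define \<Theta> where "\<Theta> t = integral {-1..t} b / I" for t
  have int: "b integrable_on {x..y}" for x y
    by (intro integrable_continuous_real cont)
  have z: "integral {x..y} b = 0" if "y \<le> 0 \<or> x \<ge> 1" for x y
  proof -
    have "integral {x..y} b = integral {x..y} (\<lambda>_. 0)"
      using that b(4) by (intro integral_cong) auto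
    then show ?thesis by simp
  qed
  have \<Theta>0: "\<Theta> t = 0" if "t \<le> 0" for t
    using that z by (simp add: \<Theta>_def)
  have D: "(\<Theta> has_real_derivative b t / I) (at t)" for t
  proof (cases "t < 0")
    case True
    have "(\<Theta> has_real_derivative 0) (at t)"
      by (rule has_field_derivative_transform_within_open[of "\<lambda>_. 0" _ _ "{..<0}"])
         (use True \<Theta>0 in auto)
    then show ?thesis using b(4)[of t] True by simp
  next
    case False
    have "((\<lambda>t. integral {-1..t} b) has_real_derivative b t) (at t within {-1..t+1})"
      by (rule integral_has_real_derivative[OF cont]) (use False in auto)
    then have "((\<lambda>t. integral {-1..t} b) has_real_derivative b t) (at t)"
      using False by (subst (asm) at_within_Icc_at) auto
    then show ?thesis
      unfolding \<Theta>_def by (rule DERIV_cdivide)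
  qed
  have "\<Theta> t = 1" if "t \<ge> 1" for t
  proof -
    have "integral {-1..t} b = integral {-1..0} b + (integral {0..1} b + integral {1..t} b)"
      using that Henstock_Kurzweil_Integration.integral_combine[of "-1" 0 t b]
        Henstock_Kurzweil_Integration.integral_combine[of 0 1 t b] int by auto
    then show ?thesis using I z by (simp add: \<Theta>_def I_def)
  qed
  moreover have "smooth (\<lambda>t. b t / I)"
    using smooth_affine[OF b(1), of "1/I" 1 0] by simp
  ultimately show thesis
    using b I D \<Theta>0 by (intro that[of "\<lambda>t. b t / I" "1 / I" \<Theta>]) (auto intro: divide_right_mono)
qed

text \<open>The derivative is a kernel on \<open>[a, a + e]\<close> minus one on
  \<open>[b, b + e]\<close>. Both sit to the right of their base points, which is why one-sided
  Lebesgue points suffice at the two ends.\<close>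

lemma smoothed_indicator:
  assumes \<eta>: "smooth \<eta>" "\<And>t. 0 \<le> \<eta> t" "\<And>t. t \<notin> {0<..<1} \<Longrightarrow> \<eta> t = 0"
    and \<Theta>: "\<And>t. (\<Theta> has_real_derivative \<eta> t) (at t)" "\<And>t. t \<le> 0 \<Longrightarrow> \<Theta> t = 0" "\<And>t. t \<ge> 1 \<Longrightarrow> \<Theta> t = 1"
    and "0 < a" "a < b" "0 < e" "b + e < T"
  defines "\<phi> \<equiv> \<lambda>t. \<Theta> ((t - a) / e) - \<Theta> ((t - b) / e)"
  shows "test_function T \<phi>" and "deriv \<phi> t = \<eta> ((t - a) / e) / e - \<eta> ((t - b) / e) / e"
    and "0 \<le> \<phi> t" and "\<phi> t \<le> 1" and "\<lbrakk>a + e \<le> t; t \<le> b\<rbrakk> \<Longrightarrow> \<phi> t = 1"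
    and "t \<notin> {a..b+e} \<Longrightarrow> \<phi> t = 0"
proof -
  have mono: "\<Theta> x \<le> \<Theta> y" if "x \<le> y" for x y
    using DERIV_nonneg_imp_nondecreasing[OF that, of \<Theta>] \<Theta>(1) \<eta>(2) by blast
  have D: "(\<phi> has_real_derivative \<eta> ((t - a) / e) / e - \<eta> ((t - b) / e) / e) (at t)" for t
    unfolding \<phi>_def using \<open>0 < e\<close>
    by (auto intro!: derivative_eq_intros DERIV_chain2[OF \<Theta>(1)] simp: field_simps)
  then show "deriv \<phi> t = \<eta> ((t - a) / e) / e - \<eta> ((t - b) / e) / e"
    by (rule DERIV_imp_deriv)
  have "smooth (\<lambda>t. \<eta> ((t - c) / e) / e)" for c
    using smooth_affine[OF \<eta>(1), of "1/e" "1/e" "-c/e"] by (simp add: diff_divide_distrib)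
  then have "smooth \<phi>"
    using smooth_antiderivative[OF D] smooth_diff by blast
  have z: "\<phi> t = 0" if "t \<notin> {a..b+e}" for t
    using that \<open>a < b\<close> \<open>0 < e\<close> unfolding \<phi>_def
    by (cases "t < a") (auto simp: \<Theta> field_simps)
  then show "t \<notin> {a..b+e} \<Longrightarrow> \<phi> t = 0" .
  show "test_function T \<phi>"
    unfolding test_function_def
    using \<open>smooth \<phi>\<close> z assms(7-10) unfolding smooth_def
    by (auto intro!: exI[where x="{a..b+e}"])
  have "0 \<le> \<Theta> x" "\<Theta> x \<le> 1" for x
    using mono[of 0 x] mono[of x 1] \<Theta>(2)[of x] \<Theta>(2)[of 0] \<Theta>(3)[of x] \<Theta>(3)[of 1] by linarith+
  moreover have "\<Theta> ((t - b) / e) \<le> \<Theta> ((t - a) / e)"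
    using \<open>a < b\<close> \<open>0 < e\<close> by (intro mono) (auto simp: divide_right_mono)
  ultimately show "0 \<le> \<phi> t" "\<phi> t \<le> 1"
    unfolding \<phi>_def by (smt (verit))+
  show "\<lbrakk>a + e \<le> t; t \<le> b\<rbrakk> \<Longrightarrow> \<phi> t = 1"
    unfolding \<phi>_def using \<open>0 < e\<close> by (simp add: \<Theta> field_simps)
qed

section \<open>Lebesgue points and weak derivatives\<close>

lemma AE_lebesgue_on_iff_negligible:
  assumes "S \<in> sets lebesgue"
  shows "(AE t in lebesgue_on S. P t) \<longleftrightarrow> (\<exists>N. negligible N \<and> (\<forall>t\<in>S - N. P t))"
proof -
  have "(AE t in lebesgue_on S. P t) \<longleftrightarrow> (AE t in lebesgue. t \<in> S \<longrightarrow> P t)"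
    using assms by (intro AE_restrict_space_iff) auto
  also have "\<dots> \<longleftrightarrow> (\<exists>N. negligible N \<and> (\<forall>t\<in>S - N. P t))"
    unfolding negligible_iff_null_sets eventually_ae_filter by auto
  finally show ?thesis .
qed

text \<open>For Banach-valued functions on measurable sets this amounts to Bochner integrability,
  without naming the value of the integral. Both \<open>L_1\<close> and \<open>L_infinity\<close>
  lead to it.\<close>

definition norm_integrable_on :: "real set \<Rightarrow> (real \<Rightarrow> 'b::real_normed_vector) \<Rightarrow> bool" where
  "norm_integrable_on S f \<longleftrightarrow>
    strongly_measurable (lebesgue_on S) f \<and> integrable (lebesgue_on S) (\<lambda>x. norm (f x))"

text \<open>One-sided, because all kernels lie to the right of their base point and monotonicity
  needs forward increments. \<open>integral\<close> is 0 for a non-integrable integrand, so the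
  condition is informative only together with integrability.\<close>

definition right_Lebesgue_point :: "(real \<Rightarrow> 'b::real_normed_vector) \<Rightarrow> real \<Rightarrow> bool" where
  "right_Lebesgue_point f t \<longleftrightarrow>
    (\<forall>e>0. \<exists>d>0. \<forall>h. 0 < h \<and> h < d \<longrightarrow> integral {t..t+h} (\<lambda>s. norm (f s - f t)) \<le> e * h)"

lemma right_Lebesgue_pointD:
  assumes "right_Lebesgue_point f t" "0 < e"
  obtains d where "d > 0" "\<And>h. \<lbrakk>0 < h; h < d\<rbrakk> \<Longrightarrow> integral {t..t+h} (\<lambda>s. norm (f s - f t)) \<le> e * h"
  using assms unfolding right_Lebesgue_point_def by metis

lemma norm_integrable_on_diff_const:
  fixes f :: "real \<Rightarrow> 'b::real_normed_vector"
  assumes f: "norm_integrable_on S f" and S: "S \<in> lmeasurable"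
  shows "integrable (lebesgue_on S) (\<lambda>x. norm (f x - c))"
proof -
  interpret finite_measure "lebesgue_on S"
    by (rule finite_measure_lebesgue_on[OF S])
  show ?thesis
  proof (rule Bochner_Integration.integrable_bound)
    show "integrable (lebesgue_on S) (\<lambda>x. norm (f x) + norm c)"
      using f unfolding norm_integrable_on_def by simp
    show "(\<lambda>x. norm (f x - c)) \<in> borel_measurable (lebesgue_on S)"
      using f S unfolding norm_integrable_on_def
      by (intro strongly_measurable_borel_norm) auto
  qed (auto intro!: AE_I2 norm_triangle_ineq4)
qed

lemma norm_integrable_on_subinterval:
  fixes f :: "real \<Rightarrow> 'b::real_normed_vector"
  assumes f: "norm_integrable_on S f" and S: "S \<in> lmeasurable" and "{a..b} \<subseteq> S"
  shows "(\<lambda>x. norm (f x - c)) integrable_on {a..b}"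
proof -
  have "(\<lambda>x. norm (f x - c)) integrable_on S"
    using norm_integrable_on_diff_const[OF f S] S by (intro integrable_on_lebesgue_on) auto
  then show ?thesis
    using integrable_on_subinterval assms(3) by blast
qed

text \<open>Lebesgue differentiation is applied to the real functions \<open>norm (f s - c)\<close>.
  Letting \<open>c\<close> range over all vectors would give uncountably many exceptional sets; the
  countably many values of the simple approximants suffice, since almost every \<open>f t\<close> is
  a limit of such values.\<close>

lemma right_Lebesgue_point_AE:
  fixes f :: "real \<Rightarrow> 'b::real_normed_vector"
  assumes f: "norm_integrable_on {a<..<b} f"
  shows "AE t in lebesgue_on {a<..<b}. right_Lebesgue_point f t"
proof -
  let ?S = "{a<..<b}"
  have S: "?S \<in> lmeasurable" by simp
  obtain r where r: "\<And>i::nat. simple_function (lebesgue_on ?S) (r i)"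
      "AE x in lebesgue_on ?S. (\<lambda>i. r i x) \<longlonglongrightarrow> f x"
    using f unfolding norm_integrable_on_def strongly_measurable_def by blast
  obtain N0 where N0: "negligible N0" "\<And>x. x \<in> ?S - N0 \<Longrightarrow> (\<lambda>i. r i x) \<longlonglongrightarrow> f x"
    using r(2) by (subst (asm) AE_lebesgue_on_iff_negligible) auto
  define D where "D = (\<Union>i. r i ` ?S)"
  have "countable (r i ` ?S)" for i
    using simple_functionD(1)[OF r(1), of i] by (simp add: countable_finite)
  then have "countable D"
    unfolding D_def by simp
  have "\<exists>N. negligible N \<and> (\<forall>x e. x \<notin> N \<longrightarrow> 0 < e \<longrightarrow> (\<exists>d>0. \<forall>h. 0 < h \<and> h < d \<longrightarrow>
      \<bar>integral {x..x+h} (\<lambda>s. if s \<in> ?S then norm (f s - c) else 0) / h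
          - (if x \<in> ?S then norm (f x - c) else 0)\<bar> < e))" for c
  proof -
    have "(\<lambda>s. if s \<in> ?S then norm (f s - c) else 0) integrable_on cbox x y" for x y
    proof (rule integrable_on_subcbox[of _ UNIV])
      have "(\<lambda>x. norm (f x - c)) integrable_on ?S"
        using norm_integrable_on_diff_const[OF f S] by (intro integrable_on_lebesgue_on) auto
      then show "(\<lambda>s. if s \<in> ?S then norm (f s - c) else 0) integrable_on UNIV"
        by (simp only: Henstock_Kurzweil_Integration.integrable_restrict_UNIV)
    qed auto
    then obtain N where "negligible N"
      "\<And>x e. \<lbrakk>x \<notin> N; 0 < e\<rbrakk> \<Longrightarrow> \<exists>d>0. \<forall>h. 0 < h \<and> h < d \<longrightarrow>
         norm (integral (cbox x (x + h *\<^sub>R One)) (\<lambda>s. if s \<in> ?S then norm (f s - c) else 0) /\<^sub>R h ^ DIM(real)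
           - (if x \<in> ?S then norm (f x - c) else 0)) < e"
      using integrable_ccontinuous_explicit by blast
    then show ?thesis
      by (intro exI[of _ N]) (simp add: divide_inverse mult.commute)
  qed
  \<comment> \<open>Exceptional sets are chosen for all \<open>c\<close>; only those with
    \<open>c \<in> D\<close> enter the union below.\<close>
  then have "\<exists>N. \<forall>c. negligible (N c) \<and> (\<forall>x e. x \<notin> N c \<longrightarrow> 0 < e \<longrightarrow> (\<exists>d>0. \<forall>h. 0 < h \<and> h < d \<longrightarrow>
      \<bar>integral {x..x+h} (\<lambda>s. if s \<in> ?S then norm (f s - c) else 0) / h
          - (if x \<in> ?S then norm (f x - c) else 0)\<bar> < e))"
    by (intro choice allI)
  then obtain N where N: "\<And>c. negligible (N c)"
    "\<And>c x e. \<lbrakk>x \<notin> N c; 0 < e\<rbrakk> \<Longrightarrow> \<exists>d>0. \<forall>h. 0 < h \<and> h < d \<longrightarrow>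
      \<bar>integral {x..x+h} (\<lambda>s. if s \<in> ?S then norm (f s - c) else 0) / h
          - (if x \<in> ?S then norm (f x - c) else 0)\<bar> < e"
    by blast
  have neg: "negligible (N0 \<union> (\<Union>c\<in>D. N c))"
    using N0(1) N(1) \<open>countable D\<close> by (intro negligible_Un negligible_countable_Union) auto
  have "right_Lebesgue_point f t" if t: "t \<in> ?S - (N0 \<union> (\<Union>c\<in>D. N c))" for t
    unfolding right_Lebesgue_point_def
  proof (intro allI impI)
    fix e :: real assume "0 < e"
    obtain i where i: "dist (r i t) (f t) < e / 3"
      using N0(2)[of t] t metric_LIMSEQ_D[of "\<lambda>i. r i t" "f t" "e/3"] \<open>0 < e\<close> by auto
    define c where "c = r i t"
    have "c \<in> D" using t unfolding c_def D_def by blast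
    then obtain d where d: "d > 0" "\<And>h. \<lbrakk>0 < h; h < d\<rbrakk> \<Longrightarrow>
       \<bar>integral {t..t+h} (\<lambda>s. if s \<in> ?S then norm (f s - c) else 0) / h - norm (f t - c)\<bar> < e / 3"
      using N(2)[of t c "e/3"] t \<open>0 < e\<close> by auto
    \<comment> \<open>For small \<open>h\<close> the average of \<open>norm (f s - c)\<close> is
      below \<open>2 * e / 3\<close>, and passing from \<open>c\<close> back to \<open>f t\<close>
      costs another \<open>e / 3\<close>.\<close>
    have ct: "norm (f t - c) < e / 3"
      using i by (simp add: c_def dist_norm norm_minus_commute)
    have "integral {t..t+h} (\<lambda>s. norm (f s - f t)) \<le> e * h" if h: "0 < h" "h < min d (b - t)" for h
    proof -
      have sub: "{t..t+h} \<subseteq> ?S" using t h by auto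
      note int = norm_integrable_on_subinterval[OF f S sub]
      have "integral {t..t+h} (\<lambda>s. norm (f s - f t)) \<le> integral {t..t+h} (\<lambda>s. norm (f s - c) + e / 3)"
      proof (rule integral_le[OF int])
        show "(\<lambda>s. norm (f s - c) + e / 3) integrable_on {t..t+h}"
          by (intro integrable_add int integrable_const_ivl)
        fix s
        show "norm (f s - f t) \<le> norm (f s - c) + e / 3"
          using norm_triangle_ineq4[of "f s - c" "f t - c"] ct by (simp add: algebra_simps)
      qed
      also have "\<dots> = integral {t..t+h} (\<lambda>s. norm (f s - c)) + e / 3 * h"
        using h by (subst Henstock_Kurzweil_Integration.integral_add[OF int integrable_const_ivl]) auto
      also have "\<dots> \<le> (2 * e / 3) * h + e / 3 * h"
      proof -
        have eq: "integral {t..t+h} (\<lambda>s. norm (f s - c))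
            = integral {t..t+h} (\<lambda>s. if s \<in> ?S then norm (f s - c) else 0)"
          using sub by (intro integral_cong) auto
        have "integral {t..t+h} (\<lambda>s. norm (f s - c)) / h < 2 * e / 3"
          using d(2)[of h] h ct unfolding eq by linarith
        then show ?thesis using h by (simp add: pos_divide_less_eq)
      qed
      finally show ?thesis by (simp add: algebra_simps)
    qed
    then show "\<exists>d>0. \<forall>h. 0 < h \<and> h < d \<longrightarrow> integral {t..t+h} (\<lambda>s. norm (f s - f t)) \<le> e * h"
      using d(1) t by (intro exI[of _ "min d (b - t)"]) auto
  qed
  then show ?thesis
    using neg S by (subst AE_lebesgue_on_iff_negligible) (blast intro: fmeasurableD)+
qed

lemma right_Lebesgue_point_continuous:
  fixes f :: "real \<Rightarrow> 'b::real_normed_vector"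
  assumes f: "continuous_on {a<..<b} f" and t: "t \<in> {a<..<b}"
  shows "right_Lebesgue_point f t"
  unfolding right_Lebesgue_point_def
proof (intro allI impI)
  fix e :: real assume "0 < e"
  then obtain d where d: "d > 0" "\<And>s. \<lbrakk>s \<in> {a<..<b}; dist s t < d\<rbrakk> \<Longrightarrow> dist (f s) (f t) < e"
    using f t unfolding continuous_on_iff by metis
  have "integral {t..t+h} (\<lambda>s. norm (f s - f t)) \<le> e * h" if h: "0 < h" "h < min d (b - t)" for h
  proof -
    have "norm (f s - f t) \<le> e" if "s \<in> {t..t+h}" for s
      using d(2)[of s] that h t by (auto simp: dist_norm)
    moreover have "(\<lambda>s. norm (f s - f t)) integrable_on {t..t+h}"
      using h t by (intro integrable_continuous_real continuous_intros continuous_on_subset[OF f]) auto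
    ultimately have "integral {t..t+h} (\<lambda>s. norm (f s - f t)) \<le> integral {t..t+h} (\<lambda>s. e)"
      by (intro integral_le) auto
    then show ?thesis using h by (simp add: mult.commute)
  qed
  then show "\<exists>d>0. \<forall>h. 0 < h \<and> h < d \<longrightarrow> integral {t..t+h} (\<lambda>s. norm (f s - f t)) \<le> e * h"
    using d(1) t by (intro exI[of _ "min d (b - t)"]) auto
qed

text \<open>The kernel has mass 1, being the derivative of a function that rises from 0 to 1 across
  \<open>[c, c + e]\<close>. The error is therefore the integral of \<open>p t - p c\<close> against
  a kernel bounded by \<open>C / e\<close>.\<close>

lemma mollification_near_Lebesgue_point:
  fixes p :: "real \<Rightarrow> real"
  assumes \<eta>: "smooth \<eta>" "\<And>t. 0 \<le> \<eta> t" "\<And>t. \<eta> t \<le> C"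
    and \<Theta>: "\<And>t. (\<Theta> has_real_derivative \<eta> t) (at t)" "\<And>t. t \<le> 0 \<Longrightarrow> \<Theta> t = 0" "\<And>t. t \<ge> 1 \<Longrightarrow> \<Theta> t = 1"
    and e: "0 < e" and p: "p absolutely_integrable_on {c..c+e}"
  shows "(\<lambda>t. \<eta> ((t - c) / e) / e * p t) integrable_on {c..c+e}"
    and "\<bar>integral {c..c+e} (\<lambda>t. \<eta> ((t - c) / e) / e * p t) - p c\<bar>
          \<le> C / e * integral {c..c+e} (\<lambda>t. \<bar>p t - p c\<bar>)"
proof -
  let ?k = "\<lambda>t. \<eta> ((t - c) / e) / e"
  have cont: "continuous_on S ?k" for S
    using e by (intro continuous_intros continuous_on_compose2[OF smooth_continuous[OF \<eta>(1), of UNIV]]) auto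
  have prod: "(\<lambda>t. ?k t * q t) absolutely_integrable_on {c..c+e}" if "q absolutely_integrable_on {c..c+e}" for q :: "real \<Rightarrow> real"
    using that by (intro absolutely_integrable_bounded_measurable_product_real
        continuous_imp_measurable_on_sets_lebesgue cont compact_imp_bounded compact_continuous_image) auto
  show int: "(\<lambda>t. ?k t * p t) integrable_on {c..c+e}"
    by (rule set_lebesgue_integral_eq_integral(1)[OF prod[OF p]])
  have D: "((\<lambda>t. \<Theta> ((t - c) / e)) has_real_derivative ?k t) (at t)" for t
  proof -
    have "((\<lambda>t. (t - c) / e) has_real_derivative 1 / e) (at t)"
      using e by (auto intro!: derivative_eq_intros)
    from DERIV_chain2[OF \<Theta>(1) this] show ?thesis by simp
  qed
  have "(?k has_integral \<Theta> ((c + e - c) / e) - \<Theta> ((c - c) / e)) {c..c+e}"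
    using e by (intro fundamental_theorem_of_calculus)
      (auto intro: has_field_derivative_at_within[OF D] simp flip: has_real_derivative_iff_has_vector_derivative)
  then have 1: "(?k has_integral 1) {c..c+e}"
    using e by (simp add: \<Theta>)
  have pc: "(\<lambda>t. p t - p c) absolutely_integrable_on {c..c+e}"
    using p by (intro set_integral_diff(1)) auto
  have "integral {c..c+e} (\<lambda>t. ?k t * p t) - p c = integral {c..c+e} (\<lambda>t. ?k t * p t) - integral {c..c+e} (\<lambda>t. ?k t * p c)"
    using integral_unique[OF has_integral_mult_left[OF 1, of "p c"]] by simp
  also have "\<dots> = integral {c..c+e} (\<lambda>t. ?k t * (p t - p c))"
    using int has_integral_mult_left[OF 1, of "p c"]
    by (subst Henstock_Kurzweil_Integration.integral_diff[symmetric])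
       (auto simp: right_diff_distrib intro: has_integral_integrable)
  also have "\<bar>\<dots>\<bar> \<le> integral {c..c+e} (\<lambda>t. C / e * \<bar>p t - p c\<bar>)"
  unfolding real_norm_def[symmetric]
  proof (rule Henstock_Kurzweil_Integration.integral_norm_bound_integral, unfold real_norm_def)
    show "(\<lambda>t. ?k t * (p t - p c)) integrable_on {c..c+e}"
      by (rule set_lebesgue_integral_eq_integral(1)[OF prod[OF pc]])
    show "(\<lambda>t. C / e * \<bar>p t - p c\<bar>) integrable_on {c..c+e}"
      using pc unfolding absolutely_integrable_on_def by (intro integrable_on_mult_right) auto
    show "\<bar>?k t * (p t - p c)\<bar> \<le> C / e * \<bar>p t - p c\<bar>" for t
      using \<eta>(2,3) e by (auto simp: abs_mult intro!: mult_right_mono divide_right_mono)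
  qed
  finally show "\<bar>integral {c..c+e} (\<lambda>t. ?k t * p t) - p c\<bar> \<le> C / e * integral {c..c+e} (\<lambda>t. \<bar>p t - p c\<bar>)"
    by simp
qed

lemma mollification_tendsto:
  fixes p :: "real \<Rightarrow> real"
  assumes \<eta>: "smooth \<eta>" "\<And>t. 0 \<le> \<eta> t" "\<And>t. \<eta> t \<le> C"
    and \<Theta>: "\<And>t. (\<Theta> has_real_derivative \<eta> t) (at t)" "\<And>t. t \<le> 0 \<Longrightarrow> \<Theta> t = 0" "\<And>t. t \<ge> 1 \<Longrightarrow> \<Theta> t = 1"
    and p: "p absolutely_integrable_on {0<..<T}" "right_Lebesgue_point p c" "0 < c" "c < T"
  shows "((\<lambda>e. integral {c..c+e} (\<lambda>t. \<eta> ((t - c) / e) / e * p t)) \<longlongrightarrow> p c) (at_right 0)"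
proof (rule tendstoI)
  fix r :: real assume r: "0 < r"
  have C: "C \<ge> 0" using \<eta>(2,3) order_trans by blast
  \<comment> \<open>With the denominator \<open>C + 1\<close> the final bound
    \<open>r * (C / (C + 1))\<close> is strictly below \<open>r\<close>, also for
    \<open>C = 0\<close>.\<close>
  then have "0 < r / (C + 1)" using r by simp
  then obtain d where d: "d > 0"
    "\<And>h. \<lbrakk>0 < h; h < d\<rbrakk> \<Longrightarrow> integral {c..c+h} (\<lambda>s. norm (p s - p c)) \<le> r / (C + 1) * h"
    using right_Lebesgue_pointD[OF p(2)] by metis
  have "\<bar>integral {c..c+e} (\<lambda>t. \<eta> ((t - c) / e) / e * p t) - p c\<bar> < r" if e: "0 < e" "e < min d (T - c)" for e
  proof -
    have "p absolutely_integrable_on {c..c+e}"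
      using p e by (intro set_integrable_subset[OF p(1)]) auto
    then have "\<bar>integral {c..c+e} (\<lambda>t. \<eta> ((t - c) / e) / e * p t) - p c\<bar>
        \<le> C / e * integral {c..c+e} (\<lambda>t. \<bar>p t - p c\<bar>)"
      by (intro mollification_near_Lebesgue_point[OF \<eta> \<Theta>]) (use e in auto)
    also have "\<dots> \<le> C / e * (r / (C + 1) * e)"
      using d(2)[of e] e C by (intro mult_left_mono) auto
    also have "\<dots> = r * (C / (C + 1))"
      using e by simp
    also have "\<dots> < r * 1"
      using r C by (intro mult_strict_left_mono) auto
    finally show ?thesis by simp
  qed
  then show "eventually (\<lambda>e. dist (integral {c..c+e} (\<lambda>t. \<eta> ((t - c) / e) / e * p t)) (p c) < r) (at_right 0)"
    unfolding eventually_at_right[OF zero_less_one]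
    using d(1) p by (intro exI[of _ "min d (T - c)"]) (auto simp: dist_real_def)
qed

text \<open>Testing against a smoothed indicator of \<open>[a, b]\<close> and shrinking the smoothing gives the
  du Bois-Reymond lemma with explicit exceptional points.\<close>

lemma weak_derivative_real_FTC:
  fixes p q :: "real \<Rightarrow> real"
  assumes p: "p absolutely_integrable_on {0<..<T}" and q: "q absolutely_integrable_on {0<..<T}"
    and weak: "\<And>\<phi>. test_function T \<phi> \<Longrightarrow>
      integral {0<..<T} (\<lambda>t. deriv \<phi> t * p t) = - integral {0<..<T} (\<lambda>t. \<phi> t * q t)"
    and ab: "0 < a" "a < b" "b < T" "right_Lebesgue_point p a" "right_Lebesgue_point p b"
  shows "p b - p a = integral {a..b} q"
proof -
  let ?S = "{0<..<T}"
  obtain \<eta> \<Theta> C where \<eta>: "smooth \<eta>" "\<And>t. 0 \<le> \<eta> t" "\<And>t. \<eta> t \<le> C" "\<And>t. t \<notin> {0<..<1} \<Longrightarrow> \<eta> t = 0"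
    and \<Theta>: "\<And>t. (\<Theta> has_real_derivative \<eta> t) (at t)" "\<And>t. t \<le> 0 \<Longrightarrow> \<Theta> t = 0" "\<And>t. t \<ge> 1 \<Longrightarrow> \<Theta> t = 1"
    by (rule mollifier_exists) blast
  \<comment> \<open>The shift by 2 keeps \<open>b + e n\<close> strictly below \<open>T\<close>
    already for \<open>n = 0\<close>.\<close>
  define e where "e n = (T - b) / real (n + 2)" for n
  have e: "0 < e n" "b + e n < T" for n
  proof -
    have "(T - b) / real (n + 2) < (T - b) / 1"
      using ab by (intro divide_strict_left_mono) auto
    then show "0 < e n" "b + e n < T" using ab by (auto simp: e_def)
  qed
  have "e \<longlonglongrightarrow> 0"
    unfolding e_def by (rule LIMSEQ_ignore_initial_segment[OF lim_const_over_n])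
  have e0: "filterlim e (at_right 0) sequentially"
  proof -
    have "e n \<in> {0<..} \<and> e n \<noteq> 0" for n using e(1)[of n] by simp
    then show ?thesis using \<open>e \<longlonglongrightarrow> 0\<close> by (simp add: filterlim_at)
  qed
  define \<phi> where "\<phi> n = (\<lambda>t. \<Theta> ((t - a) / e n) - \<Theta> ((t - b) / e n))" for n
  have \<phi>: "test_function T (\<phi> n)" "deriv (\<phi> n) t = \<eta> ((t - a) / e n) / e n - \<eta> ((t - b) / e n) / e n"
    "0 \<le> \<phi> n t" "\<phi> n t \<le> 1" "\<lbrakk>a + e n \<le> t; t \<le> b\<rbrakk> \<Longrightarrow> \<phi> n t = 1" "t \<notin> {a..b + e n} \<Longrightarrow> \<phi> n t = 0"
    for n t
    unfolding \<phi>_def by (rule smoothed_indicator[where \<eta>=\<eta>]; (assumption | rule \<eta>(1,2,4) \<Theta> ab e)+)+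
  have *: "integral ?S (\<lambda>t. \<eta> ((t - c) / e n) / e n * p t)
        = integral {c..c+e n} (\<lambda>t. \<eta> ((t - c) / e n) / e n * p t)"
     "(\<lambda>t. \<eta> ((t - c) / e n) / e n * p t) integrable_on ?S"
    if "0 < c" "c + e n < T" for c n
  proof -
    have "p absolutely_integrable_on {c..c+e n}"
      using that by (intro set_integrable_subset[OF p]) auto
    then have "(\<lambda>t. \<eta> ((t - c) / e n) / e n * p t) integrable_on {c..c+e n}"
      by (intro mollification_near_Lebesgue_point(1)[OF \<eta>(1-3) \<Theta> e(1)])
    then have "((\<lambda>t. \<eta> ((t - c) / e n) / e n * p t) has_integral
        integral {c..c+e n} (\<lambda>t. \<eta> ((t - c) / e n) / e n * p t)) ?S"
      using that e[of n]
      by (intro has_integral_on_superset[OF integrable_integral]) (auto simp: \<eta>(4) field_simps)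
    then show "integral ?S (\<lambda>t. \<eta> ((t - c) / e n) / e n * p t)
        = integral {c..c+e n} (\<lambda>t. \<eta> ((t - c) / e n) / e n * p t)"
     "(\<lambda>t. \<eta> ((t - c) / e n) / e n * p t) integrable_on ?S"
      by blast+
  qed
  have lhs: "(\<lambda>n. integral ?S (\<lambda>t. deriv (\<phi> n) t * p t)) = (\<lambda>n.
      integral {a..a+e n} (\<lambda>t. \<eta> ((t - a) / e n) / e n * p t)
    - integral {b..b+e n} (\<lambda>t. \<eta> ((t - b) / e n) / e n * p t))"
  proof
    fix n
    have "a + e n < T" using e[of n] ab by linarith
    note I = *[of b n, OF _ e(2)] *[of a n, OF ab(1) this]
    have "integral ?S (\<lambda>t. deriv (\<phi> n) t * p t)
      = integral ?S (\<lambda>t. \<eta> ((t - a) / e n) / e n * p t - \<eta> ((t - b) / e n) / e n * p t)"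
      by (simp add: \<phi>(2) left_diff_distrib)
    also have "\<dots> = integral {a..a+e n} (\<lambda>t. \<eta> ((t - a) / e n) / e n * p t)
        - integral {b..b+e n} (\<lambda>t. \<eta> ((t - b) / e n) / e n * p t)"
      using I ab by (subst Henstock_Kurzweil_Integration.integral_diff) auto
    finally show "integral ?S (\<lambda>t. deriv (\<phi> n) t * p t) =
      integral {a..a+e n} (\<lambda>t. \<eta> ((t - a) / e n) / e n * p t)
        - integral {b..b+e n} (\<lambda>t. \<eta> ((t - b) / e n) / e n * p t)" .
  qed
  have "(\<lambda>n. integral {a..a+e n} (\<lambda>t. \<eta> ((t - a) / e n) / e n * p t)
    - integral {b..b+e n} (\<lambda>t. \<eta> ((t - b) / e n) / e n * p t)) \<longlonglongrightarrow> p a - p b"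
    using ab by (intro tendsto_diff filterlim_compose[OF mollification_tendsto[OF \<eta>(1-3) \<Theta> p] e0]) auto
  then have L1: "(\<lambda>n. - integral ?S (\<lambda>t. \<phi> n t * q t)) \<longlonglongrightarrow> p a - p b"
    unfolding lhs[symmetric] weak[OF \<phi>(1)] .
  \<comment> \<open>The cutoffs converge pointwise to the indicator of a half-open interval: at
    \<open>b\<close> the falling ramp has not started, at \<open>a\<close> the rising one is still
    0.\<close>
  have L2: "(\<lambda>n. integral ?S (\<lambda>t. \<phi> n t * q t)) \<longlonglongrightarrow> integral ?S (\<lambda>t. if t \<in> {a<..b} then q t else 0)"
  proof (rule dominated_convergence(2))
    show "(\<lambda>t. \<phi> n t * q t) integrable_on ?S" for n
    proof -
      have "continuous_on S (\<phi> n)" for S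
        using \<phi>(1)[of n] smooth_continuous unfolding test_function_def smooth_def by blast
      then have "(\<lambda>t. \<phi> n t * q t) absolutely_integrable_on ?S"
        using \<phi>(3,4)[of n]
        by (intro absolutely_integrable_bounded_measurable_product_real
            continuous_imp_measurable_on_sets_lebesgue q boundedI[of _ 1]) auto
      then show ?thesis by (rule set_lebesgue_integral_eq_integral(1))
    qed
    show "(\<lambda>t. \<bar>q t\<bar>) integrable_on ?S"
      using q unfolding absolutely_integrable_on_def real_norm_def by (rule conjunct2)
    show "norm (\<phi> n t * q t) \<le> \<bar>q t\<bar>" for n t
      using \<phi>(3,4)[of n t] by (simp add: abs_mult mult_left_le_one_le)
    show "(\<lambda>n. \<phi> n t * q t) \<longlonglongrightarrow> (if t \<in> {a<..b} then q t else 0)" for t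
    proof -
      have "eventually (\<lambda>n. \<phi> n t * q t = (if t \<in> {a<..b} then q t else 0)) sequentially"
      proof (cases "t > a \<and> t \<noteq> b")
        case True
        then have "eventually (\<lambda>n. e n < min (t - a) \<bar>t - b\<bar>) sequentially"
          using \<open>e \<longlonglongrightarrow> 0\<close> by (intro order_tendstoD(2)[of e 0]) auto
        then show ?thesis
        proof eventually_elim
          case (elim n)
          then show ?case using \<phi>(5)[of n t] \<phi>(6)[of t n] True by (cases "t < b") auto
        qed
      next
        case False
        show ?thesis
        proof (cases "t = b")
          case True
          have "eventually (\<lambda>n. e n < b - a) sequentially"
            using \<open>e \<longlonglongrightarrow> 0\<close> ab by (intro order_tendstoD(2)[of e 0]) auto
          then show ?thesis
            by eventually_elim (use True \<phi>(5)[of _ t] ab in auto)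
        next
          case F: False
          have "\<phi> n t = 0" for n
          proof (cases "t = a")
            case True
            then show ?thesis
              unfolding \<phi>_def using ab e[of n] by (simp add: \<Theta>(2) divide_nonpos_pos)
          next
            case F2: False
            then show ?thesis using \<phi>(6)[of t n] False F by auto
          qed
          then show ?thesis using False F by auto
        qed
      qed
      then show ?thesis
        by (rule tendsto_eventually)
    qed
  qed
  have "p a - p b = - integral ?S (\<lambda>t. if t \<in> {a<..b} then q t else 0)"
    by (rule LIMSEQ_unique[OF L1 tendsto_minus[OF L2]])
  also have "integral ?S (\<lambda>t. if t \<in> {a<..b} then q t else 0) = integral {a<..b} q"
  proof -
    have "{a<..b} \<inter> ?S = {a<..b}" using ab by auto
    then show ?thesis by (simp only: Henstock_Kurzweil_Integration.integral_restrict_Int)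
  qed
  also have "integral {a<..b} q = integral {a..b} q"
    by (rule integral_spike_set; rule negligible_subset[of "{a}"]) auto
  finally show ?thesis by simp
qed

section \<open>Monotonicity from a Dini derivative\<close>

text \<open>Absolute continuity of the integral through open sets: the measure of
  \<open>V n - N\<close> tends to 0, so the intersection of all \<open>V n\<close> is still
  negligible, and dominated convergence sends the integral of \<open>m\<close> over the decreasing
  sets \<open>U n\<close> to 0.\<close>

lemma open_cover_small_integral:
  fixes m :: "real \<Rightarrow> real"
  assumes m: "m integrable_on {a..b}" "\<And>t. 0 \<le> m t" and N: "negligible N" and "0 < e"
  obtains U where "open U" "N \<subseteq> U" "(\<lambda>t. if t \<in> U then m t else 0) integrable_on {a..b}"
    "integral {a..b} (\<lambda>t. if t \<in> U then m t else 0) < e"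
proof -
  have N_sets: "N \<in> sets lebesgue"
    using N negligible_iff_null_sets by blast
  have "\<exists>V. open V \<and> N \<subseteq> V \<and> emeasure lebesgue (V - N) < ennreal (1 / (real n + 1))" for n
    using sets_lebesgue_outer_open[OF N_sets, of "1 / (real n + 1)"] by (metis add_nonneg_pos divide_pos_pos of_nat_0_le_iff zero_less_one)
  then obtain V where V: "\<And>n. open (V n)" "\<And>n. N \<subseteq> V n"
    "\<And>n. emeasure lebesgue (V n - N) < ennreal (1 / (real n + 1))"
    by metis
  define U where "U n = (\<Inter>i\<le>n. V i)" for n
  have U: "open (U n)" "N \<subseteq> U n" for n
    using V by (auto simp: U_def)
  have V_sets: "V n \<in> sets lebesgue" for n
    using V(1) by (simp add: borel_open)
  have "emeasure lebesgue ((\<Inter>n. V n) - N) \<le> ennreal (1 / (real n + 1))" for n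
  proof -
    have "emeasure lebesgue ((\<Inter>n. V n) - N) \<le> emeasure lebesgue (V n - N)"
      using V_sets N_sets by (intro emeasure_mono) auto
    then show ?thesis using V(3)[of n] by (meson less_imp_le order_trans)
  qed
  then have "emeasure lebesgue ((\<Inter>n. V n) - N) \<le> 0"
  proof (intro LIMSEQ_le_const[of "\<lambda>n. ennreal (1 / (real n + 1))"])
    have "(\<lambda>n. 1 / (real n + 1)) \<longlonglongrightarrow> 0"
      using LIMSEQ_inverse_real_of_nat by (simp add: inverse_eq_divide add.commute)
    then show "(\<lambda>n. ennreal (1 / (real n + 1))) \<longlonglongrightarrow> 0"
      using tendsto_ennrealI by fastforce
  qed auto
  then have "(\<Inter>n. V n) - N \<in> null_sets lebesgue"
    using V_sets N_sets by (intro null_setsI) auto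
  then have neg: "negligible (\<Inter>n. V n)"
    using N negligible_iff_null_sets by (metis Diff_partition Inf_greatest V(2) image_iff negligible_Un)
  have abs: "m absolutely_integrable_on {a..b}"
    using m by (simp add: nonnegative_absolutely_integrable_1)
  have int: "(\<lambda>t. if t \<in> U n then m t else 0) integrable_on {a..b}" for n
  proof -
    have "m absolutely_integrable_on ({a..b} \<inter> U n)"
      using U by (intro set_integrable_subset[OF abs]) (auto simp: borel_open)
    then show ?thesis
      by (simp add: absolutely_integrable_on_def Henstock_Kurzweil_Integration.integrable_restrict_Int Int_commute)
  qed
  have "(\<lambda>n. integral {a..b} (\<lambda>t. if t \<in> U n then m t else 0))
      \<longlonglongrightarrow> integral {a..b} (\<lambda>t. if t \<in> (\<Inter>n. V n) then m t else 0)"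
  proof (rule dominated_convergence(2)[OF int m(1)])
    fix t
    show "(\<lambda>n. if t \<in> U n then m t else 0) \<longlonglongrightarrow> (if t \<in> (\<Inter>n. V n) then m t else 0)"
    proof (cases "t \<in> (\<Inter>n. V n)")
      case True
      then show ?thesis by (auto simp: U_def)
    next
      case False
      then obtain k where "t \<notin> V k" by auto
      then have "eventually (\<lambda>n. (if t \<in> U n then m t else 0) = 0) sequentially"
        unfolding eventually_sequentially by (intro exI[of _ k]) (auto simp: U_def)
      then show ?thesis unfolding if_not_P[OF False] by (rule tendsto_eventually)
    qed
  qed (use m in auto)
  also have "integral {a..b} (\<lambda>t. if t \<in> (\<Inter>n. V n) then m t else 0) = integral {a..b} (\<lambda>t. 0)"
    by (rule integral_spike[OF neg]) auto
  finally have "eventually (\<lambda>n. integral {a..b} (\<lambda>t. if t \<in> U n then m t else 0) < e) sequentially"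
    using \<open>0 < e\<close> by (intro order_tendstoD(2)) auto
  then obtain n where "integral {a..b} (\<lambda>t. if t \<in> U n then m t else 0) < e"
    unfolding eventually_sequentially by blast
  then show thesis
    using that[OF U int] by blast
qed

text \<open>The set of points up to which \<open>K\<close> grows by at most \<open>e (t - a)\<close> plus the integral of
  \<open>m\<close> over a small open neighbourhood of the exceptional set cannot have a supremum below \<open>b\<close>.\<close>

lemma nonincreasing_if_Dini_derivative_nonpos:
  fixes K m :: "real \<Rightarrow> real"
  assumes ab: "a \<le> b" and K: "continuous_on {a..b} K"
    and m: "m integrable_on {a..b}" "\<And>t. 0 \<le> m t"
    and local: "\<And>t. t \<in> {a..<b} \<Longrightarrow> \<exists>d>0. \<forall>t'. t < t' \<and> t' < t + d \<and> t' \<le> b \<longrightarrow>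
                  K t' - K t \<le> integral {t..t'} m"
    and N: "negligible N"
    and Dini: "\<And>t e. \<lbrakk>t \<in> {a<..<b} - N; 0 < e\<rbrakk> \<Longrightarrow> \<exists>t'. t < t' \<and> t' \<le> b \<and> K t' - K t \<le> e * (t' - t)"
  shows "K b \<le> K a"
proof (rule field_le_epsilon)
  fix r :: real assume "0 < r"
  \<comment> \<open>The slopes contribute \<open>e * (b - a)\<close> and the open neighbourhood
    contributes \<open>e\<close>; together these are \<open>r\<close>.\<close>
  define e where "e = r / (b - a + 1)"
  have e: "0 < e" using \<open>0 < r\<close> ab by (simp add: e_def)
  \<comment> \<open>The Dini hypothesis says nothing at \<open>a\<close>. Counting \<open>a\<close>
    as exceptional lets the local bound treat a supremum equal to \<open>a\<close>.\<close>
  have nN: "negligible (insert a N)" using N by simp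
  obtain U where U: "open U" "insert a N \<subseteq> U" and iU: "(\<lambda>t. if t \<in> U then m t else 0) integrable_on {a..b}"
    and lU: "integral {a..b} (\<lambda>t. if t \<in> U then m t else 0) < e"
    by (rule open_cover_small_integral[OF m nN e])
  define W where "W t = integral {a..t} (\<lambda>t. if t \<in> U then m t else 0)" for t
  have contW: "continuous_on {a..b} W"
    unfolding W_def by (rule indefinite_integral_continuous_1[OF iU])
  have W_diff: "W t' - W t = integral {t..t'} (\<lambda>t. if t \<in> U then m t else 0)" if "a \<le> t" "t \<le> t'" "t' \<le> b" for t t'
    unfolding W_def
    using that Henstock_Kurzweil_Integration.integral_combine[of a t t' "\<lambda>t. if t \<in> U then m t else 0"]
      integrable_on_subinterval[OF iU, of a t'] by (simp add: algebra_simps)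
  have W_mono: "W t \<le> W t'" if "a \<le> t" "t \<le> t'" "t' \<le> b" for t t'
  proof -
    have "0 \<le> integral {t..t'} (\<lambda>t. if t \<in> U then m t else 0)"
      using that m(2) by (intro integral_nonneg integrable_on_subinterval[OF iU]) auto
    then show ?thesis using W_diff[OF that] by simp
  qed
  define A where "A = {t \<in> {a..b}. K t - K a - e * (t - a) - W t \<le> 0}"
  have "closed A"
    unfolding A_def using K contW by (intro continuous_on_closed_Collect_le continuous_intros) auto
  moreover have "a \<in> A" using ab by (simp add: A_def W_def)
  moreover have bdd: "bdd_above A" by (auto simp: A_def intro: bdd_aboveI[of _ b])
  ultimately have s: "Sup A \<in> A" by (intro closed_contains_Sup) auto
  have "Sup A = b"
  proof (rule ccontr)
    assume "Sup A \<noteq> b"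
    then have sb: "a \<le> Sup A" "Sup A < b" using s by (auto simp: A_def)
    have "\<exists>t'\<in>A. Sup A < t'"
    \<comment> \<open>Inside \<open>U\<close> the increment of \<open>K\<close> is paid by
      \<open>W\<close>, which near this point grows like the integral of \<open>m\<close>. Outside
      \<open>U\<close> the point is not exceptional, so a step of slope \<open>e\<close> to the
      right exists, and \<open>W\<close> does not decrease.\<close>
    proof (cases "Sup A \<in> U")
      case True
      obtain d1 where d1: "0 < d1" "ball (Sup A) d1 \<subseteq> U"
        using U(1) True openE by blast
      obtain d where d: "0 < d" "\<And>t'. \<lbrakk>Sup A < t'; t' < Sup A + d; t' \<le> b\<rbrakk> \<Longrightarrow>
          K t' - K (Sup A) \<le> integral {Sup A..t'} m"
        using local[of "Sup A"] sb by auto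
      define t' where "t' = Sup A + min (min d d1) (b - Sup A) / 2"
      have t': "Sup A < t'" "t' < Sup A + d" "t' < Sup A + d1" "t' \<le> b"
        using d(1) d1(1) sb by (auto simp: t'_def min_def field_simps)
      have "{Sup A..t'} \<subseteq> U"
        using d1(2) t' by (auto simp: subset_iff dist_real_def)
      then have "integral {Sup A..t'} m = W t' - W (Sup A)"
        unfolding W_diff[OF sb(1) less_imp_le[OF t'(1)] t'(4)] by (intro integral_cong) auto
      then have "K t' - K (Sup A) \<le> W t' - W (Sup A)" using d(2)[OF t'(1,2,4)] by simp
      moreover have "e * (Sup A - a) \<le> e * (t' - a)" using e t' by simp
      ultimately have "t' \<in> A"
        using s t' sb unfolding A_def by auto
      then show ?thesis using t' by blast
    next
      case False
      then have "Sup A \<in> {a<..<b} - N" using U(2) sb by (cases "Sup A = a") auto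
      then obtain t' where t': "Sup A < t'" "t' \<le> b" "K t' - K (Sup A) \<le> e * (t' - Sup A)"
        using Dini e by blast
      moreover have "W (Sup A) \<le> W t'" using t' sb by (intro W_mono) auto
      ultimately have "t' \<in> A"
        using s sb unfolding A_def by (auto simp: algebra_simps)
      then show ?thesis using t' by blast
    qed
    then show False using cSup_upper[OF _ bdd] by fastforce
  qed
  then have "K b - K a \<le> e * (b - a) + W b" using s by (simp add: A_def)
  also have "\<dots> \<le> e * (b - a) + e" using lU by (simp add: W_def)
  also have "\<dots> = e * (b - a + 1)" by (simp add: algebra_simps)
  also have "\<dots> = r" using ab by (simp add: e_def)
  finally show "K b \<le> K a + r" by simp
qed

section \<open>Integral identities and increment bounds for vector-valued weak derivatives\<close>

lemma absolutely_integrable_on_iff_integrable_lebesgue_on: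
  fixes f :: "'a::euclidean_space \<Rightarrow> real"
  assumes "S \<in> sets lebesgue"
  shows "f absolutely_integrable_on S \<longleftrightarrow> integrable (lebesgue_on S) f"
  using assms by (simp add: set_integrable_def integrable_restrict_space)

text \<open>Since \<xi> commutes with the Bochner integral, the weak identity becomes scalar.
  Lebesgue points of \<open>f\<close> remain Lebesgue points after applying the bounded \<xi>, so
  the admissible endpoints do not depend on \<xi>, and \<xi> may be chosen in terms of them.\<close>

lemma weak_derivative_FTC:
  fixes f f' :: "real \<Rightarrow> 'b::banach" and \<xi> :: "'b \<Rightarrow> real"
  assumes weak: "weak_derivative T f f'"
    and f: "norm_integrable_on {0<..<T} f" and f': "norm_integrable_on {0<..<T} f'"
    and \<xi>: "bounded_linear \<xi>"
    and ab: "0 < a" "a < b" "b < T" "right_Lebesgue_point f a" "right_Lebesgue_point f b"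
  shows "\<xi> (f b) - \<xi> (f a) = integral {a..b} (\<lambda>t. \<xi> (f' t))"
    and "(\<lambda>t. \<xi> (f' t)) integrable_on {a..b}"
proof -
  let ?S = "{0<..<T}"
  have S: "?S \<in> lmeasurable" "?S \<in> sets lebesgue" by auto
  have abs: "(\<lambda>t. \<xi> (g t)) absolutely_integrable_on ?S" if "norm_integrable_on ?S g" for g :: "real \<Rightarrow> 'b"
  proof -
    have "integrable (lebesgue_on ?S) (\<lambda>t. \<xi> (g t))"
      using that Bochner_integral_bounded_linear(1)[OF S(2) _ _ \<xi>] unfolding norm_integrable_on_def
      by blast
    then show ?thesis
      using S by (simp add: absolutely_integrable_on_iff_integrable_lebesgue_on)
  qed
  have prod: "\<xi> (Bochner_integral (lebesgue_on ?S) (\<lambda>t. \<psi> t *\<^sub>R g t)) = integral ?S (\<lambda>t. \<psi> t * \<xi> (g t))"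
    if g: "norm_integrable_on ?S g" and \<psi>: "\<And>S. continuous_on S \<psi>" for g :: "real \<Rightarrow> 'b" and \<psi> :: "real \<Rightarrow> real"
  proof -
    have meas: "\<psi> \<in> borel_measurable (lebesgue_on ?S)"
      by (rule continuous_imp_measurable_on_sets_lebesgue[OF \<psi> S(2)])
    have sm: "strongly_measurable (lebesgue_on ?S) (\<lambda>t. \<psi> t *\<^sub>R g t)"
      using g meas unfolding norm_integrable_on_def by (intro strongly_measurable_scaleR) auto
    have bdd: "bounded (\<psi> ` ?S)"
      using compact_imp_bounded[OF compact_continuous_image[OF \<psi> compact_Icc, of 0 T]]
      by (rule bounded_subset) auto
    have "(\<lambda>t. norm (g t)) absolutely_integrable_on ?S"
      using g S unfolding norm_integrable_on_def
      by (simp add: absolutely_integrable_on_iff_integrable_lebesgue_on)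
    moreover have "bounded ((\<lambda>t. \<bar>\<psi> t\<bar>) ` ?S)"
      using bdd unfolding bounded_iff by auto
    ultimately have "(\<lambda>t. \<bar>\<psi> t\<bar> * norm (g t)) absolutely_integrable_on ?S"
      using meas S by (intro absolutely_integrable_bounded_measurable_product_real) auto
    then have "integrable (lebesgue_on ?S) (\<lambda>t. norm (\<psi> t *\<^sub>R g t))"
      using absolutely_integrable_imp_integrable S by fastforce
    from Bochner_integral_bounded_linear[OF S(2) sm this \<xi>] S show ?thesis
      by (simp add: lebesgue_integral_eq_integral linear_cmul[OF bounded_linear.linear[OF \<xi>]])
  qed
  have weak': "integral ?S (\<lambda>t. deriv \<phi> t * \<xi> (f t)) = - integral ?S (\<lambda>t. \<phi> t * \<xi> (f' t))"
    if \<phi>: "test_function T \<phi>" for \<phi>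
  proof -
    have sm: "smooth \<phi>" using \<phi> by (simp add: test_function_def smooth_def)
    have "\<xi> (Bochner_integral (lebesgue_on ?S) (\<lambda>t. deriv \<phi> t *\<^sub>R f t))
        = - \<xi> (Bochner_integral (lebesgue_on ?S) (\<lambda>t. \<phi> t *\<^sub>R f' t))"
      using weak \<phi> bounded_linear.linear[OF \<xi>] unfolding weak_derivative_def by (simp add: linear_neg)
    then show ?thesis
      using prod[OF f smooth_continuous[OF smooth_deriv[OF sm]]] prod[OF f' smooth_continuous[OF sm]] by simp
  qed
  obtain B where B: "B > 0" "\<And>x. \<bar>\<xi> x\<bar> \<le> norm x * B"
    using bounded_linear.pos_bounded[OF \<xi>] by auto
  have leb: "right_Lebesgue_point (\<lambda>t. \<xi> (f t)) c" if c: "right_Lebesgue_point f c" "0 < c" "c < T" for c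
    unfolding right_Lebesgue_point_def
  proof (intro allI impI)
    fix e :: real assume "0 < e"
    then have "0 < e / B" using B(1) by simp
    then obtain d where d: "d > 0" "\<And>h. \<lbrakk>0 < h; h < d\<rbrakk> \<Longrightarrow> integral {c..c+h} (\<lambda>s. norm (f s - f c)) \<le> e / B * h"
      using right_Lebesgue_pointD[OF c(1)] by metis
    have "integral {c..c+h} (\<lambda>s. norm (\<xi> (f s) - \<xi> (f c))) \<le> e * h" if h: "0 < h" "h < min d (T - c)" for h
    proof -
      have sub: "{c..c+h} \<subseteq> ?S" using h c by auto
      have "integral {c..c+h} (\<lambda>s. norm (\<xi> (f s) - \<xi> (f c))) \<le> integral {c..c+h} (\<lambda>s. norm (f s - f c) * B)"
      proof (rule integral_le)
        have "(\<lambda>s. \<xi> (f s)) absolutely_integrable_on {c..c+h}"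
          using set_integrable_subset[OF abs[OF f]] sub by auto
        then have "(\<lambda>s. \<xi> (f s) - \<xi> (f c)) absolutely_integrable_on {c..c+h}"
          by (intro set_integral_diff(1)) auto
        then show "(\<lambda>s. norm (\<xi> (f s) - \<xi> (f c))) integrable_on {c..c+h}"
          by (simp only: absolutely_integrable_on_def)
        show "(\<lambda>s. norm (f s - f c) * B) integrable_on {c..c+h}"
          using norm_integrable_on_subinterval[OF f S(1) sub] by (rule integrable_on_mult_left)
        show "norm (\<xi> (f s) - \<xi> (f c)) \<le> norm (f s - f c) * B" for s
          using B(2)[of "f s - f c"] by (simp add: linear_diff[OF bounded_linear.linear[OF \<xi>]])
      qed
      also have "\<dots> \<le> e / B * h * B"
        using mult_right_mono[OF d(2)[of h], of B] h B by simp
      finally show ?thesis using B by simp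
    qed
    then show "\<exists>d>0. \<forall>h. 0 < h \<and> h < d \<longrightarrow> integral {c..c+h} (\<lambda>s. norm (\<xi> (f s) - \<xi> (f c))) \<le> e * h"
      using d(1) c by (intro exI[of _ "min d (T - c)"]) auto
  qed
  show "\<xi> (f b) - \<xi> (f a) = integral {a..b} (\<lambda>t. \<xi> (f' t))"
    using ab by (intro weak_derivative_real_FTC[OF abs[OF f] abs[OF f'] weak'] leb) auto
  show "(\<lambda>t. \<xi> (f' t)) integrable_on {a..b}"
  proof (rule integrable_on_subinterval)
    show "(\<lambda>t. \<xi> (f' t)) integrable_on ?S"
      by (rule set_lebesgue_integral_eq_integral(1)[OF abs[OF f']])
  qed (use ab in auto)
qed

text \<open>The free vector \<open>c\<close> has two uses: \<open>c = 0\<close> gives Lipschitz and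
  absolute continuity bounds, while \<open>c\<close> equal to the value of the derivative at a
  Lebesgue point identifies the right derivative there.\<close>

lemma weak_derivative_increment:
  fixes f f' :: "real \<Rightarrow> 'b::banach" and \<xi> :: "'b \<Rightarrow> real"
  assumes weak: "weak_derivative T f f'"
    and f: "norm_integrable_on {0<..<T} f" and f': "norm_integrable_on {0<..<T} f'"
    and \<xi>: "bounded_linear \<xi>" "\<And>x. \<bar>\<xi> x\<bar> \<le> B * norm x"
    and ab: "0 < a" "a < b" "b < T" "right_Lebesgue_point f a" "right_Lebesgue_point f b"
  shows "\<bar>\<xi> (f b - f a - (b - a) *\<^sub>R c)\<bar> \<le> B * integral {a..b} (\<lambda>t. norm (f' t - c))"
proof -
  note FTC = weak_derivative_FTC[OF weak f f' \<xi>(1) ab]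
  note lin = bounded_linear.linear[OF \<xi>(1)]
  have "\<xi> (f b - f a - (b - a) *\<^sub>R c) = integral {a..b} (\<lambda>t. \<xi> (f' t)) - integral {a..b} (\<lambda>t. \<xi> c)"
    using FTC(1) ab by (simp add: linear_diff[OF lin] linear_cmul[OF lin])
  also have "\<dots> = integral {a..b} (\<lambda>t. \<xi> (f' t - c))"
    using FTC(2) by (subst Henstock_Kurzweil_Integration.integral_diff[symmetric]) (auto simp: linear_diff[OF lin])
  also have "\<bar>\<dots>\<bar> \<le> integral {a..b} (\<lambda>t. B * norm (f' t - c))"
  unfolding real_norm_def[symmetric]
  proof (rule Henstock_Kurzweil_Integration.integral_norm_bound_integral, unfold real_norm_def)
    show "(\<lambda>t. \<xi> (f' t - c)) integrable_on {a..b}"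
      unfolding linear_diff[OF lin] by (intro integrable_diff FTC(2) integrable_const_ivl)
    show "(\<lambda>t. B * norm (f' t - c)) integrable_on {a..b}"
      using ab by (intro integrable_on_mult_right norm_integrable_on_subinterval[OF f']) auto
  qed (rule \<xi>(2))
  finally show ?thesis by simp
qed

text \<open>The functional is the inner product with the remainder itself, which turns the scalar
  bound into a quadratic inequality for its norm.\<close>

lemma weak_derivative_increment_inner:
  fixes f f' :: "real \<Rightarrow> 'b::{real_inner,banach}"
  assumes weak: "weak_derivative T f f'"
    and f: "norm_integrable_on {0<..<T} f" and f': "norm_integrable_on {0<..<T} f'"
    and ab: "0 < a" "a < b" "b < T" "right_Lebesgue_point f a" "right_Lebesgue_point f b"
  shows "norm (f b - f a - (b - a) *\<^sub>R c) \<le> integral {a..b} (\<lambda>t. norm (f' t - c))"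
proof -
  define y where "y = f b - f a - (b - a) *\<^sub>R c"
  have "\<bar>inner y y\<bar> \<le> norm y * integral {a..b} (\<lambda>t. norm (f' t - c))"
    unfolding y_def
    by (intro weak_derivative_increment[OF weak f f' _ _ ab] bounded_linear_inner_right Cauchy_Schwarz_ineq2)
  then have "norm y * norm y \<le> norm y * integral {a..b} (\<lambda>t. norm (f' t - c))"
    by (simp add: dot_square_norm power2_eq_square)
  moreover have "0 \<le> integral {a..b} (\<lambda>t. norm (f' t - c))"
    by (rule integral_nonneg) (use ab in \<open>auto intro!: norm_integrable_on_subinterval[OF f']\<close>)
  ultimately show ?thesis
    unfolding y_def[symmetric] by (cases "y = 0") (auto simp: mult_le_cancel_left)
qed

text \<open>The functionals are evaluations at vectors, over which the operator norm is
  taken.\<close>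

lemma weak_derivative_increment_dual:
  fixes f f' :: "real \<Rightarrow> ('b::real_normed_vector \<Rightarrow>\<^sub>L real)"
  assumes weak: "weak_derivative T f f'"
    and f: "norm_integrable_on {0<..<T} f" and f': "norm_integrable_on {0<..<T} f'"
    and ab: "0 < a" "a < b" "b < T" "right_Lebesgue_point f a" "right_Lebesgue_point f b"
  shows "norm (f b - f a - (b - a) *\<^sub>R c) \<le> integral {a..b} (\<lambda>t. norm (f' t - c))"
proof (rule norm_blinfun_bound)
  show "0 \<le> integral {a..b} (\<lambda>t. norm (f' t - c))"
    by (rule integral_nonneg) (use ab in \<open>auto intro!: norm_integrable_on_subinterval[OF f']\<close>)
  fix x
  have "\<bar>blinfun_apply (f b - f a - (b - a) *\<^sub>R c) x\<bar> \<le> norm x * integral {a..b} (\<lambda>t. norm (f' t - c))"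
    by (intro weak_derivative_increment[OF weak f f' _ _ ab, of "\<lambda>y. blinfun_apply y x"]
          bounded_linear_intros)
       (metis mult.commute norm_blinfun real_norm_def)
  then show "norm (blinfun_apply (f b - f a - (b - a) *\<^sub>R c) x) \<le> integral {a..b} (\<lambda>t. norm (f' t - c)) * norm x"
    by (simp add: mult.commute)
qed

section \<open>Regularity of trajectories and the energy\<close>

lemma L_1_imp_norm_integrable_on:
  assumes "L_1 T f"
  shows "norm_integrable_on {0<..<T} f"
proof -
  obtain I where I: "has_Bochner_integral (lebesgue_on {0<..<T}) f I"
    using assms unfolding L_1_def by blast
  then have "strongly_measurable (lebesgue_on {0<..<T}) f"
    unfolding has_Bochner_integral_def by (rule conjunct1)
  moreover have "integrable (lebesgue_on {0<..<T}) (\<lambda>x. norm (f x))"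
    by (rule has_Bochner_integral_norm_integrable[OF _ I]) simp
  ultimately show ?thesis
    unfolding norm_integrable_on_def by (rule conjI)
qed

lemma L_infinity_imp_norm_integrable_on:
  assumes "L_infinity T f"
  shows "norm_integrable_on {0<..<T} f"
proof -
  interpret finite_measure "lebesgue_on {0<..<T}"
    by (rule finite_measure_lebesgue_on) simp
  obtain C where f: "strongly_measurable (lebesgue_on {0<..<T}) f" "AE t in lebesgue_on {0<..<T}. norm (f t) \<le> C"
    using assms unfolding L_infinity_def by blast
  have "(\<lambda>t. norm (f t)) \<in> borel_measurable (lebesgue_on {0<..<T})"
    using strongly_measurable_borel_norm[OF _ f(1) simple_function_const, of 0] by simp
  then show ?thesis
    unfolding norm_integrable_on_def using f by (auto intro!: integrable_const_bound)
qed

lemma right_Lebesgue_point_imp_right_derivative: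
  fixes A g :: "real \<Rightarrow> 'b::real_normed_vector"
  assumes g: "right_Lebesgue_point g t" and "t < T"
    and A: "\<And>b. \<lbrakk>t < b; b < T\<rbrakk> \<Longrightarrow> norm (A b - A t - (b - t) *\<^sub>R g t) \<le> integral {t..b} (\<lambda>s. norm (g s - g t))"
  shows "(A has_vector_derivative g t) (at t within {t<..})"
  unfolding has_vector_derivative_def has_derivative_within_alt
proof (intro conjI allI impI)
  fix e :: real assume "0 < e"
  from right_Lebesgue_pointD[OF g this] obtain d where d: "d > 0"
    "\<And>h. \<lbrakk>0 < h; h < d\<rbrakk> \<Longrightarrow> integral {t..t+h} (\<lambda>s. norm (g s - g t)) \<le> e * h"
    by metis
  have "norm (A b - A t - (b - t) *\<^sub>R g t) \<le> e * norm (b - t)" if "b \<in> {t<..}" "norm (b - t) < min d (T - t)" for b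
    using A[of b] d(2)[of "b - t"] that by auto
  then show "\<exists>d>0. \<forall>b\<in>{t<..}. norm (b - t) < d \<longrightarrow> norm (A b - A t - (b - t) *\<^sub>R g t) \<le> e * norm (b - t)"
    using d(1) \<open>t < T\<close> by (intro exI[of _ "min d (T - t)"]) auto
qed (rule bounded_linear_scaleR_left)

lemma pivot_map_apply [simp]: "blinfun_apply (pivot_map j h) x = inner h (blinfun_apply j x)"
  by (simp add: pivot_map_def dual_map_def)

lemma bounded_linear_pivot_map: "bounded_linear (pivot_map j)"
  unfolding pivot_map_def dual_map_def
  by (intro bounded_linear_intros bounded_linear_compose[OF _ bounded_linear_blinfun_inner_right])

text \<open>\<open>f\<close> stands for u''. The data are the regularity of a strong solution and a
  bound \<open>M\<close> for u' in V; the equation enters only after the energy has been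
  differentiated.\<close>

locale weak_trajectory =
  fixes j :: "'v::{real_inner,banach} \<Rightarrow>\<^sub>L 'h::{real_inner,banach}"
    and T M :: real and u u' :: "real \<Rightarrow> 'v" and f :: "real \<Rightarrow> ('v \<Rightarrow>\<^sub>L real)"
  assumes cont: "continuous_on {0<..<T} u"
    and W1: "W_1_infinity T u u'"
    and W2: "W_2_1 T (\<lambda>t. pivot_map j (j (u t))) (\<lambda>t. pivot_map j (j (u' t))) f"
    and M: "AE t in lebesgue_on {0<..<T}. norm (u' t) \<le> M"
begin

text \<open>u' is given up to null sets. At these times its chosen value is trustworthy: it obeys
  the bound \<open>M\<close>, it is a Lebesgue value in V and in V', and it turns out to be the
  classical velocity in H.\<close>

definition regular :: "real set" where
  "regular = {t \<in> {0<..<T}. right_Lebesgue_point u' t \<and> right_Lebesgue_point f t \<and>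
     right_Lebesgue_point (\<lambda>t. pivot_map j (j (u' t))) t \<and> norm (u' t) \<le> M}"

lemma integrable:
  "norm_integrable_on {0<..<T} u" "norm_integrable_on {0<..<T} u'" "norm_integrable_on {0<..<T} f"
  "norm_integrable_on {0<..<T} (\<lambda>t. pivot_map j (j (u' t)))"
  using W1 W2 unfolding W_1_infinity_def W_2_1_def
  by (auto intro: L_1_imp_norm_integrable_on L_infinity_imp_norm_integrable_on)

lemma regular_subset: "regular \<subseteq> {0<..<T}"
  by (auto simp: regular_def)

lemma negligible_not_regular: "negligible ({0<..<T} - regular)"
proof -
  have "AE t in lebesgue_on {0<..<T}. right_Lebesgue_point u' t \<and> right_Lebesgue_point f t \<and>
     right_Lebesgue_point (\<lambda>t. pivot_map j (j (u' t))) t \<and> norm (u' t) \<le> M"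
    using right_Lebesgue_point_AE[OF integrable(2)] right_Lebesgue_point_AE[OF integrable(3)]
      right_Lebesgue_point_AE[OF integrable(4)] M
    by eventually_elim blast
  then have "\<exists>N. negligible N \<and> (\<forall>t\<in>{0<..<T} - N. right_Lebesgue_point u' t \<and> right_Lebesgue_point f t \<and>
     right_Lebesgue_point (\<lambda>t. pivot_map j (j (u' t))) t \<and> norm (u' t) \<le> M)"
    by (rule AE_lebesgue_on_iff_negligible[THEN iffD1, rotated]) simp
  then obtain N where N: "negligible N" "\<And>t. t \<in> {0<..<T} - N \<Longrightarrow> t \<in> regular"
    unfolding regular_def by blast
  show ?thesis
    by (rule negligible_subset[OF N(1)]) (use N(2) in blast)
qed

lemma regular_meets_interval:
  assumes "0 \<le> a" "a < b" "b \<le> T"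
  obtains t where "t \<in> regular" "a < t" "t < b"
proof -
  have "\<not> {a<..<b} \<subseteq> {0<..<T} - regular"
  proof
    assume "{a<..<b} \<subseteq> {0<..<T} - regular"
    then have "negligible {a<..<b}"
      by (rule negligible_subset[OF negligible_not_regular])
    then show False using assms open_not_negligible[of "{a<..<b}"] by simp
  qed
  then show thesis using that assms by force
qed

lemma regular_dense: "{0<..<T} \<subseteq> closure regular"
proof
  fix t assume t: "t \<in> {0<..<T}"
  show "t \<in> closure regular"
    unfolding closure_approachable
  proof (intro allI impI)
    fix e :: real assume "0 < e"
    then obtain y where "y \<in> regular" "t < y" "y < min T (t + e)"
      using regular_meets_interval[of t "min T (t + e)"] t by auto
    then show "\<exists>y\<in>regular. dist y t < e"
      by (intro bexI[of _ y]) (auto simp: dist_real_def)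
  qed
qed

text \<open>A cumulative integral turns increment bounds into differences of one continuous
  function, a form that passes to limits in both endpoints.\<close>

definition f_mass :: "('v \<Rightarrow>\<^sub>L real) \<Rightarrow> real \<Rightarrow> real" where
  "f_mass c t = integral {0..t} (\<lambda>s. norm (f s - c))"

lemma f_minus_const_integrable: "(\<lambda>s. norm (f s - c)) integrable_on {0..T}"
proof -
  have "(\<lambda>s. norm (f s - c)) integrable_on {0<..<T}"
    using norm_integrable_on_diff_const[OF integrable(3)] by (intro integrable_on_lebesgue_on) auto
  then show ?thesis by (simp add: integrable_on_open_interval_real)
qed

lemma f_mass_continuous: "continuous_on {0..T} (f_mass c)"
  unfolding f_mass_def by (rule indefinite_integral_continuous_1[OF f_minus_const_integrable])

lemma f_mass_diff:
  assumes "0 \<le> s" "s \<le> t" "t \<le> T"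
  shows "f_mass c t - f_mass c s = integral {s..t} (\<lambda>r. norm (f r - c))"
  unfolding f_mass_def
  using assms Henstock_Kurzweil_Integration.integral_combine[of 0 s t "\<lambda>r. norm (f r - c)"]
    integrable_on_subinterval[OF f_minus_const_integrable, of 0 t c] by (simp add: algebra_simps)

lemma f_mass_mono:
  assumes "0 \<le> s" "s \<le> t" "t \<le> T"
  shows "f_mass c s \<le> f_mass c t"
proof -
  have "0 \<le> integral {s..t} (\<lambda>r. norm (f r - c))"
    using assms by (intro integral_nonneg integrable_on_subinterval[OF f_minus_const_integrable]) auto
  then show ?thesis using f_mass_diff[OF assms, of c] by simp
qed

lemma u_increment:
  assumes "0 < s" "s < t" "t < T"
  shows "norm (u t - u s - (t - s) *\<^sub>R c) \<le> integral {s..t} (\<lambda>r. norm (u' r - c))"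
  using W1 assms unfolding W_1_infinity_def
  by (intro weak_derivative_increment_inner[OF _ integrable(1,2)] right_Lebesgue_point_continuous[OF cont]) auto

lemma u_Lipschitz:
  assumes "0 < s" "s < t" "t < T"
  shows "norm (u t - u s) \<le> M * (t - s)"
proof -
  have "norm (u t - u s) \<le> integral {s..t} (\<lambda>r. norm (u' r))"
    using u_increment[OF assms, of 0] by simp
  \<comment> \<open>The bound by \<open>M\<close> is known only at regular times, so the integrand
    is replaced by \<open>M\<close> on the remaining null set.\<close>
  also have "\<dots> \<le> integral {s..t} (\<lambda>r. if r \<in> regular then norm (u' r) else M)"
  proof -
    have "integral {s..t} (\<lambda>r. norm (u' r)) = integral {s..t} (\<lambda>r. if r \<in> regular then norm (u' r) else M)"
      using assms by (intro integral_spike[OF negligible_not_regular]) auto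
    then show ?thesis by simp
  qed
  also have "\<dots> \<le> integral {s..t} (\<lambda>r. M)"
  proof (rule integral_le)
    have "(\<lambda>r. norm (u' r)) integrable_on {s..t}"
    proof -
      have "{s..t} \<subseteq> {0<..<T}" using assms by auto
      from norm_integrable_on_subinterval[OF integrable(2) _ this, of 0] show ?thesis by simp
    qed
    then show "(\<lambda>r. if r \<in> regular then norm (u' r) else M) integrable_on {s..t}"
      by (rule integrable_spike[OF _ negligible_not_regular]) (use assms in auto)
  qed (auto simp: regular_def)
  finally show ?thesis using assms by (simp add: mult.commute)
qed

lemma velocity_dual_increment:
  assumes "s \<in> regular" "t \<in> regular" "s < t"
  shows "norm (pivot_map j (j (u' t)) - pivot_map j (j (u' s)) - (t - s) *\<^sub>R c) \<le> f_mass c t - f_mass c s"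
proof -
  have st: "0 < s" "t < T" using assms regular_subset by auto
  have "norm (pivot_map j (j (u' t)) - pivot_map j (j (u' s)) - (t - s) *\<^sub>R c) \<le> integral {s..t} (\<lambda>r. norm (f r - c))"
    using W2 assms st unfolding W_2_1_def
    by (intro weak_derivative_increment_dual[OF _ integrable(4,3)]) (auto simp: regular_def)
  then show ?thesis using f_mass_diff[of s t c] st assms by simp
qed

text \<open>The velocity increment is controlled in V' and the velocities are bounded in V; the
  pairing of the two is the inner product of H. Pairing with the difference yields continuity into
  H, pairing with the sum controls the kinetic energy.\<close>

lemma velocity_H_increment:
  assumes "s \<in> regular" "t \<in> regular" "s < t"
  shows "(norm (j (u' t) - j (u' s)))\<^sup>2 \<le> 2 * M * (f_mass 0 t - f_mass 0 s)"
    and "\<bar>(norm (j (u' t)))\<^sup>2 - (norm (j (u' s)))\<^sup>2\<bar> \<le> 2 * M * (f_mass 0 t - f_mass 0 s)"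
proof -
  let ?W = "pivot_map j (j (u' t)) - pivot_map j (j (u' s))"
  have W: "norm ?W \<le> f_mass 0 t - f_mass 0 s"
    using velocity_dual_increment[OF assms, of 0] by simp
  have M2: "norm (u' t) \<le> M" "norm (u' s) \<le> M"
    using assms by (auto simp: regular_def)
  have *: "\<bar>?W x\<bar> \<le> 2 * M * (f_mass 0 t - f_mass 0 s)" if "norm x \<le> 2 * M" for x
  proof -
    have "\<bar>?W x\<bar> \<le> norm ?W * norm x"
      using norm_blinfun[of ?W x] by simp
    also have "\<dots> \<le> (f_mass 0 t - f_mass 0 s) * (2 * M)"
      using W that order_trans[OF norm_ge_zero W] by (intro mult_mono) auto
    finally show ?thesis by (simp add: mult.commute)
  qed
  have "(norm (j (u' t) - j (u' s)))\<^sup>2 = ?W (u' t - u' s)"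
    by (simp add: power2_norm_eq_inner blinfun.bilinear_simps inner_diff)
  then show "(norm (j (u' t) - j (u' s)))\<^sup>2 \<le> 2 * M * (f_mass 0 t - f_mass 0 s)"
    using *[of "u' t - u' s"] norm_triangle_ineq4[of "u' t" "u' s"] M2 by simp
  have "(norm (j (u' t)))\<^sup>2 - (norm (j (u' s)))\<^sup>2 = ?W (u' t + u' s)"
    by (simp add: power2_norm_eq_inner blinfun.bilinear_simps inner_diff inner_add inner_commute)
  then show "\<bar>(norm (j (u' t)))\<^sup>2 - (norm (j (u' s)))\<^sup>2\<bar> \<le> 2 * M * (f_mass 0 t - f_mass 0 s)"
    using *[of "u' t + u' s"] norm_triangle_ineq[of "u' t" "u' s"] M2 by simp
qed

lemma velocity_uniformly_continuous: "uniformly_continuous_on regular (\<lambda>t. j (u' t))"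
  unfolding uniformly_continuous_on_def
proof (intro allI impI)
  fix e :: real assume "0 < e"
  \<comment> \<open>The absolute value and the added 1 keep \<open>r\<close> positive before any
    regular time is at hand; \<open>0 \<le> M\<close> is deduced from such a time.\<close>
  define r where "r = e\<^sup>2 / (2 * \<bar>M\<bar> + 1)"
  have "0 < r" using \<open>0 < e\<close> by (simp add: r_def)
  moreover have "uniformly_continuous_on {0..T} (f_mass 0)"
    by (intro compact_uniformly_continuous f_mass_continuous compact_Icc)
  ultimately obtain d where d: "d > 0"
    "\<And>s t. \<lbrakk>s \<in> {0..T}; t \<in> {0..T}; dist t s < d\<rbrakk> \<Longrightarrow> dist (f_mass 0 t) (f_mass 0 s) < r"
    unfolding uniformly_continuous_on_def by metis
  have *: "dist (j (u' t)) (j (u' s)) < e" if st: "s \<in> regular" "t \<in> regular" "dist t s < d" "s < t" for s t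
  proof -
    have in01: "s \<in> {0..T}" "t \<in> {0..T}" using st regular_subset by auto
    have M0: "0 \<le> M" using st by (auto simp: regular_def intro: order_trans[OF norm_ge_zero])
    have "(norm (j (u' t) - j (u' s)))\<^sup>2 \<le> 2 * M * (f_mass 0 t - f_mass 0 s)"
      by (rule velocity_H_increment(1)[OF st(1,2,4)])
    also have "\<dots> \<le> 2 * M * r"
      using d(2)[OF in01 st(3)] M0 by (intro mult_left_mono) (auto simp: dist_real_def)
    also have "\<dots> < (2 * \<bar>M\<bar> + 1) * r" using M0 \<open>0 < r\<close> by simp
    also have "\<dots> = e\<^sup>2" using M0 by (simp add: r_def)
    finally show ?thesis
      unfolding dist_norm by (rule power_less_imp_less_base) (use \<open>0 < e\<close> in simp)
  qed
  have "dist (j (u' t)) (j (u' s)) < e" if "s \<in> regular" "t \<in> regular" "dist t s < d" for s t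
    using *[of s t] *[of t s] that \<open>0 < e\<close> by (cases s t rule: linorder_cases) (auto simp: dist_commute)
  then show "\<exists>d>0. \<forall>s\<in>regular. \<forall>t\<in>regular. dist t s < d \<longrightarrow> dist (j (u' t)) (j (u' s)) < e"
    using d(1) by blast
qed

text \<open>Testing with the inner product against the discrepancy of the two sides shows that this
  discrepancy is orthogonal to itself.\<close>

lemma u_integral_of_continuous_velocity:
  assumes z: "continuous_on {0<..<T} z" "\<And>t. t \<in> regular \<Longrightarrow> z t = j (u' t)"
    and st: "0 < s" "s < t" "t < T"
  shows "j (u t) - j (u s) = integral {s..t} z"
proof -
  let ?d = "j (u t) - j (u s) - integral {s..t} z"
  have zc: "continuous_on {s..t} z"
    by (rule continuous_on_subset[OF z(1)]) (use st in auto)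
  have "inner ?d (j (u t)) - inner ?d (j (u s)) = integral {s..t} (\<lambda>r. inner ?d (j (u' r)))"
    using W1 st unfolding W_1_infinity_def
    by (intro weak_derivative_FTC(1)[OF _ integrable(1,2), of "\<lambda>x. inner ?d (j x)"]
        right_Lebesgue_point_continuous[OF cont]
        bounded_linear_compose[OF bounded_linear_inner_right blinfun.bounded_linear_right]) auto
  also have "\<dots> = integral {s..t} (\<lambda>r. inner ?d (z r))"
    using st z(2) by (intro integral_spike[OF negligible_not_regular]) auto
  also have "\<dots> = inner ?d (integral {s..t} z)"
    using integral_linear[OF integrable_continuous_real[OF zc] bounded_linear_inner_right[of ?d]]
    by (simp add: o_def)
  finally have "inner ?d ?d = 0" by (simp add: inner_diff_right)
  then show ?thesis by simp
qed

text \<open>The velocity is uniformly continuous on the dense set of regular times and extends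
  continuously to the open interval. The trajectory in H is an integral of this extension, which is
  therefore its classical derivative everywhere.\<close>

lemma velocity_continuous: "continuous_on {0<..<T} (velocity j u)"
  and velocity_regular: "t \<in> regular \<Longrightarrow> velocity j u t = j (u' t)"
proof -
  obtain z where z: "uniformly_continuous_on (closure regular) z" "\<And>t. t \<in> regular \<Longrightarrow> j (u' t) = z t"
    using uniformly_continuous_on_extension_on_closure[OF velocity_uniformly_continuous] by metis
  have zc: "continuous_on {0<..<T} z"
    by (rule continuous_on_subset[OF uniformly_continuous_imp_continuous[OF z(1)] regular_dense])
  have "velocity j u t = z t" if t: "t \<in> {0<..<T}" for t
  proof -
    define a b where "a = t / 2" and "b = (t + T) / 2"
    have ab: "0 < a" "a < t" "t < b" "b < T" using t by (auto simp: a_def b_def)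
    have "((\<lambda>s. integral {a..s} z) has_vector_derivative z t) (at t within {a..b})"
      using ab by (intro integral_has_vector_derivative continuous_on_subset[OF zc]) auto
    then have "((\<lambda>s. integral {a..s} z) has_vector_derivative z t) (at t)"
      using ab by (simp add: at_within_Icc_at)
    then have "((\<lambda>s. j (u a) + integral {a..s} z) has_vector_derivative z t) (at t)"
      by (auto intro!: derivative_eq_intros)
    then have "((\<lambda>s. j (u s)) has_vector_derivative z t) (at t)"
    proof (rule has_vector_derivative_transform_within_open[of _ _ _ "{a<..<b}"])
      fix s assume "s \<in> {a<..<b}"
      then show "j (u a) + integral {a..s} z = j (u s)"
        using u_integral_of_continuous_velocity[OF zc z(2)[symmetric], of a s] ab by (simp add: algebra_simps)
    qed (use ab in auto)
    then show ?thesis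
      unfolding velocity_def by (rule vector_derivative_at)
  qed
  then show "continuous_on {0<..<T} (velocity j u)"
    using zc continuous_on_cong[OF refl, of "{0<..<T}" "velocity j u" z] by blast
  show "t \<in> regular \<Longrightarrow> velocity j u t = j (u' t)"
    using \<open>\<And>t. t \<in> {0<..<T} \<Longrightarrow> velocity j u t = z t\<close> z(2)[of t] regular_subset by auto
qed

end

section \<open>Increments at all times and right derivatives at regular times\<close>

context weak_trajectory
begin

text \<open>Density of the regular times and continuity of both sides. Since \<open>s < t\<close> is
  strict, the approximating regular times are eventually in the order that \<open>le\<close>
  requires.\<close>

lemma regular_limit_le:
  fixes A :: "real \<Rightarrow> 'b::real_normed_vector" and B :: "real \<Rightarrow> real"
  assumes A: "continuous_on {0<..<T} A" and B: "continuous_on {0<..<T} B"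
    and le: "\<And>s t. \<lbrakk>s \<in> regular; t \<in> regular; s < t\<rbrakk> \<Longrightarrow> norm (A t - A s) \<le> B t - B s"
    and st: "0 < s" "s < t" "t < T"
  shows "norm (A t - A s) \<le> B t - B s"
proof -
  have "\<exists>x. (\<forall>n. x n \<in> regular) \<and> x \<longlonglongrightarrow> r" if "r \<in> {0<..<T}" for r
    using regular_dense that by (auto simp: closure_sequential)
  then obtain x y where x: "\<And>n. x n \<in> regular" "x \<longlonglongrightarrow> s" and y: "\<And>n. y n \<in> regular" "y \<longlonglongrightarrow> t"
    using st by (metis greaterThanLessThan_iff less_trans)
  have lim: "(\<lambda>n. C (x n)) \<longlonglongrightarrow> C s" "(\<lambda>n. C (y n)) \<longlonglongrightarrow> C t"
    if "continuous_on {0<..<T} C" for C :: "real \<Rightarrow> 'c::topological_space"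
    using x y st regular_subset
    by (auto intro!: continuous_on_tendsto_compose[OF that] always_eventually)
  have "(\<lambda>n. y n - x n) \<longlonglongrightarrow> t - s"
    by (intro tendsto_diff x y)
  from order_tendstoD(1)[OF this, of 0] have "eventually (\<lambda>n. 0 < y n - x n) sequentially"
    using st by simp
  then have "eventually (\<lambda>n. norm (A (y n) - A (x n)) \<le> B (y n) - B (x n)) sequentially"
    by eventually_elim (use x(1) y(1) le in auto)
  then show ?thesis
    by (rule tendsto_le[OF sequentially_bot tendsto_diff[OF lim(2,1)[OF B]] tendsto_norm[OF tendsto_diff[OF lim(2,1)[OF A]]]])
qed

lemma f_mass_continuous_open: "continuous_on {0<..<T} (f_mass c)"
  by (rule continuous_on_subset[OF f_mass_continuous]) auto

lemma pivot_velocity_increment: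
  assumes "0 < s" "s < t" "t < T"
  shows "norm (pivot_map j (velocity j u t) - pivot_map j (velocity j u s) - (t - s) *\<^sub>R c)
           \<le> f_mass c t - f_mass c s"
proof -
  let ?A = "\<lambda>t. pivot_map j (velocity j u t) - t *\<^sub>R c"
  have "norm (?A t - ?A s) \<le> f_mass c t - f_mass c s"
  proof (rule regular_limit_le[OF _ f_mass_continuous_open _ assms])
    show "continuous_on {0<..<T} ?A"
      by (intro continuous_intros bounded_linear.continuous_on[OF bounded_linear_pivot_map] velocity_continuous)
    fix s t assume *: "s \<in> regular" "t \<in> regular" "s < t"
    have "?A t - ?A s = pivot_map j (j (u' t)) - pivot_map j (j (u' s)) - (t - s) *\<^sub>R c"
      using * by (simp add: velocity_regular scaleR_left_diff_distrib)
    then show "norm (?A t - ?A s) \<le> f_mass c t - f_mass c s"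
      using velocity_dual_increment[OF *] by simp
  qed
  also have "?A t - ?A s = pivot_map j (velocity j u t) - pivot_map j (velocity j u s) - (t - s) *\<^sub>R c"
    by (simp add: scaleR_left_diff_distrib)
  finally show ?thesis .
qed

lemma velocity_norm_increment:
  assumes "0 < s" "s < t" "t < T"
  shows "\<bar>(norm (velocity j u t))\<^sup>2 - (norm (velocity j u s))\<^sup>2\<bar> \<le> 2 * M * (f_mass 0 t - f_mass 0 s)"
proof -
  have "norm ((norm (velocity j u t))\<^sup>2 - (norm (velocity j u s))\<^sup>2) \<le> 2 * M * f_mass 0 t - 2 * M * f_mass 0 s"
  proof (rule regular_limit_le[OF _ _ _ assms])
    show "continuous_on {0<..<T} (\<lambda>t. (norm (velocity j u t))\<^sup>2)"
      by (intro continuous_intros velocity_continuous)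
    show "continuous_on {0<..<T} (\<lambda>t. 2 * M * f_mass 0 t)"
      by (intro continuous_intros f_mass_continuous_open)
    fix s t assume "s \<in> regular" "t \<in> regular" "s < t"
    then show "norm ((norm (velocity j u t))\<^sup>2 - (norm (velocity j u s))\<^sup>2) \<le> 2 * M * f_mass 0 t - 2 * M * f_mass 0 s"
      using velocity_H_increment(2)[of s t] by (simp add: velocity_regular algebra_simps)
  qed
  then show ?thesis by (simp add: algebra_simps)
qed

lemma right_derivative_u:
  assumes "t \<in> regular"
  shows "(u has_vector_derivative u' t) (at t within {t<..})"
proof (rule right_Lebesgue_point_imp_right_derivative)
  show "right_Lebesgue_point u' t" "t < T" using assms by (auto simp: regular_def)
  fix b assume "t < b" "b < T"
  then show "norm (u b - u t - (b - t) *\<^sub>R u' t) \<le> integral {t..b} (\<lambda>s. norm (u' s - u' t))"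
    using assms by (intro u_increment) (auto simp: regular_def)
qed

lemma right_derivative_pivot_velocity:
  assumes "t \<in> regular"
  shows "((\<lambda>t. pivot_map j (velocity j u t)) has_vector_derivative f t) (at t within {t<..})"
proof (rule right_Lebesgue_point_imp_right_derivative)
  show "right_Lebesgue_point f t" "t < T" using assms by (auto simp: regular_def)
  fix b assume b: "t < b" "b < T"
  have t: "0 < t" using assms by (auto simp: regular_def)
  show "norm (pivot_map j (velocity j u b) - pivot_map j (velocity j u t) - (b - t) *\<^sub>R f t)
      \<le> integral {t..b} (\<lambda>s. norm (f s - f t))"
    using pivot_velocity_increment[OF t b, of "f t"] f_mass_diff[of t b "f t"] t b by simp
qed

text \<open>u' need not be right continuous in V, but it has an approximate limit at a right
  Lebesgue point: if u' stayed at distance at least \<open>e\<close> at all regular times just after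
  \<open>t\<close>, its mean distance on \<open>[t, t + h]\<close> could not be at most
  \<open>e / 2\<close>.\<close>

lemma regular_right_sequence:
  assumes "t \<in> regular"
  obtains x where "\<And>n::nat. x n \<in> regular" "\<And>n. t < x n" "x \<longlonglongrightarrow> t" "(\<lambda>n. u' (x n)) \<longlonglongrightarrow> u' t"
proof -
  have t: "right_Lebesgue_point u' t" "0 < t" "t < T" using assms by (auto simp: regular_def)
  have "\<exists>s\<in>regular. t < s \<and> s < t + e \<and> norm (u' s - u' t) < e" if "0 < e" for e
  proof (rule ccontr)
    assume contra: "\<not> ?thesis"
    have "0 < e / 2" using that by simp
    from right_Lebesgue_pointD[OF t(1) this] obtain d where d: "d > 0"
      "\<And>h. \<lbrakk>0 < h; h < d\<rbrakk> \<Longrightarrow> integral {t..t+h} (\<lambda>s. norm (u' s - u' t)) \<le> e / 2 * h"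
      by metis
    define h where "h = min (min d e) (T - t) / 2"
    have h: "0 < h" "h < d" "h < e" "t + h < T"
      using d(1) that t by (auto simp: h_def min_def field_simps)
    have sub: "{t..t+h} \<subseteq> {0<..<T}" using t h by auto
    have neg: "negligible (insert t ({0<..<T} - regular))"
      using negligible_not_regular by simp
    let ?g = "\<lambda>s. if s \<in> insert t ({0<..<T} - regular) then e else norm (u' s - u' t)"
    have int: "(\<lambda>s. norm (u' s - u' t)) integrable_on {t..t+h}"
      by (rule norm_integrable_on_subinterval[OF integrable(2) _ sub]) simp
    have "e * h = integral {t..t+h} (\<lambda>s. e)" using h by simp
    also have "\<dots> \<le> integral {t..t+h} ?g"
    proof (rule integral_le)
      show "?g integrable_on {t..t+h}"
        by (rule integrable_spike[OF int neg]) auto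
      fix s assume s: "s \<in> {t..t+h}"
      show "e \<le> ?g s"
      proof (cases "s \<in> insert t ({0<..<T} - regular)")
        case False
        then have "s \<in> regular" "t < s" "s < t + e" using s sub h by auto
        then show ?thesis using contra by force
      qed simp
    qed auto
    also have "\<dots> = integral {t..t+h} (\<lambda>s. norm (u' s - u' t))"
      by (rule integral_spike[OF neg]) auto
    also have "\<dots> \<le> e / 2 * h" by (rule d(2)[OF h(1,2)])
    finally show False using that h by simp
  qed
  then have "\<exists>s. s \<in> regular \<and> t < s \<and> s < t + inverse (real (Suc n)) \<and> norm (u' s - u' t) < inverse (real (Suc n))" for n
    by (metis inverse_positive_iff_positive of_nat_0_less_iff zero_less_Suc)
  then obtain x where x: "\<And>n. x n \<in> regular" "\<And>n. t < x n" "\<And>n. x n < t + inverse (real (Suc n))"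
    "\<And>n. norm (u' (x n) - u' t) < inverse (real (Suc n))"
    by metis
  have "x \<longlonglongrightarrow> t"
  proof (rule real_tendsto_sandwich[of "\<lambda>n. t" _ _ "\<lambda>n. t + inverse (real (Suc n))"])
    show "(\<lambda>n. t + inverse (real (Suc n))) \<longlonglongrightarrow> t"
      using tendsto_add[OF tendsto_const LIMSEQ_inverse_real_of_nat, of t] by simp
  qed (use x in \<open>auto intro!: always_eventually less_imp_le\<close>)
  moreover have "(\<lambda>n. u' (x n) - u' t) \<longlonglongrightarrow> 0"
    by (rule Lim_null_comparison[OF _ LIMSEQ_inverse_real_of_nat])
       (use x(4) in \<open>auto intro!: always_eventually less_imp_le\<close>)
  then have "(\<lambda>n. u' (x n)) \<longlonglongrightarrow> u' t"
    by (simp add: LIM_zero_iff)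
  ultimately show thesis using that x(1,2) by blast
qed

lemma u_bounded:
  assumes "0 < a" "b < T"
  obtains U where "\<And>t. t \<in> {a..b} \<Longrightarrow> norm (u t) \<le> U" "0 \<le> U"
proof -
  have "bounded (u ` {a..b})"
    using assms by (intro compact_imp_bounded compact_continuous_image continuous_on_subset[OF cont]) auto
  then obtain U where "\<And>t. t \<in> {a..b} \<Longrightarrow> norm (u t) \<le> U"
    unfolding bounded_iff by blast
  then show thesis by (intro that[of "max U 0"]) (auto intro: max.coboundedI1)
qed

lemma velocity_bounded:
  assumes "0 < a" "b < T"
  obtains Z where "\<And>t. t \<in> {a..b} \<Longrightarrow> norm (velocity j u t) \<le> Z" "0 \<le> Z"
proof -
  have "bounded (velocity j u ` {a..b})"
    using assms by (intro compact_imp_bounded compact_continuous_image continuous_on_subset[OF velocity_continuous]) auto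
  then obtain Z where "\<And>t. t \<in> {a..b} \<Longrightarrow> norm (velocity j u t) \<le> Z"
    unfolding bounded_iff by blast
  then show thesis by (intro that[of "max Z 0"]) (auto intro: max.coboundedI1)
qed

lemma M_nonneg:
  assumes "0 < T"
  shows "0 \<le> M"
proof -
  obtain t where "t \<in> regular"
    by (rule regular_meets_interval[of 0 T]) (use assms in auto)
  then have "norm (u' t) \<le> M" by (simp add: regular_def)
  then show ?thesis by (rule order_trans[OF norm_ge_zero])
qed

text \<open>A discrete product rule: the V' increment of the velocity acts on the bounded
  \<open>u t\<close>, and the Lipschitz increment of \<open>u\<close> is paired in H with the
  bounded velocity at \<open>s\<close>.\<close>

lemma inner_velocity_increment:
  assumes st: "0 < s" "s < t" "t < T" and "norm (u t) \<le> U" "norm (velocity j u s) \<le> Z"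
  shows "\<bar>inner (velocity j u t) (j (u t)) - inner (velocity j u s) (j (u s))\<bar>
           \<le> U * (f_mass 0 t - f_mass 0 s) + Z * norm j * M * (t - s)"
proof -
  let ?W = "pivot_map j (velocity j u t) - pivot_map j (velocity j u s)"
  have W: "norm ?W \<le> f_mass 0 t - f_mass 0 s"
    using pivot_velocity_increment[OF st, of 0] by simp
  have "inner (velocity j u t) (j (u t)) - inner (velocity j u s) (j (u s))
      = ?W (u t) + inner (velocity j u s) (j (u t - u s))"
    by (simp add: blinfun.bilinear_simps inner_diff_right)
  moreover have "\<bar>?W (u t)\<bar> \<le> (f_mass 0 t - f_mass 0 s) * U"
    using norm_blinfun[of ?W "u t"] mult_mono[OF W assms(4)] order_trans[OF norm_ge_zero W] by simp
  moreover have "\<bar>inner (velocity j u s) (j (u t - u s))\<bar> \<le> Z * (norm j * (M * (t - s)))"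
  proof -
    have "norm (j (u t - u s)) \<le> norm j * (M * (t - s))"
      using norm_blinfun[of j "u t - u s"] mult_left_mono[OF u_Lipschitz[OF st] norm_ge_zero[of j]] by simp
    then show ?thesis
      using Cauchy_Schwarz_ineq2[of "velocity j u s" "j (u t - u s)"] assms(5)
        mult_mono[OF assms(5), of "norm (j (u t - u s))" "norm j * (M * (t - s))"]
        order_trans[OF norm_ge_zero assms(5)]
      by simp
  qed
  ultimately show ?thesis by (simp add: algebra_simps)
qed

section \<open>Derivative and monotonicity of the modified energy\<close>

definition modified_energy :: "('v \<Rightarrow> real) \<Rightarrow> real \<Rightarrow> real \<Rightarrow> real" where
  "modified_energy F e t = (norm (velocity j u t))\<^sup>2 / 2 + F (u t) + e * inner (velocity j u t) (j (u t))"

text \<open>The potential energy and the pairing of u' with u have full right derivatives. The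
  kinetic energy forces a sequence: its difference quotient is half the V' quotient of the velocity
  applied to \<open>u' (x n) + u' t\<close>, which converges because u' converges in V along the
  sequence.\<close>

lemma modified_energy_right_derivative:
  assumes t: "t \<in> regular" and F: "(F has_derivative blinfun_apply G0) (at (u t))"
  obtains x where "\<And>n::nat. t < x n" "x \<longlonglongrightarrow> t"
    "(\<lambda>n. (modified_energy F e (x n) - modified_energy F e t) / (x n - t)) \<longlonglongrightarrow>
       f t (u' t) + G0 (u' t) + e * ((norm (velocity j u t))\<^sup>2 + f t (u t))"
proof -
  from regular_right_sequence[OF t] obtain x where
    x: "\<And>n::nat. x n \<in> regular" "\<And>n. t < x n" "x \<longlonglongrightarrow> t" "(\<lambda>n. u' (x n)) \<longlonglongrightarrow> u' t"
    by metis
  let ?W = "\<lambda>t. pivot_map j (velocity j u t)"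
  have "filterlim x (at t within {t<..}) sequentially"
    using x(2,3) by (auto simp: filterlim_at less_imp_neq[symmetric] intro!: always_eventually)
  note lim = filterlim_compose[OF _ this]
  have "(F \<circ> u has_vector_derivative G0 (u' t)) (at t within {t<..})"
    using vector_derivative_diff_chain_within[OF right_derivative_u[OF t] has_derivative_at_withinI[OF F]] .
  then have F_lim: "(\<lambda>n. (F (u (x n)) - F (u t)) / (x n - t)) \<longlonglongrightarrow> G0 (u' t)"
    unfolding has_real_derivative_iff_has_vector_derivative[symmetric] has_field_derivative_iff
    by (intro lim[of "\<lambda>y. (F (u y) - F (u t)) / (y - t)"]) (simp add: o_def)
  \<comment> \<open>The H inner product of velocity and \<open>u\<close> is a bilinear pairing of
    right-differentiable maps into V' and V.\<close>
  have "((\<lambda>s. ?W s (u s)) has_vector_derivative ?W t (u' t) + f t (u t)) (at t within {t<..})"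
    by (intro bounded_bilinear.has_vector_derivative[OF bounded_bilinear_blinfun_apply]
        right_derivative_u[OF t] right_derivative_pivot_velocity[OF t])
  then have P_lim: "(\<lambda>n. (?W (x n) (u (x n)) - ?W t (u t)) / (x n - t)) \<longlonglongrightarrow> ?W t (u' t) + f t (u t)"
    unfolding has_real_derivative_iff_has_vector_derivative[symmetric] has_field_derivative_iff
    by (intro lim[of "\<lambda>y. (?W y (u y) - ?W t (u t)) / (y - t)"])
  have "((\<lambda>y. (?W y - ?W t) /\<^sub>R (y - t)) \<longlongrightarrow> f t) (at t within {t<..})"
  proof (rule LIM_zero_cancel, rule tendsto_norm_zero_cancel)
    have "((\<lambda>y. norm (?W y - ?W t - (y - t) *\<^sub>R f t) / norm (y - t)) \<longlongrightarrow> 0) (at t within {t<..})"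
      using right_derivative_pivot_velocity[OF t]
      unfolding has_vector_derivative_def has_derivative_iff_norm by blast
    moreover have "eventually (\<lambda>y. norm (?W y - ?W t - (y - t) *\<^sub>R f t) / norm (y - t)
        = norm ((?W y - ?W t) /\<^sub>R (y - t) - f t)) (at t within {t<..})"
      unfolding eventually_at_filter
    proof (intro always_eventually allI impI)
      fix y assume "y \<noteq> t"
      then have "(?W y - ?W t) /\<^sub>R (y - t) - f t = (?W y - ?W t - (y - t) *\<^sub>R f t) /\<^sub>R (y - t)"
        by (simp add: scaleR_diff_right)
      then show "norm (?W y - ?W t - (y - t) *\<^sub>R f t) / norm (y - t) = norm ((?W y - ?W t) /\<^sub>R (y - t) - f t)"
        by (simp add: divide_inverse mult.commute)
    qed
    ultimately show "((\<lambda>y. norm ((?W y - ?W t) /\<^sub>R (y - t) - f t)) \<longlongrightarrow> 0) (at t within {t<..})"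
      by (rule Lim_transform_eventually)
  qed
  then have W_lim: "(\<lambda>n. (?W (x n) - ?W t) /\<^sub>R (x n - t)) \<longlonglongrightarrow> f t"
    by (rule lim)
  have half_lim: "(\<lambda>n. blinfun_apply ((?W (x n) - ?W t) /\<^sub>R (x n - t)) (u' (x n) + u' t) / 2) \<longlonglongrightarrow> f t (u' t + u' t) / 2"
    by (intro tendsto_intros blinfun.tendsto W_lim x(4)) simp
  have quotient: "blinfun_apply ((?W (x n) - ?W t) /\<^sub>R (x n - t)) (u' (x n) + u' t) / 2
      = ((norm (velocity j u (x n)))\<^sup>2 / 2 - (norm (velocity j u t))\<^sup>2 / 2) / (x n - t)" for n
  proof -
    have "blinfun_apply (?W (x n) - ?W t) (u' (x n) + u' t)
      = (norm (velocity j u (x n)))\<^sup>2 - (norm (velocity j u t))\<^sup>2"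
      using velocity_regular[OF x(1), of n] velocity_regular[OF t]
      by (simp add: power2_norm_eq_inner blinfun.bilinear_simps inner_diff inner_add inner_commute)
    moreover have "inverse h * (A - B) / 2 = (A / 2 - B / 2) / h" for h A B :: real
      by (cases "h = 0") (simp_all add: field_simps)
    ultimately show ?thesis
      by (simp only: blinfun.scaleR_left real_scaleR_def)
  qed
  have "f t (u' t + u' t) / 2 = f t (u' t)"
    by (simp add: blinfun.add_right)
  with half_lim have V_lim: "(\<lambda>n. ((norm (velocity j u (x n)))\<^sup>2 / 2 - (norm (velocity j u t))\<^sup>2 / 2) / (x n - t))
      \<longlonglongrightarrow> f t (u' t)"
    by (simp only: quotient)
  have "(\<lambda>n. ((norm (velocity j u (x n)))\<^sup>2 / 2 - (norm (velocity j u t))\<^sup>2 / 2) / (x n - t)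
       + (F (u (x n)) - F (u t)) / (x n - t) + e * ((?W (x n) (u (x n)) - ?W t (u t)) / (x n - t)))
      \<longlonglongrightarrow> f t (u' t) + G0 (u' t) + e * (?W t (u' t) + f t (u t))"
    by (intro tendsto_add V_lim F_lim tendsto_mult tendsto_const P_lim)
  moreover have "?W t (u' t) = (norm (velocity j u t))\<^sup>2"
    using velocity_regular[OF t] by (simp add: power2_norm_eq_inner)
  ultimately show thesis
    using x(2,3) by (intro that[of x])
      (auto simp: modified_energy_def add_divide_distrib diff_divide_distrib algebra_simps)
qed

text \<open>Adding \<open>c * t\<close> to the functional turns decrease at rate \<open>c\<close>
  into monotonicity. As the dissipation inequality holds only almost everywhere, an integrable
  \<open>m\<close> must also majorise the growth of every term from each time on.\<close>

lemma modified_energy_decreasing: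
  assumes F: "\<And>x. (F has_derivative blinfun_apply (G x)) (at x)" and G: "continuous_on UNIV G"
    and ab: "0 < a" "a \<le> b" "b < T"
    and dissipation: "AE t in lebesgue_on {0<..<T}. t \<in> {a<..<b} \<longrightarrow>
      f t (u' t) + G (u t) (u' t) + e * ((norm (velocity j u t))\<^sup>2 + f t (u t)) + c \<le> 0"
  shows "modified_energy F e b + c * (b - a) \<le> modified_energy F e a"
proof -
  obtain U where U: "\<And>t. t \<in> {a..b} \<Longrightarrow> norm (u t) \<le> U" "0 \<le> U"
    using u_bounded[OF ab(1,3)] by metis
  obtain Z where Z: "\<And>t. t \<in> {a..b} \<Longrightarrow> norm (velocity j u t) \<le> Z" "0 \<le> Z"
    using velocity_bounded[OF ab(1,3)] by metis
  have M0: "0 \<le> M" using M_nonneg ab by simp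
  have cont_u: "continuous_on {a..b} u" and cont_v: "continuous_on {a..b} (velocity j u)"
    using ab by (auto intro: continuous_on_subset[OF cont] continuous_on_subset[OF velocity_continuous])
  have "bounded ((\<lambda>t. G (u t)) ` {a..b})"
    by (intro compact_imp_bounded compact_continuous_image continuous_on_compose2[OF G cont_u]) auto
  then obtain L0 where "\<And>t. t \<in> {a..b} \<Longrightarrow> norm (G (u t)) \<le> L0"
    unfolding bounded_iff by blast
  then have L: "\<And>t. t \<in> {a..b} \<Longrightarrow> norm (G (u t)) \<le> max L0 0" "0 \<le> max L0 0"
    by (auto intro: max.coboundedI1)
  define L where "L = max L0 0"
  note L = L[folded L_def]
  let ?K = "\<lambda>t. modified_energy F e t + c * t"
  define k1 where "k1 = M + \<bar>e\<bar> * U"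
  define k2 where "k2 = (L + 1) * M + \<bar>e\<bar> * (Z * norm j * M) + \<bar>c\<bar>"
  define m where "m s = k1 * norm (f s - 0) + k2" for s
  have k: "0 \<le> k1" "0 \<le> k2" using M0 U Z L by (auto simp: k1_def k2_def)
  have int: "(\<lambda>s. norm (f s - 0)) integrable_on {s..t}" if "0 \<le> s" "t \<le> T" for s t
    by (rule integrable_on_subinterval[OF f_minus_const_integrable]) (use that in auto)
  have m_int: "m integrable_on {s..t}" if "0 \<le> s" "t \<le> T" for s t
    unfolding m_def by (intro integrable_add integrable_on_mult_right int that integrable_const_ivl)
  have m_val: "integral {s..t} m = k1 * (f_mass 0 t - f_mass 0 s) + k2 * (t - s)"
    if "0 \<le> s" "s \<le> t" "t \<le> T" for s t
  proof -
    have "integral {s..t} m = integral {s..t} (\<lambda>s. k1 * norm (f s - 0)) + integral {s..t} (\<lambda>s. k2)"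
      unfolding m_def using that
      by (intro Henstock_Kurzweil_Integration.integral_add integrable_on_mult_right int integrable_const_ivl)
    then show ?thesis using f_mass_diff[OF that, of 0] that by (simp add: mult.commute)
  qed
    obtain N where N: "negligible N" "\<And>t. \<lbrakk>t \<in> {0<..<T} - N; t \<in> {a<..<b}\<rbrakk> \<Longrightarrow>
      f t (u' t) + G (u t) (u' t) + e * ((norm (velocity j u t))\<^sup>2 + f t (u t)) + c \<le> 0"
      using AE_lebesgue_on_iff_negligible[THEN iffD1, OF _ dissipation] by auto
  have "?K b \<le> ?K a"
  proof (rule nonincreasing_if_Dini_derivative_nonpos[OF ab(2)])
    have "continuous_on UNIV F"
      by (intro continuous_at_imp_continuous_on ballI has_derivative_continuous[OF F])
    then have "continuous_on {a..b} (\<lambda>t. F (u t))"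
      by (rule continuous_on_compose2[OF _ cont_u]) auto
    then show "continuous_on {a..b} ?K"
      unfolding modified_energy_def
      by (intro continuous_intros cont_v cont_u) auto
    show "m integrable_on {a..b}" using ab by (intro m_int) auto
    show "0 \<le> m t" for t using k by (simp add: m_def)
    show "\<exists>d>0. \<forall>t'. t < t' \<and> t' < t + d \<and> t' \<le> b \<longrightarrow> ?K t' - ?K t \<le> integral {t..t'} m"
      if t: "t \<in> {a..<b}" for t
    proof -
      \<comment> \<open>Differentiability of \<open>F\<close> with tolerance 1 gives the constant
        \<open>L + 1\<close> only near \<open>u t\<close>, hence on a time scale depending on
        \<open>t\<close>; the increment bound is accordingly local.\<close>
      obtain d0 where d0: "0 < d0" "\<And>y. norm (y - u t) < d0 \<Longrightarrow>
          norm (F y - F (u t) - G (u t) (y - u t)) \<le> 1 * norm (y - u t)"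
        using F[of "u t"] unfolding has_derivative_at_alt by (metis zero_less_one)
      define d where "d = d0 / (M + 1)"
      have "0 < d" using d0 M0 by (simp add: d_def)
      have "?K t' - ?K t \<le> integral {t..t'} m" if t': "t < t'" "t' < t + d" "t' \<le> b" for t'
      proof -
        have tt: "0 < t" "t < t'" "t' < T" using t t' ab by auto
        have mass: "0 \<le> f_mass 0 t' - f_mass 0 t" using f_mass_mono[of t t' 0] tt by simp
        have uu: "norm (u t' - u t) \<le> M * (t' - t)" by (rule u_Lipschitz[OF tt])
        also have "\<dots> \<le> (M + 1) * (t' - t)" using tt by (intro mult_right_mono) auto
        also have "\<dots> < (M + 1) * d" using M0 t' by (intro mult_strict_left_mono) auto
        also have "\<dots> = d0" using M0 by (simp add: d_def)
        finally have "\<bar>F (u t') - F (u t) - G (u t) (u t' - u t)\<bar> \<le> norm (u t' - u t)"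
          using d0(2)[of "u t'"] by simp
        moreover have "\<bar>G (u t) (u t' - u t)\<bar> \<le> L * norm (u t' - u t)"
          using norm_blinfun[of "G (u t)" "u t' - u t"] L(1)[of t] t
            mult_right_mono[of "norm (G (u t))" L "norm (u t' - u t)"] by auto
        ultimately have "F (u t') - F (u t) \<le> (L + 1) * norm (u t' - u t)"
          by (simp add: algebra_simps)
        also have "\<dots> \<le> (L + 1) * (M * (t' - t))"
          using uu L(2) by (intro mult_left_mono) auto
        finally have 1: "F (u t') - F (u t) \<le> (L + 1) * M * (t' - t)" by (simp add: mult.assoc)
        have 2: "(norm (velocity j u t'))\<^sup>2 / 2 - (norm (velocity j u t))\<^sup>2 / 2 \<le> M * (f_mass 0 t' - f_mass 0 t)"
          using velocity_norm_increment[OF tt] by simp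
        have "\<bar>e * (inner (velocity j u t') (j (u t')) - inner (velocity j u t) (j (u t)))\<bar>
          \<le> \<bar>e\<bar> * (U * (f_mass 0 t' - f_mass 0 t) + Z * norm j * M * (t' - t))"
          unfolding abs_mult
          by (intro mult_left_mono inner_velocity_increment tt U(1) Z(1)) (use t t' in auto)
        then have 3: "e * inner (velocity j u t') (j (u t')) - e * inner (velocity j u t) (j (u t))
          \<le> \<bar>e\<bar> * U * (f_mass 0 t' - f_mass 0 t) + \<bar>e\<bar> * (Z * norm j * M) * (t' - t)"
          by (simp add: algebra_simps)
        have 4: "c * t' - c * t \<le> \<bar>c\<bar> * (t' - t)"
          using t' mult_right_mono[OF abs_ge_self[of c], of "t' - t"] by (simp add: algebra_simps)
        have "integral {t..t'} m = M * (f_mass 0 t' - f_mass 0 t) + \<bar>e\<bar> * U * (f_mass 0 t' - f_mass 0 t)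
           + (L + 1) * M * (t' - t) + \<bar>e\<bar> * (Z * norm j * M) * (t' - t) + \<bar>c\<bar> * (t' - t)"
          using tt by (subst m_val) (auto simp: k1_def k2_def distrib_right)
        then show ?thesis
          unfolding modified_energy_def using 1 2 3 4 by linarith
      qed
      then show ?thesis using \<open>0 < d\<close> by blast
    qed
    show "negligible (({0<..<T} - regular) \<union> N)"
      using negligible_not_regular N(1) by (rule negligible_Un)
    fix t r assume t: "t \<in> {a<..<b} - (({0<..<T} - regular) \<union> N)" and "0 < (r::real)"
    then have reg: "t \<in> regular" and neg: "f t (u' t) + G (u t) (u' t) + e * ((norm (velocity j u t))\<^sup>2 + f t (u t)) + c \<le> 0"
      using ab N(2)[of t] by auto
    let ?D = "f t (u' t) + G (u t) (u' t) + e * ((norm (velocity j u t))\<^sup>2 + f t (u t))"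
    obtain x where x: "\<And>n::nat. t < x n" "x \<longlonglongrightarrow> t"
      "(\<lambda>n. (modified_energy F e (x n) - modified_energy F e t) / (x n - t)) \<longlonglongrightarrow> ?D"
      by (rule modified_energy_right_derivative[where e = e, OF reg F[of "u t"]]) blast
    have "eventually (\<lambda>n. x n < b) sequentially"
      using x(2) t by (intro order_tendstoD(2)) auto
    \<comment> \<open>The limit is at most \<open>- c\<close>, so the quotients are eventually below
      \<open>r - c\<close>; the term \<open>c * t\<close> brings the slope back to at most
      \<open>r\<close>.\<close>
    moreover have "eventually (\<lambda>n. (modified_energy F e (x n) - modified_energy F e t) / (x n - t) < r - c) sequentially"
      using x(3) neg \<open>0 < r\<close> by (intro order_tendstoD(2)) auto
    ultimately have "eventually (\<lambda>n. x n < b \<and>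
        (modified_energy F e (x n) - modified_energy F e t) / (x n - t) < r - c) sequentially"
      by eventually_elim simp
    then obtain n where n: "x n < b" "(modified_energy F e (x n) - modified_energy F e t) / (x n - t) < r - c"
      unfolding eventually_sequentially by blast
    then have "modified_energy F e (x n) - modified_energy F e t \<le> (r - c) * (x n - t)"
      using x(1)[of n] by (simp add: pos_divide_less_eq less_imp_le)
    then show "\<exists>t'>t. t' \<le> b \<and> ?K t' - ?K t \<le> r * (t' - t)"
      using x(1)[of n] n(1) by (intro exI[of _ "x n"]) (auto simp: algebra_simps)
  qed
  then show ?thesis by (simp add: algebra_simps)
qed

end

section \<open>Decay\<close>

text \<open>Induction on the number of doublings. The intermediate value theorem provides a time
  with energy \<open>2 ^ Suc n * E t\<close>: before it lies a single dyadic level, after it the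
  induction hypothesis applies.\<close>

lemma level_time_sum:
  fixes E w :: "real \<Rightarrow> real"
  assumes E: "continuous_on {0<..t} E" "\<And>s r. \<lbrakk>0 < s; s \<le> r; r \<le> t\<rbrakk> \<Longrightarrow> E r \<le> E s"
    and pos: "0 < E t" and w: "\<And>m. 0 < m \<Longrightarrow> 0 \<le> w m"
    and level: "\<And>s r m. \<lbrakk>0 < s; s \<le> r; r \<le> t; 0 < m; m \<le> E r; E s \<le> 2 * m\<rbrakk> \<Longrightarrow> r - s \<le> w m"
    and s: "0 < s" "s \<le> t" "E s \<le> 2 ^ Suc n * E t"
  shows "t - s \<le> (\<Sum>k\<le>n. w (2 ^ k * E t))"
  using s
proof (induction n arbitrary: s)
  case 0
  then show ?case using level[of s t "E t"] pos by simp
next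
  case (Suc n)
  show ?case
  proof (cases "E s \<le> 2 ^ Suc n * E t")
    case True
    then have "t - s \<le> (\<Sum>k\<le>n. w (2 ^ k * E t))" using Suc by blast
    then show ?thesis using w[of "2 ^ Suc n * E t"] pos by simp
  next
    case False
    have "1 * E t \<le> 2 ^ Suc n * E t"
      using pos by (intro mult_right_mono one_le_power) auto
    then have "E t \<le> 2 ^ Suc n * E t" "2 ^ Suc n * E t \<le> E s"
      using False by auto
    moreover have "continuous_on {s..t} E"
      by (rule continuous_on_subset[OF E(1)]) (use Suc.prems in auto)
    ultimately obtain r where r: "s \<le> r" "r \<le> t" "E r = 2 ^ Suc n * E t"
      using IVT2'[of E t "2 ^ Suc n * E t" s] Suc.prems by blast
    have "t - r \<le> (\<Sum>k\<le>n. w (2 ^ k * E t))"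
      using r Suc.prems by (intro Suc.IH) auto
    moreover have "r - s \<le> w (2 ^ Suc n * E t)"
      using r Suc.prems pos by (intro level) auto
    ultimately show ?thesis by simp
  qed
qed

text \<open>The lowest level dominates, so the bound is independent of \<open>n\<close>, that is, of
  how large the energy was at the start.\<close>

lemma sum_powr_doubling_le:
  fixes p x :: real
  assumes "0 < p" "0 < x"
  shows "(\<Sum>k\<le>n. (2 ^ k * x) powr (- p)) \<le> x powr (- p) / (1 - 2 powr (- p))"
proof -
  define q where "q = (2::real) powr (- p)"
  have q: "0 < q" "q < 1" using assms powr_less_mono[of "-p" 0 2] by (auto simp: q_def)
  have "(2 ^ k * x) powr (- p) = x powr (- p) * q ^ k" for k
  proof -
    have "(2 ^ k * x) powr (- p) = (2 powr real k) powr (- p) * x powr (- p)"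
      using assms by (simp add: powr_mult powr_realpow)
    also have "(2 powr real k) powr (- p) = (2 powr (- p)) powr real k"
      by (simp add: powr_powr mult.commute)
    also have "\<dots> = q ^ k"
      by (simp add: q_def powr_realpow)
    finally show ?thesis by simp
  qed
  then have "(\<Sum>k\<le>n. (2 ^ k * x) powr (- p)) = x powr (- p) * (\<Sum>k\<le>n. q ^ k)"
    by (simp add: sum_distrib_left)
  also have "(\<Sum>k\<le>n. q ^ k) \<le> (\<Sum>k. q ^ k)"
    using q by (intro sum_le_suminf summable_geometric) auto
  also have "\<dots> = 1 / (1 - q)"
    using q by (intro suminf_geometric) auto
  finally show ?thesis using assms by (simp add: q_def mult_left_mono)
qed

text \<open>For \<open>E t \<le> 1\<close> the power \<alpha> / 2 dominates the time bound because
  \<open>\<gamma> \<le> \<alpha> / 2\<close>, and inverting it gives the rate. For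
  \<open>E t > 1\<close> the time bound forces \<open>t \<le> B\<close>, so a constant bound on
  \<open>E t\<close> may be multiplied by
  \<open>(B / t) powr (2 / \<alpha>) \<ge> 1\<close>.\<close>

lemma decay_from_level_times:
  fixes \<alpha> \<gamma> C :: real
  assumes "0 < \<alpha>" "0 < \<gamma>" "\<gamma> \<le> \<alpha> / 2" "0 < C"
  obtains D where "D > 0" "\<And>E t. \<lbrakk>1 \<le> t; continuous_on {0<..t} E; \<And>s r. \<lbrakk>0 < s; s \<le> r; r \<le> t\<rbrakk> \<Longrightarrow> E r \<le> E s; 0 \<le> E t;
      \<And>s r m. \<lbrakk>0 < s; s \<le> r; r \<le> t; 0 < m; m \<le> E r; E s \<le> 2 * m\<rbrakk>
         \<Longrightarrow> r - s \<le> C * (m powr (- (\<alpha> / 2)) + m powr (- \<gamma>))\<rbrakk>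
      \<Longrightarrow> E t \<le> D * t powr (- 2 / \<alpha>)"
proof -
  define B where "B = C * (1 / (1 - 2 powr (- (\<alpha> / 2))) + 1 / (1 - 2 powr (- \<gamma>)))"
  have q: "(2::real) powr (- (\<alpha> / 2)) < 1" "(2::real) powr (- \<gamma>) < 1"
    using assms powr_less_mono[of "- (\<alpha> / 2)" 0 2] powr_less_mono[of "- \<gamma>" 0 2] by auto
  then have B: "0 < B" using assms by (auto simp: B_def intro!: mult_pos_pos add_pos_pos)
  \<comment> \<open>The summand 1 serves \<open>E t \<le> 1\<close>, the summand
    \<open>B powr (1 / \<gamma>)\<close> serves \<open>E t > 1\<close>.\<close>
  define D where "D = B powr (2 / \<alpha>) * (1 + B powr (1 / \<gamma>))"
  have "D > 0" using B by (auto simp: D_def intro!: mult_pos_pos add_pos_nonneg)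
  have main: "E t \<le> D * t powr (- 2 / \<alpha>)"
    if t: "1 \<le> t" and E: "continuous_on {0<..t} E" "\<And>s r. \<lbrakk>0 < s; s \<le> r; r \<le> t\<rbrakk> \<Longrightarrow> E r \<le> E s" "0 \<le> E t"
      and level: "\<And>s r m. \<lbrakk>0 < s; s \<le> r; r \<le> t; 0 < m; m \<le> E r; E s \<le> 2 * m\<rbrakk>
         \<Longrightarrow> r - s \<le> C * (m powr (- (\<alpha> / 2)) + m powr (- \<gamma>))" for E t
  proof (cases "E t = 0")
    case True
    then show ?thesis using \<open>D > 0\<close> by simp
  next
    case False
    define l where "l = E t"
    have l: "0 < l" using E(3) False by (simp add: l_def)
    have time: "t \<le> B * max (l powr (- (\<alpha> / 2))) (l powr (- \<gamma>))"
    proof (rule field_le_epsilon)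
      fix e :: real assume "0 < e"
      \<comment> \<open>\<open>E\<close> is controlled at positive times only, so levels are counted
        from \<open>s > 0\<close>. Their number may grow as \<open>s\<close> shrinks, but the bound
        obtained does not.\<close>
      define s where "s = min e t"
      have s: "0 < s" "s \<le> t" "s \<le> e" using \<open>0 < e\<close> t by (auto simp: s_def)
      obtain n where "E s / l < 2 ^ n" using real_arch_pow[of 2] by auto
      then have "E s \<le> 2 ^ n * l" using l by (simp add: pos_divide_less_eq less_imp_le)
      also have "\<dots> \<le> 2 ^ Suc n * l" using l by simp
      finally have "E s \<le> 2 ^ Suc n * E t" by (simp add: l_def)
      then have "t - s \<le> (\<Sum>k\<le>n. C * ((2 ^ k * E t) powr (- (\<alpha> / 2)) + (2 ^ k * E t) powr (- \<gamma>)))"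
        using assms(4) l s
        by (intro level_time_sum[of t E "\<lambda>m. C * (m powr (- (\<alpha> / 2)) + m powr (- \<gamma>))", OF E(1,2) _ _ level])
           (auto simp: l_def)
      also have "\<dots> = C * ((\<Sum>k\<le>n. (2 ^ k * l) powr (- (\<alpha> / 2))) + (\<Sum>k\<le>n. (2 ^ k * l) powr (- \<gamma>)))"
        by (simp add: sum_distrib_left sum.distrib distrib_left l_def)
      also have "\<dots> \<le> C * (l powr (- (\<alpha> / 2)) / (1 - 2 powr (- (\<alpha> / 2))) + l powr (- \<gamma>) / (1 - 2 powr (- \<gamma>)))"
        using assms l by (intro mult_left_mono add_mono sum_powr_doubling_le) auto
      also have "\<dots> \<le> C * (max (l powr (- (\<alpha> / 2))) (l powr (- \<gamma>)) / (1 - 2 powr (- (\<alpha> / 2)))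
          + max (l powr (- (\<alpha> / 2))) (l powr (- \<gamma>)) / (1 - 2 powr (- \<gamma>)))"
        using assms q by (intro mult_left_mono add_mono divide_right_mono) auto
      also have "\<dots> = B * max (l powr (- (\<alpha> / 2))) (l powr (- \<gamma>))"
        by (simp add: B_def distrib_right distrib_left mult.assoc)
      finally show "t \<le> B * max (l powr (- (\<alpha> / 2))) (l powr (- \<gamma>)) + e"
        using s by linarith
    qed
    have tp: "t powr (- 2 / \<alpha>) > 0" using t by simp
    have l_from: "l \<le> (B / t) powr (1 / p)" if "t \<le> B * l powr (- p)" "0 < p" for p
    proof -
      have "l powr p \<le> B / t"
        using that l t by (simp add: powr_minus field_simps)
      then have "(l powr p) powr (1 / p) \<le> (B / t) powr (1 / p)"
        using that by (intro powr_mono2) auto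
      then show ?thesis using that l by (simp add: powr_powr)
    qed
    have split: "(B / t) powr (2 / \<alpha>) = B powr (2 / \<alpha>) * t powr (- 2 / \<alpha>)"
      using B t by (simp add: powr_divide powr_minus_divide)
    show ?thesis
    proof (cases "l \<le> 1")
      case True
      then have "l powr (- \<gamma>) \<le> l powr (- (\<alpha> / 2))"
        using l assms by (intro powr_mono') auto
      then have "l \<le> (B / t) powr (1 / (\<alpha> / 2))"
        using time assms by (intro l_from) (auto simp: max_def split: if_splits)
      also have "\<dots> = B powr (2 / \<alpha>) * t powr (- 2 / \<alpha>)" using split by simp
      also have "\<dots> \<le> D * t powr (- 2 / \<alpha>)"
        using tp B by (simp add: D_def algebra_simps)
      finally show ?thesis by (simp add: l_def)
    next
      case False
      then have "l powr (- (\<alpha> / 2)) \<le> l powr (- \<gamma>)"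
        using assms by (intro powr_mono) auto
      then have time': "t \<le> B * l powr (- \<gamma>)"
        using time by (auto simp: max_def split: if_splits)
      have "l powr (- \<gamma>) \<le> 1"
        using False assms powr_mono[of "-\<gamma>" 0 l] by simp
      then have "B * l powr (- \<gamma>) \<le> B * 1" using B by (intro mult_left_mono) auto
      then have tB: "t \<le> B" using time' by linarith
      have "l \<le> (B / t) powr (1 / \<gamma>)"
        using time' assms by (intro l_from) auto
      also have "\<dots> \<le> B powr (1 / \<gamma>)"
        using t B assms by (intro powr_mono2) (auto simp: field_simps)
      also have "\<dots> \<le> (B / t) powr (2 / \<alpha>) * B powr (1 / \<gamma>)"
      proof -
        have "1 \<le> (B / t) powr (2 / \<alpha>)" using tB t assms by (intro ge_one_powr_ge_zero) auto
        then show ?thesis using mult_right_mono[of 1 "(B / t) powr (2 / \<alpha>)" "B powr (1 / \<gamma>)"] by simp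
      qed
      also have "\<dots> \<le> D * t powr (- 2 / \<alpha>)"
        using tp B unfolding split by (simp add: D_def algebra_simps)
      finally show ?thesis by (simp add: l_def)
    qed
  qed
  show thesis
    by (rule that[OF \<open>D > 0\<close>], rule main) blast+
qed

text \<open>In the application $a = \|u'\|_X$, $v = \|u'\|_H$, $R = \|u\|_X$, $y = \|u\|_Y$ and $N = \|u\|_H$
  at a time where the energy is between $m$ and $2m$. The upper bounds imposed on \<open>\<gamma>\<close> are the
  powers of $m$ that balance the three estimates for $m \ge 1$.\<close>

lemma coupling_exists:
  fixes \<alpha> \<beta> \<delta>\<^sub>1 \<delta>\<^sub>2 \<delta>\<^sub>3 \<delta>\<^sub>4 D\<^sub>4 C\<^sub>5 A k l :: real
  assumes ab: "0 < \<alpha>" "\<alpha> < \<beta>"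
    and pos: "0 < \<delta>\<^sub>1" "0 < \<delta>\<^sub>2" "0 < \<delta>\<^sub>3" "0 < \<delta>\<^sub>4" "0 < D\<^sub>4" "0 < C\<^sub>5" "0 < A" "0 < k" "0 < l"
  obtains c \<gamma> where "0 < c" "0 < \<gamma>" "\<gamma> \<le> \<alpha> / 2"
    "\<And>m e a. \<lbrakk>0 < m; e = c * min (m powr (\<alpha> / 2)) (m powr \<gamma>); 0 \<le> a\<rbrakk>
      \<Longrightarrow> e * (A * a\<^sup>2) \<le> \<delta>\<^sub>3 / 2 * a powr (\<alpha> + 2) + e * \<delta>\<^sub>2 * m / 4"
    "\<And>m e a R y N. \<lbrakk>0 < m; e = c * min (m powr (\<alpha> / 2)) (m powr \<gamma>); 0 \<le> a; 0 \<le> R; 0 \<le> y; 0 \<le> N;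
        R powr (\<alpha> + 2) \<le> C\<^sub>5 * (N\<^sup>2 + y powr (\<beta> + 2)); R \<le> k * y;
        \<delta>\<^sub>1 * y powr (\<beta> + 2) \<le> 2 * m; \<delta>\<^sub>4 * N\<^sup>2 \<le> 2 * m\<rbrakk>
      \<Longrightarrow> e * (D\<^sub>4 * a powr (\<alpha> + 1) * R) \<le> \<delta>\<^sub>3 / 2 * a powr (\<alpha> + 2) + e * \<delta>\<^sub>2 * m / 4"
    "\<And>m e v y N. \<lbrakk>0 < m; e = c * min (m powr (\<alpha> / 2)) (m powr \<gamma>); 0 \<le> v; 0 \<le> y; 0 \<le> N;
        v\<^sup>2 / 2 \<le> 2 * m; N \<le> l * y; \<delta>\<^sub>1 * y powr (\<beta> + 2) \<le> 2 * m; \<delta>\<^sub>4 * N\<^sup>2 \<le> 2 * m\<rbrakk>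
      \<Longrightarrow> e * (v * N) \<le> m"
proof -
  \<comment> \<open>The second entry solves \<open>\<gamma> * (\<alpha> + 1) + (\<alpha> + 2) /
    (\<beta> + 2) = 1\<close> and is positive because \<alpha> < \<beta>; the third solves
    \<open>\<gamma> + 1 / 2 + 1 / (\<beta> + 2) = 1\<close>. The first makes
    \<open>m powr (\<alpha> / 2)\<close> the smaller power for \<open>m \<le> 1\<close>.\<close>
  define \<gamma> where "\<gamma> = min (\<alpha> / 2) (min ((\<beta> - \<alpha>) / ((\<beta> + 2) * (\<alpha> + 1))) (\<beta> / (2 * (\<beta> + 2))))"
  \<comment> \<open>In the unfavourable mixed case \<open>a \<le> q * e * R\<close>. The constant
    \<open>r1\<close> comes from interpolation and is used for \<open>m \<le> 1\<close>;
    \<open>s1\<close> solves the potential energy bound for \<open>y\<close>, and \<open>r2\<close>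
    results from it through the imbedding of Y in X for \<open>m > 1\<close>.\<close>
  define q where "q = 2 * D\<^sub>4 / \<delta>\<^sub>3"
  define r1 where "r1 = C\<^sub>5 * (2 / \<delta>\<^sub>4 + 2 / \<delta>\<^sub>1)"
  define s1 where "s1 = (2 / \<delta>\<^sub>1) powr (1 / (\<beta> + 2))"
  define r2 where "r2 = (k * s1) powr (\<alpha> + 2)"
  \<comment> \<open>\<open>c1\<close> serves the quadratic estimate, \<open>c2\<close> the mixed
    one, \<open>c3\<close> and \<open>c4\<close> the product for \<open>m \<le> 1\<close> and
    \<open>m > 1\<close>. The further bound \<open>c \<le> 1\<close> gives
    \<open>c powr (\<alpha> + 1) \<le> c\<close>.\<close>
  define c1 where "c1 = \<delta>\<^sub>3 / (2 * A) * (\<delta>\<^sub>2 / (4 * A)) powr (\<alpha> / 2)"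
  define c2 where "c2 = \<delta>\<^sub>2 / (4 * (D\<^sub>4 * q powr (\<alpha> + 1) * (r1 + r2)))"
  define c3 where "c3 = 1 / (2 * sqrt (2 / \<delta>\<^sub>4))"
  define c4 where "c4 = 1 / (2 * (l * s1))"
  define c where "c = min 1 (min c1 (min c2 (min c3 c4)))"
  define \<mu> where "\<mu> m = min (m powr (\<alpha> / 2)) (m powr \<gamma>)" for m
  have p: "0 < q" "0 < r1" "0 < s1" "0 < r2"
    using pos ab by (auto simp: q_def r1_def s1_def r2_def intro!: mult_pos_pos add_pos_pos)
  have "0 < c1" "0 < c2" "0 < c3" "0 < c4"
    using pos p ab by (auto simp: c1_def c2_def c3_def c4_def intro!: divide_pos_pos mult_pos_pos add_pos_pos)
  then have c: "0 < c" "c \<le> 1" "c \<le> c1" "c \<le> c2" "c \<le> c3" "c \<le> c4"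
    by (auto simp: c_def)
  have "0 < \<gamma>"
    unfolding \<gamma>_def min_less_iff_conj using ab by (intro conjI divide_pos_pos mult_pos_pos) auto
  moreover have "\<gamma> \<le> \<alpha> / 2" "\<gamma> \<le> (\<beta> - \<alpha>) / ((\<beta> + 2) * (\<alpha> + 1))" "\<gamma> \<le> \<beta> / (2 * (\<beta> + 2))"
    unfolding \<gamma>_def by (simp_all only: min_le_iff_disj order_refl simp_thms)
  ultimately have \<gamma>: "0 < \<gamma>" "\<gamma> \<le> \<alpha> / 2" "\<gamma> \<le> (\<beta> - \<alpha>) / ((\<beta> + 2) * (\<alpha> + 1))" "\<gamma> \<le> \<beta> / (2 * (\<beta> + 2))"
    by blast+
  have \<gamma>R: "\<gamma> * (\<alpha> + 1) + (\<alpha> + 2) / (\<beta> + 2) \<le> 1"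
  proof -
    have "\<gamma> * (\<alpha> + 1) \<le> (\<beta> - \<alpha>) / ((\<beta> + 2) * (\<alpha> + 1)) * (\<alpha> + 1)"
      using \<gamma> ab by (intro mult_right_mono) auto
    also have "\<dots> = (\<beta> - \<alpha>) / (\<beta> + 2)" using ab by simp
    also have "\<dots> = 1 - (\<alpha> + 2) / (\<beta> + 2)" using ab by (simp add: field_simps)
    finally show ?thesis by simp
  qed
  have \<gamma>P: "\<gamma> + 1 / 2 + 1 / (\<beta> + 2) \<le> 1"
  proof -
    have "(s - 2) / (2 * s) + 1 / 2 + 1 / s = 1" if "s \<noteq> 0" for s :: real
      using that by (simp add: field_simps)
    from this[of "\<beta> + 2"] have "\<beta> / (2 * (\<beta> + 2)) + 1 / 2 + 1 / (\<beta> + 2) = 1" using ab by simp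
    then show ?thesis using \<gamma>(4) by linarith
  qed
  have \<mu>: "0 < \<mu> m" "\<mu> m \<le> m powr (\<alpha> / 2)" "m \<le> 1 \<Longrightarrow> \<mu> m \<le> 1" "\<mu> m \<le> m powr \<gamma>" if "0 < m" for m
  proof -
    show "0 < \<mu> m" "\<mu> m \<le> m powr (\<alpha> / 2)" "\<mu> m \<le> m powr \<gamma>"
      using that by (auto simp: \<mu>_def)
    assume "m \<le> 1"
    then have "m powr \<gamma> \<le> 1" using that \<gamma> by (simp add: powr_le1)
    then show "\<mu> m \<le> 1" by (simp add: \<mu>_def)
  qed
  have y_bound: "y \<le> s1 * m powr (1 / (\<beta> + 2))" if "0 < m" "0 \<le> y" "\<delta>\<^sub>1 * y powr (\<beta> + 2) \<le> 2 * m" for m y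
  proof -
    have "y powr (\<beta> + 2) \<le> 2 / \<delta>\<^sub>1 * m"
      using that pos by (simp add: field_simps)
    then have "(y powr (\<beta> + 2)) powr (1 / (\<beta> + 2)) \<le> (2 / \<delta>\<^sub>1 * m) powr (1 / (\<beta> + 2))"
      using ab by (intro powr_mono2) auto
    also have "\<dots> = s1 * m powr (1 / (\<beta> + 2))"
      unfolding s1_def by (rule powr_mult)
    finally show ?thesis using that ab by (simp add: powr_powr)
  qed
  have quadratic: "e * (A * a\<^sup>2) \<le> \<delta>\<^sub>3 / 2 * a powr (\<alpha> + 2) + e * \<delta>\<^sub>2 * m / 4"
    if m: "0 < m" and e: "e = c * \<mu> m" and a: "0 \<le> a" for m e a
  \<comment> \<open>A dichotomy in the manner of Young's inequality: either the term fits into the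
    share of \<open>m\<close>, or \<open>a powr \<alpha>\<close> is at least a multiple of
    \<open>m powr (\<alpha> / 2)\<close> and the damping covers it.\<close>
  proof (cases "A * a\<^sup>2 \<le> \<delta>\<^sub>2 * m / 4")
    case True
    have "0 < e" using e c \<mu>(1)[OF m] by simp
    then have "e * (A * a\<^sup>2) \<le> e * (\<delta>\<^sub>2 * m / 4)"
      using True by (intro mult_left_mono) auto
    moreover have "0 \<le> \<delta>\<^sub>3 / 2 * a powr (\<alpha> + 2)" using pos by simp
    ultimately show ?thesis by simp
  next
    case False
    have e0: "0 < e" using e c \<mu>(1)[OF m] by simp
    have "0 < a\<^sup>2" using False m pos by (cases "a = 0") auto
    then have a0: "0 < a" using a by (simp add: less_le)
    have "\<delta>\<^sub>2 / (4 * A) * m \<le> a\<^sup>2" using False pos by (simp add: field_simps)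
    then have "(\<delta>\<^sub>2 / (4 * A) * m) powr (\<alpha> / 2) \<le> (a\<^sup>2) powr (\<alpha> / 2)"
      using pos m ab by (intro powr_mono2) auto
    also have "(a\<^sup>2) powr (\<alpha> / 2) = a powr \<alpha>"
      using a0 powr_powr[of a 2 "\<alpha> / 2"] by (simp add: powr_numeral)
    also have "(\<delta>\<^sub>2 / (4 * A) * m) powr (\<alpha> / 2) = (\<delta>\<^sub>2 / (4 * A)) powr (\<alpha> / 2) * m powr (\<alpha> / 2)"
      by (rule powr_mult)
    finally have 1: "(\<delta>\<^sub>2 / (4 * A)) powr (\<alpha> / 2) * m powr (\<alpha> / 2) \<le> a powr \<alpha>" .
    have "e * A \<le> c1 * m powr (\<alpha> / 2) * A"
      unfolding e using c \<mu>(1,2)[OF m] pos \<open>0 < c1\<close> by (intro mult_right_mono mult_mono) auto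
    also have "\<dots> = \<delta>\<^sub>3 / 2 * ((\<delta>\<^sub>2 / (4 * A)) powr (\<alpha> / 2) * m powr (\<alpha> / 2))"
      using pos by (simp add: c1_def)
    also have "\<dots> \<le> \<delta>\<^sub>3 / 2 * a powr \<alpha>"
      using 1 pos by (intro mult_left_mono) auto
    finally have "e * A * a\<^sup>2 \<le> \<delta>\<^sub>3 / 2 * a powr \<alpha> * a\<^sup>2"
      by (intro mult_right_mono) auto
    also have "\<dots> = \<delta>\<^sub>3 / 2 * a powr (\<alpha> + 2)"
      using a0 by (simp add: powr_add powr_numeral)
    finally have "e * A * a\<^sup>2 \<le> \<delta>\<^sub>3 / 2 * a powr (\<alpha> + 2)" .
    moreover have "0 \<le> e * \<delta>\<^sub>2 * m / 4" using e0 pos m by simp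
    ultimately show ?thesis by (simp add: mult.assoc)
  qed
  have mixed: "e * (D\<^sub>4 * a powr (\<alpha> + 1) * R) \<le> \<delta>\<^sub>3 / 2 * a powr (\<alpha> + 2) + e * \<delta>\<^sub>2 * m / 4"
    if R1: "R powr (\<alpha> + 2) \<le> C\<^sub>5 * (N\<^sup>2 + y powr (\<beta> + 2))"
      and m: "0 < m" and e: "e = c * \<mu> m" and nn: "0 \<le> a" "0 \<le> R" "0 \<le> y" "0 \<le> N" and R2: "R \<le> k * y"
      and y: "\<delta>\<^sub>1 * y powr (\<beta> + 2) \<le> 2 * m" and N: "\<delta>\<^sub>4 * N\<^sup>2 \<le> 2 * m" for m e a R y N
  \<comment> \<open>Either the damping covers the term directly, or \<open>a\<close> is small
    compared with \<open>e * R\<close> and this bound is inserted for \<open>a\<close>.\<close>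
  proof (cases "e * D\<^sub>4 * R \<le> \<delta>\<^sub>3 / 2 * a")
    case True
    have e0: "0 < e" using e c \<mu>(1)[OF m] by simp
    have "e * (D\<^sub>4 * a powr (\<alpha> + 1) * R) = e * D\<^sub>4 * R * a powr (\<alpha> + 1)" by simp
    also have "\<dots> \<le> \<delta>\<^sub>3 / 2 * a * a powr (\<alpha> + 1)"
      using True by (intro mult_right_mono) auto
    also have "\<dots> = \<delta>\<^sub>3 / 2 * a powr (\<alpha> + 2)"
      using nn(1) by (cases "a = 0") (auto simp: powr_add powr_numeral power2_eq_square)
    finally have "e * (D\<^sub>4 * a powr (\<alpha> + 1) * R) \<le> \<delta>\<^sub>3 / 2 * a powr (\<alpha> + 2)" .
    moreover have "0 \<le> e * \<delta>\<^sub>2 * m / 4" using e0 pos m by simp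
    ultimately show ?thesis by simp
  next
    case False
    have e0: "0 < e" using e c \<mu>(1)[OF m] by simp
    have R0: "0 < R" using False nn pos by (cases "R = 0") auto
    have aq: "a \<le> q * e * R"
      using False pos by (simp add: q_def field_simps)
    \<comment> \<open>Bounding \<open>a\<close> brings in \<alpha> + 1 further powers of
      \<open>e\<close>, and their product with the power of \<open>R\<close> must stay linear in
      \<open>m\<close>. Interpolation achieves this for \<open>m \<le> 1\<close>, the choice of
      \<gamma> for larger \<open>m\<close>.\<close>
    have claim: "\<mu> m powr (\<alpha> + 1) * R powr (\<alpha> + 2) \<le> (r1 + r2) * m"
    proof (cases "m \<le> 1")
      case True
      have "\<mu> m powr (\<alpha> + 1) \<le> 1"
        using \<mu>[OF m] True ab by (intro powr_le1) auto
      then have "\<mu> m powr (\<alpha> + 1) * R powr (\<alpha> + 2) \<le> 1 * R powr (\<alpha> + 2)"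
        by (intro mult_right_mono) auto
      also have "\<dots> \<le> C\<^sub>5 * (N\<^sup>2 + y powr (\<beta> + 2))" using R1 by simp
      also have "\<dots> \<le> C\<^sub>5 * (2 / \<delta>\<^sub>4 * m + 2 / \<delta>\<^sub>1 * m)"
        using y N pos by (intro mult_left_mono add_mono) (auto simp: field_simps)
      also have "\<dots> = r1 * m" by (simp add: r1_def algebra_simps)
      also have "\<dots> \<le> (r1 + r2) * m" using p m by simp
      finally show ?thesis .
    next
      case False
      have "R \<le> k * s1 * m powr (1 / (\<beta> + 2))"
        using order_trans[OF R2 mult_left_mono[OF y_bound[OF m nn(3) y] less_imp_le[OF pos(8)]]]
        by (simp only: mult.assoc)
      then have "R powr (\<alpha> + 2) \<le> (k * s1 * m powr (1 / (\<beta> + 2))) powr (\<alpha> + 2)"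
        using nn ab by (intro powr_mono2) auto
      also have "\<dots> = r2 * m powr ((\<alpha> + 2) / (\<beta> + 2))"
        using p pos m by (simp add: r2_def powr_mult powr_powr)
      finally have R3: "R powr (\<alpha> + 2) \<le> r2 * m powr ((\<alpha> + 2) / (\<beta> + 2))" .
      have "\<mu> m powr (\<alpha> + 1) \<le> (m powr \<gamma>) powr (\<alpha> + 1)"
        using \<mu>[OF m] ab by (intro powr_mono2) auto
      then have "\<mu> m powr (\<alpha> + 1) * R powr (\<alpha> + 2) \<le> (m powr \<gamma>) powr (\<alpha> + 1) * (r2 * m powr ((\<alpha> + 2) / (\<beta> + 2)))"
        using R3 by (intro mult_mono) auto
      also have "\<dots> = r2 * m powr (\<gamma> * (\<alpha> + 1) + (\<alpha> + 2) / (\<beta> + 2))"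
        by (simp only: powr_powr powr_add[of m] mult.left_commute)
      also have "\<dots> \<le> r2 * m powr 1"
        using \<gamma>R False p by (intro mult_left_mono powr_mono) auto
      also have "\<dots> \<le> (r1 + r2) * m" using p m by simp
      finally show ?thesis .
    qed
    have "a powr (\<alpha> + 1) \<le> (q * e * R) powr (\<alpha> + 1)"
      using aq nn ab by (intro powr_mono2) auto
    then have "e * (D\<^sub>4 * a powr (\<alpha> + 1) * R) \<le> e * (D\<^sub>4 * (q * e * R) powr (\<alpha> + 1) * R)"
      using e0 pos nn by (intro mult_left_mono mult_right_mono) auto
    also have "\<dots> = e * (D\<^sub>4 * q powr (\<alpha> + 1)) * (c powr (\<alpha> + 1) * (\<mu> m powr (\<alpha> + 1) * R powr (\<alpha> + 2)))"
    proof -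
      have "(q * e * R) powr (\<alpha> + 1) = q powr (\<alpha> + 1) * (c powr (\<alpha> + 1) * \<mu> m powr (\<alpha> + 1)) * R powr (\<alpha> + 1)"
        using p e c \<mu>(1)[OF m] R0 by (simp add: powr_mult)
      moreover have "R powr (\<alpha> + 2) = R powr (\<alpha> + 1) * R"
        using R0 powr_add[of R "\<alpha> + 1" 1] by (simp add: ac_simps)
      ultimately show ?thesis by simp
    qed
    also have "\<dots> \<le> e * (D\<^sub>4 * q powr (\<alpha> + 1)) * (c2 * ((r1 + r2) * m))"
    proof (intro mult_left_mono mult_mono[OF _ claim])
      have "c powr (\<alpha> + 1) \<le> c powr 1" using c ab by (intro powr_mono') auto
      then show "c powr (\<alpha> + 1) \<le> c2" using c by simp
    qed (use \<open>0 < c2\<close> e0 pos in auto)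
    also have "\<dots> = e * \<delta>\<^sub>2 * m / 4"
    proof -
      have "D\<^sub>4 * q powr (\<alpha> + 1) * (r1 + r2) \<noteq> 0"
        using pos p by auto
      then have "D\<^sub>4 * q powr (\<alpha> + 1) * (r1 + r2) * c2 = \<delta>\<^sub>2 / 4"
        by (simp add: c2_def)
      then have "e * m * (D\<^sub>4 * q powr (\<alpha> + 1) * (r1 + r2) * c2) = e * m * (\<delta>\<^sub>2 / 4)" by simp
      then show ?thesis by (simp add: mult_ac)
    qed
    finally show ?thesis
      by (rule order_trans) (use pos in simp)
  qed
  have product: "e * (v * N) \<le> m"
    if Ny: "N \<le> l * y" and m: "0 < m" and e: "e = c * \<mu> m" and nn: "0 \<le> v" "0 \<le> y" "0 \<le> N"
      and v: "v\<^sup>2 / 2 \<le> 2 * m"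
      and y: "\<delta>\<^sub>1 * y powr (\<beta> + 2) \<le> 2 * m" and N: "\<delta>\<^sub>4 * N\<^sup>2 \<le> 2 * m" for m e v y N
  proof -
    have e0: "0 < e" using e c \<mu>(1)[OF m] by simp
    have "v\<^sup>2 \<le> (2 * sqrt m)\<^sup>2" using v m by (simp add: power_mult_distrib)
    then have v2: "v \<le> 2 * sqrt m" by (rule power2_le_imp_le) (use m in simp)
    show ?thesis
    proof (cases "m \<le> 1")
      case True
      have "N\<^sup>2 \<le> (sqrt (2 / \<delta>\<^sub>4) * sqrt m)\<^sup>2"
      proof -
        have "N\<^sup>2 \<le> 2 / \<delta>\<^sub>4 * m" using N pos by (simp add: field_simps)
        then show ?thesis using m pos by (simp add: power_mult_distrib)
      qed
      then have "N \<le> sqrt (2 / \<delta>\<^sub>4) * sqrt m" by (rule power2_le_imp_le) (use m pos in simp)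
      then have "v * N \<le> (2 * sqrt m) * (sqrt (2 / \<delta>\<^sub>4) * sqrt m)"
        using v2 nn m by (intro mult_mono) auto
      also have "\<dots> = (2 * sqrt (2 / \<delta>\<^sub>4)) * m" using m by (simp add: mult_ac flip: power2_eq_square)
      finally have vN: "v * N \<le> (2 * sqrt (2 / \<delta>\<^sub>4)) * m" .
      have "e \<le> c3 * 1" unfolding e using c \<mu>[OF m] True by (intro mult_mono) auto
      then have "e * (v * N) \<le> c3 * 1 * ((2 * sqrt (2 / \<delta>\<^sub>4)) * m)"
        using nn \<open>0 < c3\<close> by (intro mult_mono[OF _ vN]) auto
      also have "\<dots> = m" using pos by (simp add: c3_def)
      finally show ?thesis .
    next
      case False
      have "N \<le> l * s1 * m powr (1 / (\<beta> + 2))"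
        using order_trans[OF Ny mult_left_mono[OF y_bound[OF m nn(2) y] less_imp_le[OF pos(9)]]]
        by (simp only: mult.assoc)
      then have "v * N \<le> (2 * sqrt m) * (l * s1 * m powr (1 / (\<beta> + 2)))"
        using v2 nn m by (intro mult_mono) auto
      note vN = this
      have "e \<le> c4 * m powr \<gamma>" unfolding e using c \<mu>[OF m] \<open>0 < c4\<close> by (intro mult_mono) auto
      then have "e * (v * N) \<le> (c4 * m powr \<gamma>) * ((2 * sqrt m) * (l * s1 * m powr (1 / (\<beta> + 2))))"
        using nn \<open>0 < c4\<close> by (intro mult_mono[OF _ vN]) auto
      also have "\<dots> = (c4 * (2 * (l * s1))) * m powr (\<gamma> + 1 / 2 + 1 / (\<beta> + 2))"
        using m by (simp add: powr_add powr_half_sqrt)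
      also have "c4 * (2 * (l * s1)) = 1" using pos p by (simp add: c4_def)
      also have "1 * m powr (\<gamma> + 1 / 2 + 1 / (\<beta> + 2)) \<le> m powr 1"
        using powr_mono[OF \<gamma>P, of m] False by simp
      finally show ?thesis using m by simp
    qed
  qed
  show thesis
    by (rule that[OF c(1) \<gamma>(1,2)];
        rule quadratic[unfolded \<mu>_def] mixed[unfolded \<mu>_def] product[unfolded \<mu>_def]; assumption)
qed

text \<open>The V-valued derivative is hidden: dissipation is required for every \<open>x\<close>
  with \<open>j x\<close> equal to the velocity, which covers u' at almost every time. After u'' is
  replaced through the equation, the two pairings of the gradient with u' cancel.\<close>

lemma strong_solution_modified_energy:
  fixes j :: "'v::{real_inner,banach} \<Rightarrow>\<^sub>L 'h::{real_inner,banach}"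
  assumes sol: "strong_solution_on j G g T u"
    and F: "\<And>x. (F has_derivative blinfun_apply (G x)) (at x)" and G: "continuous_on UNIV G"
  shows "continuous_on {0<..<T} (velocity j u)" and "continuous_on {0<..<T} u"
    and "\<And>e c a b. \<lbrakk>0 < a; a \<le> b; b < T; AE t in lebesgue_on {0<..<T}. t \<in> {a<..<b} \<longrightarrow>
        (\<forall>x. j x = velocity j u t \<longrightarrow>
          - g t x x + e * ((norm (velocity j u t))\<^sup>2 - G (u t) (u t) - g t x (u t)) + c \<le> 0)\<rbrakk>
      \<Longrightarrow> (norm (velocity j u b))\<^sup>2 / 2 + F (u b) + e * inner (velocity j u b) (j (u b)) + c * (b - a)
        \<le> (norm (velocity j u a))\<^sup>2 / 2 + F (u a) + e * inner (velocity j u a) (j (u a))"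
proof -
  obtain u' u'' where cont: "continuous_on {0<..<T} u" and W1: "W_1_infinity T u u'"
    and W2: "W_2_1 T (\<lambda>t. pivot_map j (j (u t))) (\<lambda>t. pivot_map j (j (u' t))) u''"
    and eq: "AE t in lebesgue_on {0<..<T}. u'' t + G (u t) + g t (u' t) = 0"
    using sol unfolding strong_solution_on_def by blast
  obtain M where M: "AE t in lebesgue_on {0<..<T}. norm (u' t) \<le> M"
    using W1 unfolding W_1_infinity_def L_infinity_def by blast
  interpret weak_trajectory j T M u u' u''
    using cont W1 W2 M by unfold_locales
  show "continuous_on {0<..<T} (velocity j u)" "continuous_on {0<..<T} u"
    by (rule velocity_continuous cont)+
  fix e c a b
  assume ab: "0 < a" "a \<le> b" "b < T"
    and diss: "AE t in lebesgue_on {0<..<T}. t \<in> {a<..<b} \<longrightarrow>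
        (\<forall>x. j x = velocity j u t \<longrightarrow>
          - g t x x + e * ((norm (velocity j u t))\<^sup>2 - G (u t) (u t) - g t x (u t)) + c \<le> 0)"
  have reg: "AE t in lebesgue_on {0<..<T}. t \<in> regular"
  proof (rule AE_lebesgue_on_iff_negligible[THEN iffD2])
    show "\<exists>N. negligible N \<and> (\<forall>t\<in>{0<..<T} - N. t \<in> regular)"
      by (rule exI[of _ "{0<..<T} - regular"]) (use negligible_not_regular in auto)
  qed simp
  have "AE t in lebesgue_on {0<..<T}. t \<in> {a<..<b} \<longrightarrow>
      u'' t (u' t) + G (u t) (u' t) + e * ((norm (velocity j u t))\<^sup>2 + u'' t (u t)) + c \<le> 0"
    using eq diss reg
  proof eventually_elim
    case (elim t)
    have f: "u'' t = - G (u t) - g t (u' t)"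
      using elim(1) by (simp add: eq_neg_iff_add_eq_0 algebra_simps)
    have "t \<in> {a<..<b} \<longrightarrow> - g t (u' t) (u' t)
        + e * ((norm (velocity j u t))\<^sup>2 - G (u t) (u t) - g t (u' t) (u t)) + c \<le> 0"
      using elim(2) velocity_regular[OF elim(3)] by simp
    then show ?case
      unfolding f by (simp add: blinfun.diff_left blinfun.minus_left algebra_simps)
  qed
  from modified_energy_decreasing[OF F G ab this]
  show "(norm (velocity j u b))\<^sup>2 / 2 + F (u b) + e * inner (velocity j u b) (j (u b)) + c * (b - a)
        \<le> (norm (velocity j u a))\<^sup>2 / 2 + F (u a) + e * inner (velocity j u a) (j (u a))"
    by (simp add: modified_energy_def)
qed

text \<open>Membership in the range makes \<open>inv (dual_map i) w\<close> a genuine preimage, so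
  \<open>w\<close> acts on \<open>x\<close> through \<open>i x\<close>.\<close>

lemma dual_space_bound:
  assumes "w \<in> dual_space i" "dual_norm i w \<le> K"
  shows "\<bar>blinfun_apply w x\<bar> \<le> K * norm (blinfun_apply i x)"
proof -
  define W where "W = inv (dual_map i) w"
  have "dual_map i W = w"
    using assms(1) unfolding W_def dual_space_def by (rule f_inv_into_f)
  then have "w x = W (i x)"
    by (auto simp: dual_map_def)
  then have "\<bar>w x\<bar> \<le> norm W * norm (i x)"
    using norm_blinfun[of W "i x"] by simp
  also have "\<dots> \<le> K * norm (i x)"
    using assms(2) unfolding dual_norm_def W_def by (rule mult_right_mono) simp
  finally show ?thesis .
qed

theorem theorem3p4:
  fixes jVY :: "'v::{real_inner,banach} \<Rightarrow>\<^sub>L 'y::banach"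
    and jYX :: "'y \<Rightarrow>\<^sub>L 'x::banach"
    and jXH :: "'x \<Rightarrow>\<^sub>L 'h::{real_inner,banach}"
    and \<alpha> \<beta> C\<^sub>5 \<delta>\<^sub>1 \<delta>\<^sub>2 \<delta>\<^sub>3 \<delta>\<^sub>4 D\<^sub>4 :: real
  assumes "embedding_chain jVY jYX jXH"
    and "0 < \<alpha>" and "\<alpha> < \<beta>"
    and "C\<^sub>5 > 0" and "\<delta>\<^sub>1 > 0" and "\<delta>\<^sub>2 > 0" and "\<delta>\<^sub>3 > 0" and "\<delta>\<^sub>4 > 0" and "D\<^sub>4 > 0"
    and "\<forall>u. norm (jYX (jVY u)) powr (\<alpha> + 2)
           \<le> C\<^sub>5 * ((norm (jXH (jYX (jVY u))))\<^sup>2 + norm (jVY u) powr (\<beta> + 2))"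
  shows "\<exists>D::real. \<forall>(F :: 'v \<Rightarrow> real) (G :: 'v \<Rightarrow> ('v \<Rightarrow>\<^sub>L real)) (g :: real \<Rightarrow> 'v \<Rightarrow> ('v \<Rightarrow>\<^sub>L real)).
     (\<forall>u. (F has_derivative blinfun_apply (G u)) (at u)) \<and> continuous_on UNIV G \<and>
     (\<forall>T>0. \<forall>v. L_infinity T v \<longrightarrow> L_1 T (\<lambda>t. g t (v t))) \<and>
     (\<forall>u. F u \<ge> \<delta>\<^sub>1 * norm (jVY u) powr (\<beta> + 2)) \<and>
     (\<forall>u. blinfun_apply (G u) u \<ge> \<delta>\<^sub>2 * F u) \<and>
     (\<forall>u. F u \<ge> \<delta>\<^sub>4 * (norm (jXH (jYX (jVY u))))\<^sup>2) \<and>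
     (AE t in lebesgue_on {0<..}. \<forall>v. blinfun_apply (g t v) v \<ge> \<delta>\<^sub>3 * norm (jYX (jVY v)) powr (\<alpha> + 2)) \<and>
     (\<forall>t>0. \<forall>v. g t v \<in> dual_space (jYX o\<^sub>L jVY)) \<and>
     (AE t in lebesgue_on {0<..}. \<forall>v.
        dual_norm (jYX o\<^sub>L jVY) (g t v) \<le> D\<^sub>4 * norm (jYX (jVY v)) powr (\<alpha> + 1))
     \<longrightarrow> (\<forall>u. global_strong_solution (jXH o\<^sub>L jYX o\<^sub>L jVY) G g u \<longrightarrow>
           (\<forall>t\<ge>1. (norm (velocity (jXH o\<^sub>L jYX o\<^sub>L jVY) u t))\<^sup>2 + F (u t) \<le> D * t powr (- 2 / \<alpha>)))"
proof -
  note ab = assms(2,3) and C5 = assms(4) and \<delta> = assms(5-8) and D4 = assms(9) and interpolation = assms(10)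
  let ?J = "jYX o\<^sub>L jVY"
  let ?j = "jXH o\<^sub>L jYX o\<^sub>L jVY"
  \<comment> \<open>The weight \<open>1 + \<delta>\<^sub>2 / 2\<close> collects the squared velocity
    from the derivative of the inner product and from writing \<open>F\<close> as energy minus
    kinetic energy. The added 1 here and in \<open>k\<close>, \<open>l\<close> ensures
    positivity.\<close>
  define A where "A = (1 + \<delta>\<^sub>2 / 2) * ((norm jXH)\<^sup>2 + 1)"
  define k where "k = norm jYX + 1"
  define l where "l = norm (jXH o\<^sub>L jYX) + 1"
  have "0 < A" "0 < k" "0 < l"
    using \<delta> by (auto simp: A_def k_def l_def intro!: mult_pos_pos add_pos_pos add_nonneg_pos)
  then obtain c \<gamma> where c: "0 < c" and \<gamma>: "0 < \<gamma>" "\<gamma> \<le> \<alpha> / 2"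
    and quadratic: "\<And>m e a. \<lbrakk>0 < m; e = c * min (m powr (\<alpha> / 2)) (m powr \<gamma>); 0 \<le> a\<rbrakk>
      \<Longrightarrow> e * (A * a\<^sup>2) \<le> \<delta>\<^sub>3 / 2 * a powr (\<alpha> + 2) + e * \<delta>\<^sub>2 * m / 4"
    and mixed: "\<And>m e a R y N. \<lbrakk>0 < m; e = c * min (m powr (\<alpha> / 2)) (m powr \<gamma>); 0 \<le> a; 0 \<le> R; 0 \<le> y; 0 \<le> N;
        R powr (\<alpha> + 2) \<le> C\<^sub>5 * (N\<^sup>2 + y powr (\<beta> + 2)); R \<le> k * y;
        \<delta>\<^sub>1 * y powr (\<beta> + 2) \<le> 2 * m; \<delta>\<^sub>4 * N\<^sup>2 \<le> 2 * m\<rbrakk>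
      \<Longrightarrow> e * (D\<^sub>4 * a powr (\<alpha> + 1) * R) \<le> \<delta>\<^sub>3 / 2 * a powr (\<alpha> + 2) + e * \<delta>\<^sub>2 * m / 4"
    and cross: "\<And>m e v y N. \<lbrakk>0 < m; e = c * min (m powr (\<alpha> / 2)) (m powr \<gamma>); 0 \<le> v; 0 \<le> y; 0 \<le> N;
        v\<^sup>2 / 2 \<le> 2 * m; N \<le> l * y; \<delta>\<^sub>1 * y powr (\<beta> + 2) \<le> 2 * m; \<delta>\<^sub>4 * N\<^sup>2 \<le> 2 * m\<rbrakk>
      \<Longrightarrow> e * (v * N) \<le> m"
    by (rule coupling_exists[OF ab \<delta> D4 C5]) blast
  \<comment> \<open>On one level the modified energy changes by at most \<open>4 * m\<close> and
    decreases at rate \<open>e * \<delta>\<^sub>2 * m / 2\<close>, so the level lasts at most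
    \<open>8 / (e * \<delta>\<^sub>2)\<close>.\<close>
  define C where "C = 8 / (\<delta>\<^sub>2 * c)"
  have "0 < C" using \<delta> c by (simp add: C_def)
  obtain D where D: "0 < D" "\<And>E t. \<lbrakk>1 \<le> t; continuous_on {0<..t} E; \<And>s r. \<lbrakk>0 < s; s \<le> r; r \<le> t\<rbrakk> \<Longrightarrow> E r \<le> E s; 0 \<le> E t;
      \<And>s r m. \<lbrakk>0 < s; s \<le> r; r \<le> t; 0 < m; m \<le> E r; E s \<le> 2 * m\<rbrakk>
         \<Longrightarrow> r - s \<le> C * (m powr (- (\<alpha> / 2)) + m powr (- \<gamma>))\<rbrakk>
      \<Longrightarrow> E t \<le> D * t powr (- 2 / \<alpha>)"
    by (rule decay_from_level_times[OF ab(1) \<gamma> \<open>0 < C\<close>]) blast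
  \<comment> \<open>The factor 2 compensates the half in the kinetic part of
    \<open>E\<close>.\<close>
  have "(norm (velocity ?j u t))\<^sup>2 + F (u t) \<le> 2 * D * t powr (- 2 / \<alpha>)"
    if F: "\<And>x. (F has_derivative blinfun_apply (G x)) (at x)" and G: "continuous_on UNIV G"
      and F1: "\<And>x. F x \<ge> \<delta>\<^sub>1 * norm (jVY x) powr (\<beta> + 2)"
      and G2: "\<And>x. blinfun_apply (G x) x \<ge> \<delta>\<^sub>2 * F x"
      and F4: "\<And>x. F x \<ge> \<delta>\<^sub>4 * (norm (jXH (jYX (jVY x))))\<^sup>2"
      and g3: "AE t in lebesgue_on {0<..}. \<forall>v. blinfun_apply (g t v) v \<ge> \<delta>\<^sub>3 * norm (jYX (jVY v)) powr (\<alpha> + 2)"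
      and g_dual: "\<And>t v. 0 < t \<Longrightarrow> g t v \<in> dual_space ?J"
      and g4: "AE t in lebesgue_on {0<..}. \<forall>v. dual_norm ?J (g t v) \<le> D\<^sub>4 * norm (jYX (jVY v)) powr (\<alpha> + 1)"
      and sol: "global_strong_solution ?j G g u" and t: "1 \<le> t"
    for F G g u and t :: real
  proof -
    define T where "T = t + 1"
    have T: "0 < T" "t < T" using t by (auto simp: T_def)
    have "strong_solution_on ?j G g T u"
      using sol T unfolding global_strong_solution_def by blast
    note energy = strong_solution_modified_energy[OF this F G]
    let ?v = "velocity ?j u"
    define E where "E t = (norm (?v t))\<^sup>2 / 2 + F (u t)" for t
    have F0: "0 \<le> F x" for x
      by (rule order_trans[OF _ F1]) (use \<delta> in simp)
    have "AE t in lebesgue_on {0<..}. \<forall>v. \<delta>\<^sub>3 * norm (jYX (jVY v)) powr (\<alpha> + 2) \<le> g t v v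
        \<and> dual_norm ?J (g t v) \<le> D\<^sub>4 * norm (jYX (jVY v)) powr (\<alpha> + 1)"
      using g3 g4 by eventually_elim blast
    then have "\<exists>N. negligible N \<and> (\<forall>t\<in>{0<..} - N. \<forall>v. \<delta>\<^sub>3 * norm (jYX (jVY v)) powr (\<alpha> + 2) \<le> g t v v
        \<and> dual_norm ?J (g t v) \<le> D\<^sub>4 * norm (jYX (jVY v)) powr (\<alpha> + 1))"
      by (rule AE_lebesgue_on_iff_negligible[THEN iffD1, rotated]) simp
    then obtain N where N: "negligible N" "\<And>t v. \<lbrakk>0 < t; t \<notin> N\<rbrakk> \<Longrightarrow>
        \<delta>\<^sub>3 * norm (jYX (jVY v)) powr (\<alpha> + 2) \<le> g t v v
        \<and> dual_norm ?J (g t v) \<le> D\<^sub>4 * norm (jYX (jVY v)) powr (\<alpha> + 1)"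
      by auto
    have AE_T: "AE t in lebesgue_on {0<..<T}. P t" if "\<And>t. \<lbrakk>0 < t; t < T; t \<notin> N\<rbrakk> \<Longrightarrow> P t" for P
    proof (rule AE_lebesgue_on_iff_negligible[THEN iffD2])
      show "\<exists>N. negligible N \<and> (\<forall>t\<in>{0<..<T} - N. P t)"
        by (rule exI[of _ N]) (use N(1) that in auto)
    qed simp
    \<comment> \<open>The case of zero coupling and zero rate: only the nonnegative damping
      remains.\<close>
    have mono: "E r \<le> E s" if "0 < s" "s \<le> r" "r \<le> t" for s r
    proof -
      have "0 \<le> g \<tau> x x" if "0 < \<tau>" "\<tau> \<notin> N" for \<tau> x
        by (rule order_trans[OF _ N(2)[OF that, THEN conjunct1]]) (use \<delta> in simp)
      then show ?thesis
        using energy(3)[of s r 0 0] that T by (auto simp: E_def intro!: AE_T)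
    qed
    have "E t \<le> D * t powr (- 2 / \<alpha>)"
    proof (rule D(2)[OF t])
      have "continuous_on UNIV F"
        by (intro continuous_at_imp_continuous_on ballI has_derivative_continuous[OF F])
      moreover have "continuous_on {0<..t} u" "continuous_on {0<..t} ?v"
        using T by (auto intro: continuous_on_subset[OF energy(1)] continuous_on_subset[OF energy(2)])
      ultimately have "continuous_on {0<..t} (\<lambda>t. F (u t))" "continuous_on {0<..t} ?v"
        by (auto intro: continuous_on_compose2)
      then show "continuous_on {0<..t} E"
        unfolding E_def by (intro continuous_intros) auto
      show "E r \<le> E s" if "0 < s" "s \<le> r" "r \<le> t" for s r
        by (rule mono[OF that])
      show "0 \<le> E t" using F0 by (simp add: E_def)
      fix s r m assume sr: "0 < s" "s \<le> r" "r \<le> t" and m: "0 < m" "m \<le> E r" "E s \<le> 2 * m"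
      define e where "e = c * min (m powr (\<alpha> / 2)) (m powr \<gamma>)"
      have e: "0 < e" using c m by (simp add: e_def)
      have level: "m \<le> E \<tau>" "E \<tau> \<le> 2 * m" if "s \<le> \<tau>" "\<tau> \<le> r" for \<tau>
        using mono[of s \<tau>] mono[of \<tau> r] m sr that by auto
      have bounds: "(norm (?v \<tau>))\<^sup>2 / 2 \<le> 2 * m"
        "\<delta>\<^sub>1 * norm (jVY (u \<tau>)) powr (\<beta> + 2) \<le> 2 * m" "\<delta>\<^sub>4 * (norm (jXH (jYX (jVY (u \<tau>)))))\<^sup>2 \<le> 2 * m"
        if "s \<le> \<tau>" "\<tau> \<le> r" for \<tau>
        using level(2)[OF that] F0[of "u \<tau>"] F1[of "u \<tau>"] F4[of "u \<tau>"] zero_le_power2[of "norm (?v \<tau>)"]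
        unfolding E_def by linarith+
      have cross_le: "e * \<bar>inner (?v \<tau>) (?j (u \<tau>))\<bar> \<le> m" if "s \<le> \<tau>" "\<tau> \<le> r" for \<tau>
      proof -
        have "norm (?j (u \<tau>)) \<le> l * norm (jVY (u \<tau>))"
          using norm_blinfun[of "jXH o\<^sub>L jYX" "jVY (u \<tau>)"]
          by (simp add: l_def distrib_right add_increasing2)
        then have "e * (norm (?v \<tau>) * norm (?j (u \<tau>))) \<le> m"
          using bounds[OF that] by (intro cross[OF m(1) e_def]) auto
        then show ?thesis
          using mult_left_mono[OF Cauchy_Schwarz_ineq2[of "?v \<tau>" "?j (u \<tau>)"] less_imp_le[OF e]] by linarith
      qed
      \<comment> \<open>One half of the damping absorbs the quadratic term, the other half the mixed
        term. Each absorption also costs \<open>e * \<delta>\<^sub>2 * m / 4\<close> of the gain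
        \<open>e * \<delta>\<^sub>2 * m\<close> due to the gradient, so half of the gain survives as
        decay rate.\<close>
      have "- g \<tau> x x + e * ((norm (?v \<tau>))\<^sup>2 - G (u \<tau>) (u \<tau>) - g \<tau> x (u \<tau>)) + e * \<delta>\<^sub>2 * m / 2 \<le> 0"
        if \<tau>: "s \<le> \<tau>" "\<tau> \<le> r" "\<tau> \<notin> N" and x: "?j x = ?v \<tau>" for \<tau> x
      proof -
        define a where "a = norm (jYX (jVY x))"
        have \<tau>0: "0 < \<tau>" using \<tau> sr by simp
        have gx: "\<delta>\<^sub>3 * a powr (\<alpha> + 2) \<le> g \<tau> x x"
          using N(2)[OF \<tau>0 \<tau>(3)] by (simp add: a_def)
        have "\<bar>g \<tau> x (u \<tau>)\<bar> \<le> D\<^sub>4 * a powr (\<alpha> + 1) * norm (?J (u \<tau>))"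
          using N(2)[OF \<tau>0 \<tau>(3)] unfolding a_def by (intro dual_space_bound g_dual[OF \<tau>0]) auto
        then have gu: "e * - g \<tau> x (u \<tau>) \<le> e * (D\<^sub>4 * a powr (\<alpha> + 1) * norm (?J (u \<tau>)))"
          using e by (intro mult_left_mono) auto
        have R: "norm (?J (u \<tau>)) \<le> k * norm (jVY (u \<tau>))"
          using norm_blinfun[of jYX "jVY (u \<tau>)"]
          by (simp add: k_def distrib_right add_increasing2)
        have mix: "e * (D\<^sub>4 * a powr (\<alpha> + 1) * norm (?J (u \<tau>)))
            \<le> \<delta>\<^sub>3 / 2 * a powr (\<alpha> + 2) + e * \<delta>\<^sub>2 * m / 4"
          using bounds(2,3)[OF \<tau>(1,2)] R interpolation
          by (intro mixed[OF m(1) e_def, where N = "norm (?j (u \<tau>))" and y = "norm (jVY (u \<tau>))"])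
             (auto simp: a_def)
        have "norm (?v \<tau>) \<le> norm jXH * a"
          using norm_blinfun[of jXH "jYX (jVY x)"] by (simp add: a_def flip: x)
        then have "(norm (?v \<tau>))\<^sup>2 \<le> (norm jXH * a)\<^sup>2"
          by (intro power_mono) auto
        also have "\<dots> \<le> ((norm jXH)\<^sup>2 + 1) * a\<^sup>2"
          by (simp add: power_mult_distrib distrib_right)
        finally have "(1 + \<delta>\<^sub>2 / 2) * (norm (?v \<tau>))\<^sup>2 \<le> A * a\<^sup>2"
          unfolding A_def mult.assoc using \<delta> by (intro mult_left_mono) auto
        then have "e * ((1 + \<delta>\<^sub>2 / 2) * (norm (?v \<tau>))\<^sup>2) \<le> e * (A * a\<^sup>2)"
          using e by (intro mult_left_mono) auto
        also have "\<dots> \<le> \<delta>\<^sub>3 / 2 * a powr (\<alpha> + 2) + e * \<delta>\<^sub>2 * m / 4"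
          by (rule quadratic[OF m(1) e_def]) (simp add: a_def)
        finally have quad: "e * ((1 + \<delta>\<^sub>2 / 2) * (norm (?v \<tau>))\<^sup>2)
            \<le> \<delta>\<^sub>3 / 2 * a powr (\<alpha> + 2) + e * \<delta>\<^sub>2 * m / 4" .
        have "\<delta>\<^sub>2 * (m - (norm (?v \<tau>))\<^sup>2 / 2) \<le> \<delta>\<^sub>2 * F (u \<tau>)"
          using level(1)[OF \<tau>(1,2)] \<delta> by (intro mult_left_mono) (auto simp: E_def)
        then have "e * (\<delta>\<^sub>2 * (m - (norm (?v \<tau>))\<^sup>2 / 2)) \<le> e * G (u \<tau>) (u \<tau>)"
          using e order_trans[OF _ G2] by (intro mult_left_mono) auto
        then show ?thesis
          using gx gu mix quad by (simp add: algebra_simps)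
      qed
      then have "AE \<tau> in lebesgue_on {0<..<T}. \<tau> \<in> {s<..<r} \<longrightarrow> (\<forall>x. ?j x = ?v \<tau> \<longrightarrow>
          - g \<tau> x x + e * ((norm (?v \<tau>))\<^sup>2 - G (u \<tau>) (u \<tau>) - g \<tau> x (u \<tau>)) + e * \<delta>\<^sub>2 * m / 2 \<le> 0)"
        by (intro AE_T) auto
      from energy(3)[OF sr(1,2) _ this] sr T
      have "E r + e * inner (?v r) (?j (u r)) + e * \<delta>\<^sub>2 * m / 2 * (r - s) \<le> E s + e * inner (?v s) (?j (u s))"
        by (simp add: E_def)
      moreover have "\<bar>e * inner (?v \<tau>) (?j (u \<tau>))\<bar> \<le> m" if "s \<le> \<tau>" "\<tau> \<le> r" for \<tau>
        using cross_le[OF that] e by (simp add: abs_mult)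
      from this[of r] this[of s] have "\<bar>e * inner (?v r) (?j (u r))\<bar> \<le> m" "\<bar>e * inner (?v s) (?j (u s))\<bar> \<le> m"
        using sr by auto
      \<comment> \<open>\<open>E s \<le> 2 * m\<close>, \<open>E r \<ge> 0\<close> and two cross
        terms of size at most \<open>m\<close> give \<open>4 * m\<close>.\<close>
      ultimately have "e * \<delta>\<^sub>2 * m / 2 * (r - s) \<le> 4 * m"
        using m by linarith
      then have "m * (e * \<delta>\<^sub>2 * (r - s)) \<le> m * 8" by (simp add: algebra_simps)
      then have "e * \<delta>\<^sub>2 * (r - s) \<le> 8" using m(1) by (simp only: mult_le_cancel_left_pos)
      then have "r - s \<le> 8 / (e * \<delta>\<^sub>2)" using e \<delta> by (simp add: pos_le_divide_eq mult.commute)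
      also have "\<dots> = C * (1 / min (m powr (\<alpha> / 2)) (m powr \<gamma>))"
        by (simp add: C_def e_def mult_ac)
      also have "1 / min (m powr (\<alpha> / 2)) (m powr \<gamma>) \<le> m powr (- (\<alpha> / 2)) + m powr (- \<gamma>)"
        by (auto simp: min_def powr_minus_divide)
      finally show "r - s \<le> C * (m powr (- (\<alpha> / 2)) + m powr (- \<gamma>))"
        using \<open>0 < C\<close> by simp
    qed
    then show ?thesis
      using F0[of "u t"] by (simp add: E_def)
  qed
  then show ?thesis
    by (intro exI[of _ "2 * D"]) blast
qed

end
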